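(* Let $(M^n,g)$, $n\ge 3$, be a (pseudo-)Riemannian manifold and consider the Poisson equation $$\Delta_g u+f(u)=0 \qquad (P_f)$$ on $M^n$. Then the following hold. 1) The Lie point symmetry group of $(P_f)$ with an arbitrary $f$ coincides with the isometry group of $M^n$: the infinitesimal generators are exactly $X=\xi=\xi^i(x)\frac{\partial}{\partial x^i}$ with $\mathcal L_\xi g_{ij}=0$. For some special choices of $f$ the symmetry group can be extended, in the following cases. 2) If $f(u)=0$, the symmetries are $$X=\xi^i(x)\frac{\partial}{\partial x^i}+\Big[\Big(\tfrac{2-n}{4}\mu(x)+c\Big)u+b(x)\Big]\frac{\partial}{\partial u},$$ where $c$ is an arbitrary constant, $\Delta_g b=0$, $\Delta_g\mu=0$, and $\xi=\xi^i\frac{\partial}{\partial x^i}$ is a conformal Killing vector field with $\mathcal L_\xi g_{ij}=\mu g_{ij}$. 3) If $f(u)=k$ with $k\ne 0$ constant, the symmetries are $$X=\xi^i(x)\frac{\partial}{\partial x^i}+\Big[\Big(\tfrac{n-2}{n+2}\big(\tfrac1k\Delta_g b-c\big)+c\Big)u+b(x)\Big]\frac{\partial}{\partial u},$$ where $c$ is an arbitrary constant, $\Delta_g^2 b=0$, and $\xi$ is a conformal Killing vector field with $\mathcal L_\xi g_{ij}=\mu g_{ij}$, where $\mu=\frac{4}{n+2}\big(c-\frac1k\Delta_g b\big)$. 4) If $f(u)=u$, the symmetries are $$X=\xi^i(x)\frac{\partial}{\partial x^i}+\Big[\Big(\tfrac{2-n}{4}\mu(x)+c\Big)u+b(x)\Big]\frac{\partial}{\partial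 u},$$ where $c$ is an arbitrary constant, $\mathcal L_\xi g_{ij}=\mu g_{ij}$, $\Delta_g b+b=0$ and $\frac{2-n}{4}\Delta_g\mu+\mu=0$. 5) If $f(u)=e^u$, the symmetries are $$X=\xi^i(x)\frac{\partial}{\partial x^i}-\mu\frac{\partial}{\partial u},$$ where $\mu$ is a constant and $\xi$ is a homothety with $\mathcal L_\xi g_{ij}=\mu g_{ij}$. 6) If $f(u)=u^p$ with $p\neq 0$, $p\ne 1$ and $p\neq\frac{n+2}{n-2}$, the symmetries are $$X=\xi^i(x)\frac{\partial}{\partial x^i}+\frac{\mu}{1-p}\,u\,\frac{\partial}{\partial u},$$ where $\mu$ is a constant and $\xi$ is a homothety with $\mathcal L_\xi g_{ij}=\mu g_{ij}$. 6.1) If $f(u)=u^p$ with $p=\frac{n+2}{n-2}$ and $n\neq 6$, the symmetries are $$X=\xi^i(x)\frac{\partial}{\partial x^i}+\frac{2-n}{4}\mu\,u\,\frac{\partial}{\partial u},$$ where $\mathcal L_\xi g_{ij}=\mu g_{ij}$ and $\mu$ is a harmonic function, $\Delta_g\mu=0$. 6.2) If $f(u)=u^2$ and $n=6$, the symmetries are $$X=\xi^i(x)\frac{\partial}{\partial x^i}+\Big(-\mu(x)u+\tfrac12\Delta_g\mu\Big)\frac{\partial}{\partial u},$$ where $\xi$ is a conformal Killing vector field with $\mathcal L_\xi g_{ij}=\mu g_{ij}$ and $\mu$ is a biharmonic function, $\Delta_g^2\mu=0$.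
   Context: $M^n$ is a connected smooth manifold with (pseudo-)Riemannian metric $g=(g_{ij})$ in local coordinates $(x^1,\dots,x^n)$; the summation convention is used. $\Delta_g u=g^{ij}\nabla_i\nabla_j u=\frac1{\sqrt g}\partial_i(\sqrt g\,g^{ij}\partial_j u)$ is the Laplace–Beltrami operator and $\mathcal L_\xi$ is the Lie derivative. $f$ is a smooth function (for $f(u)=u^p$ one works on a range of $u$ on which $u^p$ is smooth, e.g. $u>0$). The functions $b,\mu$ on $M$ are smooth. A conformal Killing field is a vector field $\xi$ with $\mathcal L_\xi g_{ij}=\mu g_{ij}$ for some function $\mu$; it is a homothety if $\mu$ is constant and a Killing field (infinitesimal isometry) if $\mu=0$. Equation $(P_f)$ is equivalent to $H:=g^{ij}u_{ij}-\Gamma^iu_i+f(u)=0$, with $\Gamma^i=g^{pq}\Gamma^i_{pq}$, $u_i=\partial u/\partial x^i$, $u_{ij}=\partial^2u/\partial x^i\partial x^j$. A Lie point symmetry (infinitesimal generator) of $(P_f)$ is a vector field $X=\xi^i(x,u)\frac{\partial}{\partial x^i}+\eta(x,u)\frac{\partial}{\partial u}$ on $M\times\mathbb R$ whose second prolongation $X^{(2)}$ satisfies $X^{(2)}H=0$ whenever $H=0$. Groups are identified with their Lie algebras of infinitesimal generators. The Lie point symmetries of $(P_f)$ "with an arbitrary $f$" are the fields $X$ which are Lie point symmetries of $(P_f)$ for every smooth $f$. In each special case, "the symmetries are" means that $X$ is a Lie point symmetry if and only if it has the given form. *)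

theory Defs
  imports "HOL-Analysis.Analysis"
begin

subsection \<open>Smooth functions and partial derivatives\<close>

text \<open>Meant for open \<open>S\<close>, since the derivatives are those of the ambient space.\<close>

fun times_differentiable_on ::
  "nat \<Rightarrow> 'a::real_normed_vector set \<Rightarrow> ('a \<Rightarrow> 'b::real_normed_vector) \<Rightarrow> bool" where
  "times_differentiable_on 0 S F \<longleftrightarrow> continuous_on S F"
| "times_differentiable_on (Suc k) S F \<longleftrightarrow>
     (\<forall>x\<in>S. F differentiable (at x)) \<and>
     (\<forall>v. times_differentiable_on k S (\<lambda>x. frechet_derivative F (at x) v))"

definition smooth_on :: "'a::real_normed_vector set \<Rightarrow> ('a \<Rightarrow> 'b::real_normed_vector) \<Rightarrow> bool" where
  "smooth_on S F \<longleftrightarrow> (\<forall>k. times_differentiable_on k S F)"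

definition partial :: "'n::finite \<Rightarrow> (real^'n \<Rightarrow> 'b::real_normed_vector) \<Rightarrow> real^'n \<Rightarrow> 'b" where
  "partial i F x = frechet_derivative F (at x) (axis i 1)"


subsection \<open>Smooth manifolds\<close>

text \<open>A chart is an open set of the manifold with its coordinate map. The dimension is
  the cardinality of the index type \<open>'n\<close>. The atlas need not be maximal.\<close>

type_synonym ('a,'n) chart = "'a set \<times> ('a \<Rightarrow> real^'n)"

definition chart_range :: "('a,'n) chart \<Rightarrow> (real^'n) set" where
  "chart_range c = snd c ` fst c"

definition chart_overlap :: "('a,'n) chart \<Rightarrow> ('a,'n) chart \<Rightarrow> (real^'n) set" where
  "chart_overlap c d = snd c ` (fst c \<inter> fst d)"

definition transition :: "('a,'n) chart \<Rightarrow> ('a,'n) chart \<Rightarrow> real^'n \<Rightarrow> real^'n" where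
  "transition c d = snd d \<circ> inv_into (fst c) (snd c)"

definition is_chart :: "'a topology \<Rightarrow> ('a,'n::finite) chart \<Rightarrow> bool" where
  "is_chart X c \<longleftrightarrow> openin X (fst c) \<and> open (chart_range c) \<and>
     homeomorphic_map (subtopology X (fst c)) (top_of_set (chart_range c)) (snd c)"

definition smooth_manifold :: "'a topology \<Rightarrow> ('a,'n::finite) chart set \<Rightarrow> bool" where
  "smooth_manifold X A \<longleftrightarrow>
     Hausdorff_space X \<and> second_countable X \<and>
     (\<forall>c\<in>A. is_chart X c) \<and> (\<Union>c\<in>A. fst c) = topspace X \<and>
     (\<forall>c\<in>A. \<forall>d\<in>A. smooth_on (chart_overlap c d) (transition c d))"


subsection \<open>Fields in local coordinates\<close>

text \<open>A tensor field is given by its components in each chart of the atlas, as functions of the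
  coordinates on the range of that chart, subject to the tensorial transformation law on overlaps.
  Values outside the range of the chart are irrelevant.\<close>

type_synonym ('a,'n) scalar_comps = "('a,'n) chart \<Rightarrow> real^'n \<Rightarrow> real"
type_synonym ('a,'n) vector_comps = "('a,'n) chart \<Rightarrow> real^'n \<Rightarrow> real^'n"
type_synonym ('a,'n) metric_comps = "('a,'n) chart \<Rightarrow> real^'n \<Rightarrow> real^'n^'n"

definition transition_jacobian ::
  "('a,'n::finite) chart \<Rightarrow> ('a,'n) chart \<Rightarrow> real^'n \<Rightarrow> real^'n^'n" where
  "transition_jacobian c d x = (\<chi> i j. partial j (transition c d) x $ i)"

definition smooth_function :: "('a,'n::finite) chart set \<Rightarrow> ('a,'n) scalar_comps \<Rightarrow> bool" where
  "smooth_function A b \<longleftrightarrow>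
     (\<forall>c\<in>A. smooth_on (chart_range c) (b c)) \<and>
     (\<forall>c\<in>A. \<forall>d\<in>A. \<forall>x\<in>chart_overlap c d. b d (transition c d x) = b c x)"

definition smooth_vector_field :: "('a,'n::finite) chart set \<Rightarrow> ('a,'n) vector_comps \<Rightarrow> bool" where
  "smooth_vector_field A \<xi> \<longleftrightarrow>
     (\<forall>c\<in>A. smooth_on (chart_range c) (\<xi> c)) \<and>
     (\<forall>c\<in>A. \<forall>d\<in>A. \<forall>x\<in>chart_overlap c d.
        \<xi> d (transition c d x) = transition_jacobian c d x *v \<xi> c x)"

text \<open>On a connected manifold the signature of a nondegenerate continuous metric is constant,
  so nondegeneracy is all that is required; the Riemannian case is included.\<close>

definition pseudo_riemannian_metric ::
  "('a,'n::finite) chart set \<Rightarrow> ('a,'n) metric_comps \<Rightarrow> bool" where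
  "pseudo_riemannian_metric A g \<longleftrightarrow>
     (\<forall>c\<in>A. smooth_on (chart_range c) (g c)) \<and>
     (\<forall>c\<in>A. \<forall>x\<in>chart_range c. transpose (g c x) = g c x \<and> invertible (g c x)) \<and>
     (\<forall>c\<in>A. \<forall>d\<in>A. \<forall>x\<in>chart_overlap c d.
        g c x = transpose (transition_jacobian c d x) ** g d (transition c d x)
                  ** transition_jacobian c d x)"


subsection \<open>Laplace--Beltrami operator and conformal Killing fields\<close>

text \<open>In this section \<open>G\<close> is the component matrix \<open>(g\<^sub>i\<^sub>j)\<close> in one fixed chart.\<close>

definition inverse_metric :: "(real^'n \<Rightarrow> real^'n^'n) \<Rightarrow> 'n::finite \<Rightarrow> 'n \<Rightarrow> real^'n \<Rightarrow> real" where
  "inverse_metric G i j x = matrix_inv (G x) $ i $ j"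

definition christoffel ::
  "(real^'n \<Rightarrow> real^'n^'n) \<Rightarrow> 'n::finite \<Rightarrow> 'n \<Rightarrow> 'n \<Rightarrow> real^'n \<Rightarrow> real" where
  "christoffel G i p q x = (\<Sum>l\<in>UNIV. inverse_metric G i l x / 2 *
     (partial p (\<lambda>y. G y $ l $ q) x + partial q (\<lambda>y. G y $ l $ p) x
        - partial l (\<lambda>y. G y $ p $ q) x))"

definition contracted_christoffel ::
  "(real^'n \<Rightarrow> real^'n^'n) \<Rightarrow> 'n::finite \<Rightarrow> real^'n \<Rightarrow> real" where
  "contracted_christoffel G i x =
     (\<Sum>p\<in>UNIV. \<Sum>q\<in>UNIV. inverse_metric G p q x * christoffel G i p q x)"

text \<open>The Laplacian as a function of the first derivatives \<open>p = (u\<^sub>i)\<close> and the second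
  derivatives \<open>q = (u\<^sub>i\<^sub>j)\<close>.\<close>

definition laplace_jet ::
  "(real^'n \<Rightarrow> real^'n^'n) \<Rightarrow> real^'n \<Rightarrow> real^'n::finite \<Rightarrow> real^'n^'n \<Rightarrow> real" where
  "laplace_jet G x p q =
     (\<Sum>i\<in>UNIV. \<Sum>j\<in>UNIV. inverse_metric G i j x * q $ i $ j)
     - (\<Sum>i\<in>UNIV. contracted_christoffel G i x * p $ i)"

definition laplacian ::
  "('a,'n::finite) metric_comps \<Rightarrow> ('a,'n) scalar_comps \<Rightarrow> ('a,'n) scalar_comps" where
  "laplacian g b = (\<lambda>c x.
     laplace_jet (g c) x (\<chi> i. partial i (b c) x) (\<chi> i j. partial i (partial j (b c)) x))"

definition vanishes :: "('a,'n::finite) chart set \<Rightarrow> ('a,'n) scalar_comps \<Rightarrow> bool" where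
  "vanishes A b \<longleftrightarrow> (\<forall>c\<in>A. \<forall>x\<in>chart_range c. b c x = 0)"

definition lie_derivative_metric ::
  "(real^'n \<Rightarrow> real^'n) \<Rightarrow> (real^'n \<Rightarrow> real^'n^'n) \<Rightarrow> 'n::finite \<Rightarrow> 'n \<Rightarrow> real^'n \<Rightarrow> real" where
  "lie_derivative_metric v G i j x =
     (\<Sum>k\<in>UNIV. v x $ k * partial k (\<lambda>y. G y $ i $ j) x
        + G x $ k $ j * partial i (\<lambda>y. v y $ k) x
        + G x $ i $ k * partial j (\<lambda>y. v y $ k) x)"

definition conformal_killing_field ::
  "('a,'n::finite) chart set \<Rightarrow> ('a,'n) metric_comps \<Rightarrow> ('a,'n) vector_comps
     \<Rightarrow> ('a,'n) scalar_comps \<Rightarrow> bool" where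
  "conformal_killing_field A g \<xi> \<mu> \<longleftrightarrow>
     smooth_vector_field A \<xi> \<and> smooth_function A \<mu> \<and>
     (\<forall>c\<in>A. \<forall>x\<in>chart_range c. \<forall>i j.
        lie_derivative_metric (\<xi> c) (g c) i j x = \<mu> c x * g c x $ i $ j)"

definition homothety ::
  "('a,'n::finite) chart set \<Rightarrow> ('a,'n) metric_comps \<Rightarrow> ('a,'n) vector_comps \<Rightarrow> real \<Rightarrow> bool" where
  "homothety A g \<xi> m \<longleftrightarrow> conformal_killing_field A g \<xi> (\<lambda>c x. m)"

definition killing_field ::
  "('a,'n::finite) chart set \<Rightarrow> ('a,'n) metric_comps \<Rightarrow> ('a,'n) vector_comps \<Rightarrow> bool" where
  "killing_field A g \<xi> \<longleftrightarrow> homothety A g \<xi> 0"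


subsection \<open>Vector fields on \<open>M \<times> J\<close> and their second prolongation\<close>

text \<open>A field \<open>\<xi>\<^sup>i(x,u) \<partial>/\<partial>x\<^sup>i + \<eta>(x,u) \<partial>/\<partial>u\<close> on the product of the manifold with an open
  interval \<open>J\<close> of values of \<open>u\<close>, given by the pair \<open>(\<xi>, \<eta>)\<close> in each product chart. The transition
  maps of product charts leave \<open>u\<close> fixed, so \<open>\<eta>\<close> transforms as a scalar.\<close>

type_synonym ('a,'n) point_field =
  "('a,'n) chart \<Rightarrow> ((real^'n) \<times> real \<Rightarrow> real^'n) \<times> ((real^'n) \<times> real \<Rightarrow> real)"

definition smooth_point_field ::
  "('a,'n::finite) chart set \<Rightarrow> real set \<Rightarrow> ('a,'n) point_field \<Rightarrow> bool" where
  "smooth_point_field A J V \<longleftrightarrow>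
     (\<forall>c\<in>A. smooth_on (chart_range c \<times> J) (fst (V c)) \<and>
             smooth_on (chart_range c \<times> J) (snd (V c))) \<and>
     (\<forall>c\<in>A. \<forall>d\<in>A. \<forall>x\<in>chart_overlap c d. \<forall>u\<in>J.
        fst (V d) (transition c d x, u) = transition_jacobian c d x *v fst (V c) (x, u) \<and>
        snd (V d) (transition c d x, u) = snd (V c) (x, u))"

text \<open>Jet coordinates are \<open>(x, u, p, q)\<close> with \<open>p = (u\<^sub>i)\<close> and \<open>q = (u\<^sub>i\<^sub>j)\<close>. The total derivative
  \<open>D\<^sub>i\<close> is the derivative in the direction \<open>\<partial>\<^sub>i + u\<^sub>i \<partial>/\<partial>u\<close>, respectively
  \<open>\<partial>\<^sub>i + u\<^sub>i \<partial>/\<partial>u + u\<^sub>i\<^sub>j \<partial>/\<partial>u\<^sub>j\<close>.\<close>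

definition total_derivative0 ::
  "'n::finite \<Rightarrow> ((real^'n) \<times> real \<Rightarrow> real) \<Rightarrow> (real^'n) \<times> real \<times> (real^'n) \<Rightarrow> real" where
  "total_derivative0 i F = (\<lambda>(x, u, p). frechet_derivative F (at (x, u)) (axis i 1, p $ i))"

definition total_derivative1 ::
  "'n::finite \<Rightarrow> ((real^'n) \<times> real \<times> (real^'n) \<Rightarrow> real)
     \<Rightarrow> (real^'n) \<times> real \<times> (real^'n) \<times> (real^'n^'n) \<Rightarrow> real" where
  "total_derivative1 i F =
     (\<lambda>(x, u, p, q). frechet_derivative F (at (x, u, p)) (axis i 1, p $ i, q $ i))"

definition prolong_coeff1 ::
  "((real^'n) \<times> real \<Rightarrow> real^'n) \<Rightarrow> ((real^'n) \<times> real \<Rightarrow> real) \<Rightarrow> 'n::finite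
     \<Rightarrow> (real^'n) \<times> real \<times> (real^'n) \<Rightarrow> real" where
  "prolong_coeff1 \<xi> \<eta> i = (\<lambda>(x, u, p).
     total_derivative0 i \<eta> (x, u, p)
     - (\<Sum>k\<in>UNIV. p $ k * total_derivative0 i (\<lambda>z. \<xi> z $ k) (x, u, p)))"

definition prolong_coeff2 ::
  "((real^'n) \<times> real \<Rightarrow> real^'n) \<Rightarrow> ((real^'n) \<times> real \<Rightarrow> real) \<Rightarrow> 'n::finite \<Rightarrow> 'n
     \<Rightarrow> (real^'n) \<times> real \<times> (real^'n) \<times> (real^'n^'n) \<Rightarrow> real" where
  "prolong_coeff2 \<xi> \<eta> i j = (\<lambda>(x, u, p, q).
     total_derivative1 j (prolong_coeff1 \<xi> \<eta> i) (x, u, p, q)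
     - (\<Sum>k\<in>UNIV. q $ i $ k * total_derivative0 j (\<lambda>z. \<xi> z $ k) (x, u, p)))"

definition prolongation2 ::
  "((real^'n) \<times> real \<Rightarrow> real^'n) \<Rightarrow> ((real^'n) \<times> real \<Rightarrow> real)
     \<Rightarrow> ((real^'n) \<times> real \<times> (real^'n) \<times> (real^'n^'n) \<Rightarrow> real)
     \<Rightarrow> (real^'n) \<times> real \<times> (real^'n) \<times> (real^'n^'n::finite) \<Rightarrow> real" where
  "prolongation2 \<xi> \<eta> H = (\<lambda>(x, u, p, q).
     frechet_derivative H (at (x, u, p, q))
       (\<xi> (x, u), \<eta> (x, u), (\<chi> i. prolong_coeff1 \<xi> \<eta> i (x, u, p)),
        (\<chi> i j. prolong_coeff2 \<xi> \<eta> i j (x, u, p, q))))"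


subsection \<open>Lie point symmetries of the Poisson equation\<close>

definition poisson_jet ::
  "(real^'n \<Rightarrow> real^'n^'n) \<Rightarrow> (real \<Rightarrow> real)
     \<Rightarrow> (real^'n) \<times> real \<times> (real^'n) \<times> (real^'n^'n::finite) \<Rightarrow> real" where
  "poisson_jet G f = (\<lambda>(x, u, p, q). laplace_jet G x p q + f u)"

definition lie_point_symmetry ::
  "('a,'n::finite) chart set \<Rightarrow> ('a,'n) metric_comps \<Rightarrow> real set \<Rightarrow> (real \<Rightarrow> real)
     \<Rightarrow> ('a,'n) point_field \<Rightarrow> bool" where
  "lie_point_symmetry A g J f V \<longleftrightarrow>
     smooth_point_field A J V \<and>
     (\<forall>c\<in>A. \<forall>x\<in>chart_range c. \<forall>u\<in>J. \<forall>p q.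
        transpose q = q \<longrightarrow> poisson_jet (g c) f (x, u, p, q) = 0 \<longrightarrow>
        prolongation2 (fst (V c)) (snd (V c)) (poisson_jet (g c) f) (x, u, p, q) = 0)"

text \<open>\<open>V = \<xi>\<^sup>i(x) \<partial>/\<partial>x\<^sup>i + h(x,u) \<partial>/\<partial>u\<close> on \<open>M \<times> J\<close>.\<close>

definition field_eq ::
  "('a,'n::finite) chart set \<Rightarrow> real set \<Rightarrow> ('a,'n) point_field \<Rightarrow> ('a,'n) vector_comps
     \<Rightarrow> (('a,'n) chart \<Rightarrow> real^'n \<Rightarrow> real \<Rightarrow> real) \<Rightarrow> bool" where
  "field_eq A J V \<xi> h \<longleftrightarrow>
     (\<forall>c\<in>A. \<forall>x\<in>chart_range c. \<forall>u\<in>J. fst (V c) (x, u) = \<xi> c x \<and> snd (V c) (x, u) = h c x u)"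

text \<open>\<open>f(u) = u\<^sup>p\<close> on an interval \<open>J\<close> where this power is smooth: any real \<open>p\<close> for positive \<open>u\<close>;
  for integer \<open>p\<close> also negative \<open>u\<close>, and \<open>u = 0\<close> unless \<open>p < 0\<close>.\<close>

definition power_function_on :: "real \<Rightarrow> real set \<Rightarrow> (real \<Rightarrow> real) \<Rightarrow> bool" where
  "power_function_on p J f \<longleftrightarrow>
     (J \<subseteq> {0<..} \<and> (\<forall>u\<in>J. f u = u powr p)) \<or>
     (\<exists>k::int. p = of_int k \<and> (k \<ge> 0 \<or> 0 \<notin> J) \<and> (\<forall>u\<in>J. f u = u powi k))"

definition open_interval :: "real set \<Rightarrow> bool" where
  "open_interval J \<longleftrightarrow> open J \<and> connected J \<and> J \<noteq> {}"

end

theory Submission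
  imports Defs
begin

text \<open>
  Contracting the second prolongation with \<open>g\<^sup>i\<^sup>j\<close> and subtracting two jets on \<open>H = 0\<close> with the same
  \<open>(x, u, p)\<close> leaves a linear form in the second derivatives that vanishes on all symmetric
  trace-free matrices, hence is a multiple of \<open>g\<^sup>i\<^sup>j\<close>. Its dependence on \<open>p\<close> forces \<open>\<xi>\<^sub>u = 0\<close>, and at
  \<open>p = 0\<close> it says that \<open>\<xi>\<close> is conformal Killing. The terms quadratic in \<open>p\<close> give \<open>\<eta> = a(x) u + b(x)\<close>.
  By the formula for the Lie derivative of the contracted Christoffel symbols, what remains is
  \<open>4 a\<^sub>i = (2 - n) \<mu>\<^sub>i\<close>, so \<open>a = (2 - n) \<mu> / 4 + C\<close> by connectedness, together with
  \<open>(\<Delta>a) u + \<Delta>b + (a u + b) f'(u) = (a - \<mu>) f(u)\<close>, which is solved for each \<open>f\<close> by comparing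
  linearly independent functions of \<open>u\<close>. That \<open>\<mu>\<close> does not depend on the chart follows from the
  naturality of the Lie derivative of \<open>g\<close>.
\<close>

subsection \<open>Smooth functions\<close>

text \<open>The equation \<open>H = 0\<close> is affine in the second derivatives with nonzero
  coefficient matrix g^{-1}, so over every (x, u, p) it can be solved for a symmetric q. This turns
  the symmetry condition into polynomial identities in a free p. Of the nonlinearity only f(u) and
  f'(u) enter, so all cases share one set of determining equations. The signature is arbitrary:
  where positivity of g would be used, the Frobenius inner product of matrices or a covector chosen
  non-null takes its place. Two degeneracies in u organise the power cases. The coefficient of u^p
  is a (p - 1) + \<mu>, and \<mu> cancels in it precisely if (2 - n)(p - 1) / 4 = -1, the critical
  exponent. For p = 2 the term b f' = 2 b u merges with the term linear in u, so b is no longer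
  forced to vanish by independence; both happen at once only for n = 6. The statement about
  arbitrary f is decided by the single test function exp u + 1. In each chart the coefficients are
  given by explicit formulas at one fixed u0 rather than by choice, so they can be compared on
  overlaps.\<close>

lemma frechet_derivative_cong:
  assumes "open S" "x \<in> S" "\<And>y. y \<in> S \<Longrightarrow> F y = G y"
  shows "frechet_derivative F (at x) = frechet_derivative G (at x)"
proof -
  have "(F has_derivative D) (at x) \<longleftrightarrow> (G has_derivative D) (at x)" for D
    using assms has_derivative_transform_within_open[of F D x UNIV S G]
      has_derivative_transform_within_open[of G D x UNIV S F] by auto
  then show ?thesis unfolding frechet_derivative_def by simp
qed

lemma differentiable_cong_open:
  assumes "open S" "x \<in> S" "\<And>y. y \<in> S \<Longrightarrow> F y = G y"
  shows "F differentiable (at x) \<longleftrightarrow> G differentiable (at x)"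
  using assms has_derivative_transform_within_open[of F _ x UNIV S G]
    has_derivative_transform_within_open[of G _ x UNIV S F]
  unfolding differentiable_def by metis

lemma frechet_derivativeI:
  "(F has_derivative D) (at x) \<Longrightarrow> frechet_derivative F (at x) = D"
  using frechet_derivative_at by metis

lemma frechet_derivative_works_at:
  "F differentiable (at x) \<Longrightarrow> (F has_derivative frechet_derivative F (at x)) (at x)"
  using frechet_derivative_works by blast

lemma times_differentiable_on_cong:
  assumes "open S" "\<And>y. y \<in> S \<Longrightarrow> F y = G y"
  shows "times_differentiable_on k S F \<longleftrightarrow> times_differentiable_on k S G"
  using assms(2)
proof (induction k arbitrary: F G)
  case 0
  then show ?case by (auto cong: continuous_on_cong)
next
  case (Suc k)
  have "frechet_derivative F (at x) = frechet_derivative G (at x)" if "x \<in> S" for x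
    using frechet_derivative_cong assms(1) that Suc.prems by metis
  then have "times_differentiable_on k S (\<lambda>x. frechet_derivative F (at x) v) \<longleftrightarrow>
     times_differentiable_on k S (\<lambda>x. frechet_derivative G (at x) v)" for v
    by (intro Suc.IH) auto
  moreover have "F differentiable (at x) \<longleftrightarrow> G differentiable (at x)" if "x \<in> S" for x
    by (rule differentiable_cong_open[OF assms(1) that Suc.prems])
  ultimately show ?case by auto
qed

text \<open>\<open>frechet_derivative\<close> is a choice operator; on an open set any explicit
  derivative may be supplied in its place, which is how all the closure properties below are
  proved.\<close>

lemma times_differentiable_on_SucI:
  assumes "open S" "\<And>x. x \<in> S \<Longrightarrow> (F has_derivative F' x) (at x)"
    "\<And>v. times_differentiable_on k S (\<lambda>x. F' x v)"
  shows "times_differentiable_on (Suc k) S F"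
proof -
  have "times_differentiable_on k S (\<lambda>x. frechet_derivative F (at x) v)" for v
    using times_differentiable_on_cong[OF assms(1), of "\<lambda>x. frechet_derivative F (at x) v" "\<lambda>x. F' x v"]
      frechet_derivativeI[OF assms(2)] assms(3) by auto
  then show ?thesis using assms(2) by (auto simp: differentiable_def)
qed

lemma times_differentiable_on_Suc_has_derivative:
  "times_differentiable_on (Suc k) S F \<Longrightarrow> x \<in> S \<Longrightarrow>
    (F has_derivative frechet_derivative F (at x)) (at x)"
  by (auto intro: frechet_derivative_works_at)

text \<open>The product and reciprocal rules produce derivatives that still contain the
  undifferentiated functions; the inductions need these at the lower order.\<close>

lemma times_differentiable_on_SucD:
  "times_differentiable_on (Suc k) S F \<Longrightarrow> times_differentiable_on k S F"
proof (induction k arbitrary: F)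
  case 0
  then show ?case
    by (auto intro!: continuous_at_imp_continuous_on differentiable_imp_continuous_within)
next
  case (Suc k)
  then show ?case by (metis times_differentiable_on.simps(2))
qed

lemma times_differentiable_on_const: "times_differentiable_on k S (\<lambda>x. c)"
proof (induction k arbitrary: c)
  case (Suc k)
  have "frechet_derivative (\<lambda>x. c) (at x) v = 0" for x v
    by (simp add: frechet_derivative_const)
  with Suc show ?case by simp
qed auto

lemma times_differentiable_on_bounded_linear:
  assumes "open S" "bounded_linear L" "times_differentiable_on k S F"
  shows "times_differentiable_on k S (\<lambda>x. L (F x))"
  using assms(3)
proof (induction k arbitrary: F)
  case 0
  then show ?case
    using bounded_linear.continuous_on[OF assms(2)] by simp
next
  case (Suc k)
  show ?case
  proof (rule times_differentiable_on_SucI[OF assms(1)])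
    fix x assume "x \<in> S"
    show "((\<lambda>x. L (F x)) has_derivative (\<lambda>v. L (frechet_derivative F (at x) v))) (at x)"
      by (rule bounded_linear.has_derivative[OF assms(2)])
        (rule times_differentiable_on_Suc_has_derivative[OF Suc.prems \<open>x \<in> S\<close>])
  qed (use Suc in simp)
qed

lemma times_differentiable_on_add:
  assumes "open S" "times_differentiable_on k S F" "times_differentiable_on k S G"
  shows "times_differentiable_on k S (\<lambda>x. F x + G x)"
  using assms(2,3)
proof (induction k arbitrary: F G)
  case 0
  then show ?case by (auto intro: continuous_intros)
next
  case (Suc k)
  show ?case
  proof (rule times_differentiable_on_SucI[OF assms(1)])
    fix x assume "x \<in> S"
    show "((\<lambda>x. F x + G x) has_derivative
        (\<lambda>v. frechet_derivative F (at x) v + frechet_derivative G (at x) v)) (at x)"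
      using Suc.prems[THEN times_differentiable_on_Suc_has_derivative, OF \<open>x \<in> S\<close>]
      by (rule has_derivative_add)
  qed (use Suc in simp)
qed

lemma times_differentiable_on_bilinear:
  assumes "open S" "bounded_bilinear B" "times_differentiable_on k S F" "times_differentiable_on k S G"
  shows "times_differentiable_on k S (\<lambda>x. B (F x) (G x))"
  using assms(3,4)
proof (induction k arbitrary: F G)
  case 0
  then show ?case using bounded_bilinear.continuous_on[OF assms(2)] by simp
next
  case (Suc k)
  show ?case
  proof (rule times_differentiable_on_SucI[OF assms(1)])
    fix x assume "x \<in> S"
    show "((\<lambda>x. B (F x) (G x)) has_derivative
        (\<lambda>v. B (F x) (frechet_derivative G (at x) v) + B (frechet_derivative F (at x) v) (G x))) (at x)"
      using Suc.prems[THEN times_differentiable_on_Suc_has_derivative, OF \<open>x \<in> S\<close>]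
      by (rule bounded_bilinear.FDERIV[OF assms(2)])
  next
    fix v
    have "times_differentiable_on k S F" "times_differentiable_on k S G"
      using Suc.prems times_differentiable_on_SucD by blast+
    then show "times_differentiable_on k S (\<lambda>x. B (F x) (frechet_derivative G (at x) v) +
        B (frechet_derivative F (at x) v) (G x))"
      using Suc.prems by (intro times_differentiable_on_add[OF assms(1)] Suc.IH) simp_all
  qed
qed

text \<open>The derivative of 1/F is a polynomial in 1/F and F', so the induction hypothesis for 1/F
  itself closes the step.\<close>

lemma times_differentiable_on_inverse:
  fixes F :: "'a::real_normed_vector \<Rightarrow> real"
  assumes "open S" "\<And>x. x \<in> S \<Longrightarrow> F x \<noteq> 0" "times_differentiable_on k S F"
  shows "times_differentiable_on k S (\<lambda>x. inverse (F x))"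
  using assms(3)
proof (induction k)
  case 0
  then show ?case using assms(2) by (auto intro: continuous_intros)
next
  case (Suc k)
  show ?case
  proof (rule times_differentiable_on_SucI[OF assms(1)])
    fix x assume "x \<in> S"
    show "((\<lambda>x. inverse (F x)) has_derivative
        (\<lambda>v. - (inverse (F x) * frechet_derivative F (at x) v * inverse (F x)))) (at x)"
      using times_differentiable_on_Suc_has_derivative[OF Suc.prems \<open>x \<in> S\<close>] assms(2) \<open>x \<in> S\<close>
      by (intro Deriv.has_derivative_inverse) auto
  next
    fix v
    have 1: "times_differentiable_on k S (\<lambda>x. inverse (F x))"
      using Suc times_differentiable_on_SucD by blast
    have 2: "times_differentiable_on k S (\<lambda>x. frechet_derivative F (at x) v)"
      using Suc by simp
    show "times_differentiable_on k S (\<lambda>x. - (inverse (F x) * frechet_derivative F (at x) v * inverse (F x)))"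
      by (intro times_differentiable_on_bounded_linear[OF assms(1) bounded_linear_minus[OF bounded_linear_ident]]
          times_differentiable_on_bilinear[OF assms(1) bounded_bilinear_mult] 1 2)
  qed
qed

text \<open>An affine inner map has constant derivative, so a directional derivative of the
  composite is again a composite with the same inner map and the induction closes. The use is
  restriction of a function on \<open>U \<times> J\<close> to a slice of fixed u.\<close>

lemma times_differentiable_on_affine:
  assumes "open S" "open T" "bounded_linear L" "\<And>x. x \<in> T \<Longrightarrow> c + L x \<in> S"
    "times_differentiable_on k S F"
  shows "times_differentiable_on k T (\<lambda>x. F (c + L x))"
  using assms(5)
proof (induction k arbitrary: F)
  case 0
  have "continuous_on T (\<lambda>x. c + L x)"
    by (intro continuous_intros bounded_linear.continuous_on[OF assms(3)])
  then show ?case using 0 assms(4)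
    by (auto intro: continuous_on_compose2)
next
  case (Suc k)
  show ?case
  proof (rule times_differentiable_on_SucI[OF assms(2)])
    fix x assume "x \<in> T"
    have "((\<lambda>x. c + L x) has_derivative L) (at x)"
      using has_derivative_add[OF has_derivative_const[of c] bounded_linear_imp_has_derivative[OF assms(3)]]
      by simp
    then show "((\<lambda>x. F (c + L x)) has_derivative (\<lambda>v. frechet_derivative F (at (c + L x)) (L v))) (at x)"
      by (rule has_derivative_compose)
        (rule times_differentiable_on_Suc_has_derivative[OF Suc.prems assms(4)[OF \<open>x \<in> T\<close>]])
  next
    fix v
    show "times_differentiable_on k T (\<lambda>x. frechet_derivative F (at (c + L x)) (L v))"
      by (rule Suc.IH[of "\<lambda>y. frechet_derivative F (at y) (L v)"]) (use Suc.prems in simp)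
  qed
qed

lemma smooth_on_cong: "open S \<Longrightarrow> (\<And>y. y \<in> S \<Longrightarrow> F y = G y) \<Longrightarrow> smooth_on S F \<longleftrightarrow> smooth_on S G"
  unfolding smooth_on_def using times_differentiable_on_cong by metis

lemma smooth_on_eqI:
  "open S \<Longrightarrow> smooth_on S F \<Longrightarrow> (\<And>y. y \<in> S \<Longrightarrow> F y = G y) \<Longrightarrow> smooth_on S G"
  using smooth_on_cong[of S F G] by auto

lemma smooth_on_const: "smooth_on S (\<lambda>x. c)"
  by (simp add: smooth_on_def times_differentiable_on_const)

lemma smooth_on_bounded_linear:
  "open S \<Longrightarrow> bounded_linear L \<Longrightarrow> smooth_on S F \<Longrightarrow> smooth_on S (\<lambda>x. L (F x))"
  by (simp add: smooth_on_def times_differentiable_on_bounded_linear)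

lemma smooth_on_vec_nth: "open S \<Longrightarrow> smooth_on S F \<Longrightarrow> smooth_on S (\<lambda>x. F x $ i)"
  by (rule smooth_on_bounded_linear[OF _ bounded_linear_vec_nth])

lemma smooth_on_mult:
  fixes F G :: "'a::real_normed_vector \<Rightarrow> real"
  shows "open S \<Longrightarrow> smooth_on S F \<Longrightarrow> smooth_on S G \<Longrightarrow> smooth_on S (\<lambda>x. F x * G x)"
  by (simp add: smooth_on_def times_differentiable_on_bilinear[OF _ bounded_bilinear_mult])

lemma smooth_on_add: "open S \<Longrightarrow> smooth_on S F \<Longrightarrow> smooth_on S G \<Longrightarrow> smooth_on S (\<lambda>x. F x + G x)"
  by (simp add: smooth_on_def times_differentiable_on_add)

lemma smooth_on_sum:
  "open S \<Longrightarrow> (\<And>i. i \<in> I \<Longrightarrow> smooth_on S (F i)) \<Longrightarrow> smooth_on S (\<lambda>x. \<Sum>i\<in>I. F i x)"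
  by (induction I rule: infinite_finite_induct) (auto intro: smooth_on_const smooth_on_add)

lemma smooth_on_inverse:
  fixes F :: "'a::real_normed_vector \<Rightarrow> real"
  shows "open S \<Longrightarrow> (\<And>x. x \<in> S \<Longrightarrow> F x \<noteq> 0) \<Longrightarrow> smooth_on S F \<Longrightarrow> smooth_on S (\<lambda>x. inverse (F x))"
  by (simp add: smooth_on_def times_differentiable_on_inverse)

lemma smooth_on_affine:
  "open S \<Longrightarrow> open T \<Longrightarrow> bounded_linear L \<Longrightarrow> (\<And>x. x \<in> T \<Longrightarrow> c + L x \<in> S) \<Longrightarrow>
    smooth_on S F \<Longrightarrow> smooth_on T (\<lambda>x. F (c + L x))"
  by (simp add: smooth_on_def times_differentiable_on_affine)

lemma smooth_on_derivative: "smooth_on S F \<Longrightarrow> smooth_on S (\<lambda>x. frechet_derivative F (at x) v)"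
  unfolding smooth_on_def by (metis times_differentiable_on.simps(2))

lemma smooth_on_partial: "smooth_on S F \<Longrightarrow> smooth_on S (partial i F)"
  unfolding partial_def using smooth_on_derivative by blast

lemma smooth_on_differentiable: "smooth_on S F \<Longrightarrow> x \<in> S \<Longrightarrow> F differentiable (at x)"
  unfolding smooth_on_def by (metis times_differentiable_on.simps(2))

lemma smooth_on_has_derivative:
  "smooth_on S F \<Longrightarrow> x \<in> S \<Longrightarrow> (F has_derivative frechet_derivative F (at x)) (at x)"
  by (rule frechet_derivative_works_at[OF smooth_on_differentiable])

lemma smooth_on_continuous_on: "smooth_on S F \<Longrightarrow> continuous_on S F"
  unfolding smooth_on_def by (metis times_differentiable_on.simps(1))

lemma smooth_on_exp: "smooth_on UNIV (exp :: real \<Rightarrow> real)"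
proof -
  \<comment> \<open>The factor \<open>c\<close> absorbs the direction \<open>v\<close> that each
    differentiation contributes.\<close>
  have "times_differentiable_on k UNIV (\<lambda>x. c * exp x)" for c :: real and k
  proof (induction k arbitrary: c)
    case 0
    then show ?case by (auto intro!: continuous_intros)
  next
    case (Suc k)
    show ?case
    proof (rule times_differentiable_on_SucI)
      show "((\<lambda>x. c * exp x) has_derivative (\<lambda>v. c * v * exp x)) (at x)" for x
        by (auto intro!: derivative_eq_intros)
      show "times_differentiable_on k UNIV (\<lambda>x. c * v * exp x)" for v
        by (rule Suc)
    qed auto
  qed
  from this[where c=1] show ?thesis by (simp add: smooth_on_def)
qed

subsection \<open>Symmetry of second derivatives\<close>

text \<open>The second difference is symmetric in \<open>v\<close> and \<open>w\<close>. The mean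
  value theorem along \<open>v\<close> and then along \<open>w\<close> turns it into one mixed
  derivative at a point of the parallelogram; exchanging the roles gives the other one.\<close>

lemma second_difference:
  fixes F :: "'a::real_normed_vector \<Rightarrow> real"
  assumes "open S" "smooth_on S F" "h > 0"
    "\<And>s t. 0 \<le> s \<Longrightarrow> s \<le> h \<Longrightarrow> 0 \<le> t \<Longrightarrow> t \<le> h \<Longrightarrow> x + s *\<^sub>R v + t *\<^sub>R w \<in> S"
  shows "\<exists>s t. 0 \<le> s \<and> s \<le> h \<and> 0 \<le> t \<and> t \<le> h \<and>
    F (x + h *\<^sub>R v + h *\<^sub>R w) - F (x + h *\<^sub>R v) - F (x + h *\<^sub>R w) + F x =
     h^2 * frechet_derivative (\<lambda>y. frechet_derivative F (at y) v) (at (x + s *\<^sub>R v + t *\<^sub>R w)) w"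
proof -
  define D where "D = (\<lambda>y. frechet_derivative F (at y) v)"
  have smD: "smooth_on S D" unfolding D_def by (rule smooth_on_derivative[OF assms(2)])
  define q where "q = (\<lambda>s. F (x + s *\<^sub>R v + h *\<^sub>R w) - F (x + s *\<^sub>R v + 0 *\<^sub>R w))"
  have dF: "((\<lambda>s. F (x + s *\<^sub>R v + t *\<^sub>R w)) has_real_derivative D (x + s *\<^sub>R v + t *\<^sub>R w)) (at s)"
    if "0 \<le> s" "s \<le> h" "0 \<le> t" "t \<le> h" for s t
  proof -
    have "((\<lambda>s. x + s *\<^sub>R v + t *\<^sub>R w) has_derivative (\<lambda>d. d *\<^sub>R v)) (at s)"
      by (auto intro!: derivative_eq_intros)
    from has_derivative_compose[OF this smooth_on_has_derivative[OF assms(2) assms(4)[OF that]]]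
    have "((\<lambda>s. F (x + s *\<^sub>R v + t *\<^sub>R w)) has_derivative
        (\<lambda>d. frechet_derivative F (at (x + s *\<^sub>R v + t *\<^sub>R w)) (d *\<^sub>R v))) (at s)" .
    moreover have "frechet_derivative F (at (x + s *\<^sub>R v + t *\<^sub>R w)) (d *\<^sub>R v) = D (x + s *\<^sub>R v + t *\<^sub>R w) * d" for d
      unfolding D_def using linear_frechet_derivative[OF smooth_on_differentiable[OF assms(2) assms(4)[OF that]]]
      by (simp add: linear_scale)
    ultimately show ?thesis by (simp add: has_field_derivative_def)
  qed
  have dD: "((\<lambda>t. D (x + s *\<^sub>R v + t *\<^sub>R w)) has_real_derivative
      frechet_derivative D (at (x + s *\<^sub>R v + t *\<^sub>R w)) w) (at t)"
    if "0 \<le> s" "s \<le> h" "0 \<le> t" "t \<le> h" for s t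
  proof -
    have "((\<lambda>t. x + s *\<^sub>R v + t *\<^sub>R w) has_derivative (\<lambda>d. d *\<^sub>R w)) (at t)"
      by (auto intro!: derivative_eq_intros)
    from has_derivative_compose[OF this smooth_on_has_derivative[OF smD assms(4)[OF that]]]
    have "((\<lambda>t. D (x + s *\<^sub>R v + t *\<^sub>R w)) has_derivative
        (\<lambda>d. frechet_derivative D (at (x + s *\<^sub>R v + t *\<^sub>R w)) (d *\<^sub>R w))) (at t)" .
    moreover have "frechet_derivative D (at (x + s *\<^sub>R v + t *\<^sub>R w)) (d *\<^sub>R w)
        = frechet_derivative D (at (x + s *\<^sub>R v + t *\<^sub>R w)) w * d" for d
      using linear_frechet_derivative[OF smooth_on_differentiable[OF smD assms(4)[OF that]]]
      by (simp add: linear_scale)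
    ultimately show ?thesis by (simp add: has_field_derivative_def)
  qed
  have dq: "(q has_real_derivative D (x + s *\<^sub>R v + h *\<^sub>R w) - D (x + s *\<^sub>R v + 0 *\<^sub>R w)) (at s)"
    if "0 \<le> s" "s \<le> h" for s
    unfolding q_def using that assms(3) by (intro DERIV_diff dF) auto
  obtain s where s: "0 < s" "s < h"
    "q h - q 0 = (h - 0) * (D (x + s *\<^sub>R v + h *\<^sub>R w) - D (x + s *\<^sub>R v + 0 *\<^sub>R w))"
    using MVT2[of 0 h q "\<lambda>s. D (x + s *\<^sub>R v + h *\<^sub>R w) - D (x + s *\<^sub>R v + 0 *\<^sub>R w)"] assms(3) dq
    by blast
  obtain t where t: "0 < t" "t < h"
    "D (x + s *\<^sub>R v + h *\<^sub>R w) - D (x + s *\<^sub>R v + 0 *\<^sub>R w) =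
      (h - 0) * frechet_derivative D (at (x + s *\<^sub>R v + t *\<^sub>R w)) w"
    using MVT2[of 0 h "\<lambda>t. D (x + s *\<^sub>R v + t *\<^sub>R w)" "\<lambda>t. frechet_derivative D (at (x + s *\<^sub>R v + t *\<^sub>R w)) w"]
      assms(3) s dD by force
  have "q h - q 0 = h^2 * frechet_derivative D (at (x + s *\<^sub>R v + t *\<^sub>R w)) w"
    using s(3) t(3) by (simp add: power2_eq_square)
  then show ?thesis
    unfolding q_def D_def using s t by (intro exI[of _ s] exI[of _ t]) (auto simp: algebra_simps)
qed

text \<open>Schwarz's theorem: both mixed derivatives, at two possibly different points near x,
  equal the same second difference divided by h^2, and both are continuous.\<close>

lemma second_derivative_symmetric:
  fixes F :: "'a::real_normed_vector \<Rightarrow> real"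
  assumes "open S" "smooth_on S F" "x \<in> S"
  shows "frechet_derivative (\<lambda>y. frechet_derivative F (at y) v) (at x) w =
    frechet_derivative (\<lambda>y. frechet_derivative F (at y) w) (at x) v"
proof -
  define P where "P = (\<lambda>z. frechet_derivative (\<lambda>y. frechet_derivative F (at y) v) (at z) w)"
  define Q where "Q = (\<lambda>z. frechet_derivative (\<lambda>y. frechet_derivative F (at y) w) (at z) v)"
  have cP: "isCont P x" and cQ: "isCont Q x"
    unfolding P_def Q_def
    using assms smooth_on_continuous_on[OF smooth_on_derivative[OF smooth_on_derivative[OF assms(2)]]]
    by (auto simp: continuous_on_eq_continuous_at)
  have "\<bar>P x - Q x\<bar> \<le> e" if "e > 0" for e :: real
  proof -
    obtain d1 where d1: "d1 > 0" "\<And>y. dist y x < d1 \<Longrightarrow> \<bar>P y - P x\<bar> < e / 2"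
      using cP \<open>e > 0\<close> unfolding continuous_at_eps_delta by (metis dist_real_def half_gt_zero)
    obtain d2 where d2: "d2 > 0" "\<And>y. dist y x < d2 \<Longrightarrow> \<bar>Q y - Q x\<bar> < e / 2"
      using cQ \<open>e > 0\<close> unfolding continuous_at_eps_delta by (metis dist_real_def half_gt_zero)
    obtain d3 where d3: "d3 > 0" "ball x d3 \<subseteq> S"
      using assms by (meson open_contains_ball)
    define d where "d = min d1 (min d2 d3)"
    \<comment> \<open>With this side length the whole parallelogram stays within d/2 of x; the
      summand 1 keeps the denominator positive when \<open>v\<close> and \<open>w\<close>
      vanish.\<close>
    define h where "h = d / (2 * (norm v + norm w + 1))"
    have "d > 0" using d1 d2 d3 by (simp add: d_def)
    have np: "norm v + norm w + 1 > 0" by (smt (verit) norm_ge_zero)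
    have "h > 0" using \<open>d > 0\<close> np by (simp add: h_def)
    have near: "dist (x + s *\<^sub>R v + t *\<^sub>R w) x < d" if "0 \<le> s" "s \<le> h" "0 \<le> t" "t \<le> h" for s t
    proof -
      have "dist (x + s *\<^sub>R v + t *\<^sub>R w) x = norm (s *\<^sub>R v + t *\<^sub>R w)"
        by (simp add: dist_norm)
      also have "\<dots> \<le> s * norm v + t * norm w"
        using norm_triangle_ineq[of "s *\<^sub>R v" "t *\<^sub>R w"] that by simp
      also have "\<dots> \<le> h * norm v + h * norm w"
        using that by (intro add_mono mult_right_mono) auto
      also have "\<dots> \<le> h * (norm v + norm w + 1)"
        using \<open>h > 0\<close> by (simp add: algebra_simps)
      also have "\<dots> = d / 2" unfolding h_def using np by (simp add: field_simps)
      also have "\<dots> < d" using \<open>d > 0\<close> by simp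
      finally show ?thesis .
    qed
    have near': "dist (x + s *\<^sub>R w + t *\<^sub>R v) x < d" if "0 \<le> s" "s \<le> h" "0 \<le> t" "t \<le> h" for s t
      using near[of t s] that by (simp add: algebra_simps)
    have inS: "y \<in> S" if "dist y x < d" for y
      using that d3 by (auto simp: d_def dist_commute subset_iff)
    obtain s t where st: "0 \<le> s" "s \<le> h" "0 \<le> t" "t \<le> h"
      "F (x + h *\<^sub>R v + h *\<^sub>R w) - F (x + h *\<^sub>R v) - F (x + h *\<^sub>R w) + F x = h^2 * P (x + s *\<^sub>R v + t *\<^sub>R w)"
      using second_difference[OF assms(1,2) \<open>h > 0\<close>, of x v w] near inS unfolding P_def by blast
    obtain s' t' where st': "0 \<le> s'" "s' \<le> h" "0 \<le> t'" "t' \<le> h"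
      "F (x + h *\<^sub>R w + h *\<^sub>R v) - F (x + h *\<^sub>R w) - F (x + h *\<^sub>R v) + F x = h^2 * Q (x + s' *\<^sub>R w + t' *\<^sub>R v)"
      using second_difference[OF assms(1,2) \<open>h > 0\<close>, of x w v] near' inS unfolding Q_def by blast
    have "x + h *\<^sub>R w + h *\<^sub>R v = x + h *\<^sub>R v + h *\<^sub>R w" by simp
    then have "h^2 * P (x + s *\<^sub>R v + t *\<^sub>R w) = h^2 * Q (x + s' *\<^sub>R w + t' *\<^sub>R v)"
      using st(5) st'(5) by (smt (verit))
    then have "P (x + s *\<^sub>R v + t *\<^sub>R w) = Q (x + s' *\<^sub>R w + t' *\<^sub>R v)"
      using \<open>h > 0\<close> by simp
    moreover have "\<bar>P (x + s *\<^sub>R v + t *\<^sub>R w) - P x\<bar> < e/2"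
      using d1(2) near[OF st(1-4)] by (simp add: d_def)
    moreover have "\<bar>Q (x + s' *\<^sub>R w + t' *\<^sub>R v) - Q x\<bar> < e/2"
      using d2(2) near'[OF st'(1-4)] by (simp add: d_def)
    ultimately show ?thesis by linarith
  qed
  then have "\<bar>P x - Q x\<bar> \<le> 0" by (rule field_le_epsilon[where y=0, simplified])
  then show ?thesis by (simp add: P_def Q_def)
qed

subsection \<open>Partial derivatives\<close>

lemma partial_cong:
  "open S \<Longrightarrow> x \<in> S \<Longrightarrow> (\<And>y. y \<in> S \<Longrightarrow> F y = G y) \<Longrightarrow> partial i F x = partial i G x"
  unfolding partial_def using frechet_derivative_cong by metis

lemma partialI: "(F has_derivative D) (at x) \<Longrightarrow> partial i F x = D (axis i 1)"
  unfolding partial_def by (simp add: frechet_derivativeI)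

lemma partial_const [simp]: "partial i (\<lambda>y. c) x = 0"
  by (rule partialI) (rule has_derivative_const)

lemma partial_add:
  "F differentiable (at x) \<Longrightarrow> G differentiable (at x) \<Longrightarrow>
    partial i (\<lambda>y. F y + G y) x = partial i F x + partial i G x"
  unfolding partial_def
  by (subst frechet_derivativeI[OF has_derivative_add[OF frechet_derivative_works_at frechet_derivative_works_at]]) auto

lemma partial_diff:
  "F differentiable (at x) \<Longrightarrow> G differentiable (at x) \<Longrightarrow>
    partial i (\<lambda>y. F y - G y) x = partial i F x - partial i G x"
  unfolding partial_def
  by (subst frechet_derivativeI[OF has_derivative_diff[OF frechet_derivative_works_at frechet_derivative_works_at]]) auto

lemma partial_mult:
  fixes F G :: "real^'n::finite \<Rightarrow> real"
  shows "F differentiable (at x) \<Longrightarrow> G differentiable (at x) \<Longrightarrow>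
    partial i (\<lambda>y. F y * G y) x = F x * partial i G x + partial i F x * G x"
  unfolding partial_def
  by (subst frechet_derivativeI[OF has_derivative_mult[OF frechet_derivative_works_at frechet_derivative_works_at]]) auto

lemma partial_cmult:
  fixes F :: "real^'n::finite \<Rightarrow> real"
  shows "F differentiable (at x) \<Longrightarrow> partial i (\<lambda>y. c * F y) x = c * partial i F x"
  by (simp add: partial_mult)

lemma partial_sum:
  "(\<And>k. k \<in> I \<Longrightarrow> F k differentiable (at x)) \<Longrightarrow>
    partial i (\<lambda>y. \<Sum>k\<in>I. F k y) x = (\<Sum>k\<in>I. partial i (F k) x)"
  by (rule trans[OF partialI[OF has_derivative_sum[OF frechet_derivative_works_at]]]) (auto simp: partial_def)

lemma partial_vec_nth:
  "F differentiable (at x) \<Longrightarrow> partial i (\<lambda>y. F y $ k) x = partial i F x $ k"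
  unfolding partial_def
  by (subst frechet_derivativeI[OF bounded_linear.has_derivative[OF bounded_linear_vec_nth frechet_derivative_works_at]]) auto

lemma partial_commute:
  fixes F :: "real^'n::finite \<Rightarrow> real"
  assumes "open S" "smooth_on S F" "x \<in> S"
  shows "partial i (partial j F) x = partial j (partial i F) x"
  unfolding partial_def using second_derivative_symmetric[OF assms] by metis

lemma frechet_derivative_eq_sum_partial:
  fixes F :: "real^'n::finite \<Rightarrow> 'b::real_normed_vector"
  assumes "F differentiable (at x)"
  shows "frechet_derivative F (at x) h = (\<Sum>k\<in>UNIV. h $ k *\<^sub>R partial k F x)"
proof -
  interpret linear "frechet_derivative F (at x)" by (rule linear_frechet_derivative[OF assms])
  have "h = (\<Sum>k\<in>UNIV. h $ k *\<^sub>R axis k 1)"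
    using basis_expansion[of h] by (simp add: scalar_mult_eq_scaleR)
  then have "frechet_derivative F (at x) h = frechet_derivative F (at x) (\<Sum>k\<in>UNIV. h $ k *\<^sub>R axis k 1)"
    by simp
  also have "\<dots> = (\<Sum>k\<in>UNIV. h $ k *\<^sub>R partial k F x)"
    by (simp add: sum scale partial_def)
  finally show ?thesis .
qed

subsection \<open>Inverse matrices\<close>

lemma matrix_inv_right_left:
  fixes B :: "real^'n::finite^'n"
  assumes "invertible B"
  shows "B ** matrix_inv B = mat 1" "matrix_inv B ** B = mat 1"
proof -
  have "\<exists>B'. B ** B' = mat 1 \<and> B' ** B = mat 1" using assms by (simp add: invertible_def)
  from someI_ex[OF this] show "B ** matrix_inv B = mat 1" "matrix_inv B ** B = mat 1"
    unfolding matrix_inv_def by auto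
qed

lemma matrix_inv_unique_right:
  fixes B :: "real^'n::finite^'n"
  assumes "B ** C = mat 1"
  shows "matrix_inv B = C"
proof -
  have "C ** B = mat 1" using assms by (simp add: matrix_left_right_inverse)
  then have inv: "invertible B" using assms by (auto simp: invertible_def)
  have "matrix_inv B ** (B ** C) = (matrix_inv B ** B) ** C" by (simp add: matrix_mul_assoc)
  then show ?thesis using assms matrix_inv_right_left[OF inv] by simp
qed

text \<open>As quotients of determinants the entries of the inverse are rational in the entries of
  \<open>B\<close>; this is where differentiability of the inverse metric comes from.\<close>

lemma matrix_inv_nth_cramer:
  fixes B :: "real^'n::finite^'n"
  assumes "invertible B"
  shows "matrix_inv B $ i $ j = det (\<chi> r s. if s = i then axis j 1 $ r else B $ r $ s) / det B"
proof -
  have d: "det B \<noteq> 0" using assms by (simp add: invertible_det_nz)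
  have "B *v (matrix_inv B *v axis j 1) = axis j 1"
    by (simp add: matrix_vector_mul_assoc matrix_inv_right_left[OF assms])
  then have "matrix_inv B *v axis j 1 = (\<chi> k. det (\<chi> r s. if s = k then axis j 1 $ r else B $ r $ s) / det B)"
    using cramer[OF d] by blast
  moreover have "(matrix_inv B *v axis j 1) $ i = matrix_inv B $ i $ j"
    by (simp add: matrix_vector_mult_basis column_def)
  ultimately show ?thesis by (metis (mono_tags, lifting) vec_lambda_beta)
qed

lemma differentiable_prod_at:
  fixes F :: "'i \<Rightarrow> 'a::real_normed_vector \<Rightarrow> real"
  assumes "\<And>i. i \<in> I \<Longrightarrow> F i differentiable (at x)"
  shows "(\<lambda>y. \<Prod>i\<in>I. F i y) differentiable (at x)"
  unfolding differentiable_def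
  by (rule exI, rule has_derivative_prod, rule frechet_derivative_works_at, rule assms)

lemma differentiable_det:
  fixes B :: "'a::real_normed_vector \<Rightarrow> real^'n::finite^'n"
  assumes "\<And>i j. (\<lambda>y. B y $ i $ j) differentiable (at x)"
  shows "(\<lambda>y. det (B y)) differentiable (at x)"
  unfolding det_def
  by (intro differentiable_sum ballI differentiable_mult differentiable_const differentiable_prod_at assms) simp

lemma differentiable_matrix_inv:
  fixes B :: "'a::real_normed_vector \<Rightarrow> real^'n::finite^'n"
  assumes "open S" "x \<in> S" "\<And>y. y \<in> S \<Longrightarrow> invertible (B y)"
    and "\<And>i j. (\<lambda>y. B y $ i $ j) differentiable (at x)"
  shows "(\<lambda>y. matrix_inv (B y) $ i $ j) differentiable (at x)"
proof -
  have "(\<lambda>y. det (\<chi> r s. if s = i then axis j 1 $ r else B y $ r $ s) / det (B y)) differentiable (at x)"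
  proof (intro differentiable_divide differentiable_det assms)
    show "(\<lambda>y. (\<chi> r s. if s = i then axis j 1 $ r else B y $ r $ s) $ i' $ j') differentiable (at x)" for i' j'
      by (cases "j' = i") (auto simp: assms(4))
    show "det (B x) \<noteq> 0" using assms(2,3) by (simp add: invertible_det_nz[symmetric])
  qed
  then show ?thesis
    using differentiable_cong_open[OF assms(1,2), of "\<lambda>y. matrix_inv (B y) $ i $ j"
        "\<lambda>y. det (\<chi> r s. if s = i then axis j 1 $ r else B y $ r $ s) / det (B y)"]
      matrix_inv_nth_cramer[OF assms(3)] by blast
qed

subsection \<open>The Lie derivative of the contracted Christoffel symbols\<close>

lemma matrix_mult_distribs:
  fixes A B C :: "real^'n::finite^'n"
  shows "A ** (B + C) = A ** B + A ** C" "(A + B) ** C = A ** C + B ** C"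
    "A ** (B - C) = A ** B - A ** C" "(A - B) ** C = A ** C - B ** C"
    "A ** (- B) = - (A ** B)" "(- A) ** B = - (A ** B)"
    "A ** (r *\<^sub>R B) = r *\<^sub>R (A ** B)" "(r *\<^sub>R A) ** B = r *\<^sub>R (A ** B)"
    "A ** 0 = 0" "0 ** A = 0"
  by (simp_all add: matrix_matrix_mult_def vec_eq_iff sum.distrib sum_subtractf sum_negf
      sum_distrib_left algebra_simps)

lemma matrix_right_inverse_nonzero:
  fixes B C :: "real^'n::finite^'n"
  assumes "B ** C = mat 1"
  shows "B \<noteq> 0"
proof
  assume "B = 0"
  with assms have "(mat 1 :: real^'n^'n) $ undefined $ undefined = 0"
    by (simp add: matrix_mult_distribs)
  then show False by (simp add: mat_def)
qed

text \<open>\<open>DG\<close> and \<open>DM\<close> stand for the derivatives of the metric and its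
  inverse along a field with Jacobian \<open>X\<close>, and \<open>D\<close> is the differentiated
  identity \<open>G ** M = mat 1\<close>. The defects of the two equations satisfy
  \<open>M ** T ** M = - N\<close>, and multiplication by \<open>G\<close> on both sides undoes
  this.\<close>

lemma matrix_lie_derivative_inverse:
  fixes G M DG DM X :: "real^'n::finite^'n"
  assumes GM: "G ** M = mat 1" and MG: "M ** G = mat 1" and D: "DG ** M + G ** DM = 0"
  shows "DG + transpose X ** G + G ** X = r *\<^sub>R G \<longleftrightarrow>
    DM = M ** transpose X + X ** M - r *\<^sub>R M"
proof -
  define T where "T = DG + transpose X ** G + G ** X - r *\<^sub>R G"
  define N where "N = DM - M ** transpose X - X ** M + r *\<^sub>R M"
  have "M ** (DG ** M + G ** DM) = 0" using D by (simp add: matrix_mult_distribs)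
  then have 1: "M ** DG ** M = - DM"
    by (simp add: matrix_mult_distribs matrix_mul_assoc MG add_eq_0_iff2)
  have a: "M ** (transpose X ** G) ** M = M ** transpose X ** (G ** M)"
    "M ** (G ** X) ** M = (M ** G) ** X ** M" "M ** G ** M = M"
    by (simp_all only: matrix_mul_assoc MG matrix_mul_lid)
  have MTM: "M ** T ** M = - N"
    unfolding T_def N_def by (simp add: matrix_mult_distribs a GM MG 1)
  have "G ** (M ** T ** M) ** G = (G ** M) ** T ** (M ** G)" by (simp only: matrix_mul_assoc)
  then have GNG: "T = - (G ** N ** G)" using MTM GM MG by (simp add: matrix_mult_distribs)
  have "T = 0 \<longleftrightarrow> N = 0" using MTM GNG by (auto simp: matrix_mult_distribs)
  then show ?thesis unfolding T_def N_def by (auto simp: algebra_simps)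
qed

lemma frechet_derivative_real_eq_sum:
  fixes F :: "real^'n::finite \<Rightarrow> real"
  assumes "F differentiable (at x)"
  shows "frechet_derivative F (at x) h = (\<Sum>k\<in>UNIV. h $ k * partial k F x)"
  using frechet_derivative_eq_sum_partial[OF assms] by simp

text \<open>The Christoffel symbols of the first kind. They are linear in the first derivatives of
  the metric, so their Lie derivative can be found before the inverse metric enters.\<close>

definition lowered_christoffel ::
  "(real^'n \<Rightarrow> real^'n^'n) \<Rightarrow> 'n::finite \<Rightarrow> 'n \<Rightarrow> 'n \<Rightarrow> real^'n \<Rightarrow> real" where
  "lowered_christoffel G l p q x = 1/2 * (partial p (\<lambda>y. G y $ l $ q) x
     + partial q (\<lambda>y. G y $ l $ p) x - partial l (\<lambda>y. G y $ p $ q) x)"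

locale local_metric =
  fixes U :: "(real^'n::finite) set" and G :: "real^'n \<Rightarrow> real^'n^'n"
  assumes open_U: "open U" and smooth_G: "smooth_on U G"
    and transpose_G: "x \<in> U \<Longrightarrow> transpose (G x) = G x"
    and invertible_G: "x \<in> U \<Longrightarrow> invertible (G x)"
begin

lemma G_sym: "x \<in> U \<Longrightarrow> G x $ i $ j = G x $ j $ i"
  using transpose_G[of x] by (metis (no_types, lifting) transpose_def vec_lambda_beta)

lemma matrix_inv_sym: "x \<in> U \<Longrightarrow> transpose (matrix_inv (G x)) = matrix_inv (G x)"
  using matrix_inv_unique_right[of "G x" "transpose (matrix_inv (G x))"]
    matrix_inv_right_left[OF invertible_G, of x] transpose_G[of x]
  by (metis matrix_transpose_mul transpose_mat)

lemma M_sym: "x \<in> U \<Longrightarrow> inverse_metric G i j x = inverse_metric G j i x"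
  unfolding inverse_metric_def
  using matrix_inv_sym[of x] by (metis (no_types, lifting) transpose_def vec_lambda_beta)

lemma sum_G_M: "x \<in> U \<Longrightarrow> (\<Sum>k\<in>UNIV. G x $ i $ k * inverse_metric G k j x) = (if i = j then 1 else 0)"
  using arg_cong[OF matrix_inv_right_left(1)[OF invertible_G, of x], of "\<lambda>B. B $ i $ j"]
  by (simp add: matrix_matrix_mult_def inverse_metric_def mat_def)

lemma sum_M_G: "x \<in> U \<Longrightarrow> (\<Sum>k\<in>UNIV. inverse_metric G i k x * G x $ k $ j) = (if i = j then 1 else 0)"
  using arg_cong[OF matrix_inv_right_left(2)[OF invertible_G, of x], of "\<lambda>B. B $ i $ j"]
  by (simp add: matrix_matrix_mult_def inverse_metric_def mat_def)

lemma smooth_G_nth: "smooth_on U (\<lambda>y. G y $ i $ j)"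
  by (intro smooth_on_vec_nth open_U smooth_G)

lemma differentiable_G_nth: "x \<in> U \<Longrightarrow> (\<lambda>y. G y $ i $ j) differentiable (at x)"
  by (rule smooth_on_differentiable[OF smooth_G_nth])

text \<open>The differential of \<open>H\<close> contains only first derivatives of the inverse
  metric and of the contracted Christoffel symbols, so differentiability at a point is the property
  tracked from here on.\<close>

lemma differentiable_inverse_metric: "x \<in> U \<Longrightarrow> inverse_metric G i j differentiable (at x)"
  using differentiable_matrix_inv[OF open_U _ invertible_G differentiable_G_nth]
  unfolding inverse_metric_def by blast

lemma smooth_lowered_christoffel: "smooth_on U (lowered_christoffel G l p q)"
proof -
  have "smooth_on U (\<lambda>x. 1/2 * ((partial p (\<lambda>y. G y $ l $ q) x
     + partial q (\<lambda>y. G y $ l $ p) x) + (- 1) * partial l (\<lambda>y. G y $ p $ q) x))"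
    by (intro smooth_on_mult smooth_on_add smooth_on_const open_U smooth_on_partial smooth_G_nth)
  then show ?thesis unfolding lowered_christoffel_def by simp
qed

lemma differentiable_lowered_christoffel: "x \<in> U \<Longrightarrow> lowered_christoffel G l p q differentiable (at x)"
  by (rule smooth_on_differentiable[OF smooth_lowered_christoffel])

lemma christoffel_eq:
  "christoffel G i p q x = (\<Sum>l\<in>UNIV. inverse_metric G i l x * lowered_christoffel G l p q x)"
  unfolding christoffel_def lowered_christoffel_def by simp

lemma christoffel_eq_fun:
  "christoffel G i p q = (\<lambda>x. \<Sum>l\<in>UNIV. inverse_metric G i l x * lowered_christoffel G l p q x)"
  using christoffel_eq by blast

lemma contracted_christoffel_eq_fun:
  "contracted_christoffel G i = (\<lambda>x. \<Sum>p\<in>UNIV. \<Sum>q\<in>UNIV. inverse_metric G p q x * christoffel G i p q x)"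
  using contracted_christoffel_def by blast

lemma differentiable_christoffel: "x \<in> U \<Longrightarrow> christoffel G i p q differentiable (at x)"
  unfolding christoffel_eq_fun
  by (intro differentiable_sum finite ballI differentiable_mult differentiable_inverse_metric
      differentiable_lowered_christoffel)

lemma differentiable_contracted_christoffel: "x \<in> U \<Longrightarrow> contracted_christoffel G i differentiable (at x)"
  unfolding contracted_christoffel_eq_fun
  by (intro differentiable_sum finite ballI differentiable_mult differentiable_inverse_metric
      differentiable_christoffel)

lemma partial_inverse_metric_sym:
  "x \<in> U \<Longrightarrow> partial k (inverse_metric G i j) x = partial k (inverse_metric G j i) x"
  by (rule partial_cong[OF open_U _ M_sym])

lemma partial_G_sym:
  "x \<in> U \<Longrightarrow> partial k (\<lambda>y. G y $ i $ j) x = partial k (\<lambda>y. G y $ j $ i) x"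
  by (rule partial_cong[OF open_U _ G_sym])

lemma partial_partial_G_sym:
  "x \<in> U \<Longrightarrow> partial l (partial k (\<lambda>y. G y $ i $ j)) x = partial l (partial k (\<lambda>y. G y $ j $ i)) x"
  by (rule partial_cong[OF open_U _ partial_G_sym])

lemma G_M_derivative:
  assumes "x \<in> U"
  shows "(\<Sum>k\<in>UNIV. G x $ i $ k * partial m (inverse_metric G k j) x
    + partial m (\<lambda>y. G y $ i $ k) x * inverse_metric G k j x) = 0"
proof -
  have "partial m (\<lambda>y. \<Sum>k\<in>UNIV. G y $ i $ k * inverse_metric G k j y) x
      = partial m (\<lambda>y. if i = j then 1 else 0 :: real) x"
    by (rule partial_cong[OF open_U assms sum_G_M])
  then show ?thesis
    by (simp add: partial_sum partial_mult differentiable_G_nth differentiable_inverse_metric assms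
        cong: if_cong split: if_splits)
qed

text \<open>\<open>\<L>\<^sub>v g = r g\<close> is equivalent to \<open>\<L>\<^sub>v g\<^sup>-\<^sup>1 = - r g\<^sup>-\<^sup>1\<close>.\<close>

lemma lie_derivative_inverse_metric:
  assumes x: "x \<in> U"
  shows "(\<forall>i j. lie_derivative_metric v G i j x = r * G x $ i $ j) \<longleftrightarrow>
    (\<forall>i j. (\<Sum>k\<in>UNIV. v x $ k * partial k (inverse_metric G i j) x) =
       (\<Sum>l\<in>UNIV. inverse_metric G i l x * partial l (\<lambda>y. v y $ j) x
          + inverse_metric G j l x * partial l (\<lambda>y. v y $ i) x) - r * inverse_metric G i j x)"
proof -
  define DG :: "real^'n^'n" where "DG = (\<chi> i j. \<Sum>k\<in>UNIV. v x $ k * partial k (\<lambda>y. G y $ i $ j) x)"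
  define DM :: "real^'n^'n" where "DM = (\<chi> i j. \<Sum>k\<in>UNIV. v x $ k * partial k (inverse_metric G i j) x)"
  define X :: "real^'n^'n" where "X = (\<chi> i j. partial j (\<lambda>y. v y $ i) x)"
  define M where "M = matrix_inv (G x)"
  have Mij: "inverse_metric G i j x = M $ i $ j" for i j by (simp add: M_def inverse_metric_def)
  have GM: "G x ** M = mat 1" and MG: "M ** G x = mat 1"
    unfolding M_def using matrix_inv_right_left[OF invertible_G[OF x]] by auto
  have D: "DG ** M + G x ** DM = 0"
  proof -
    have "(DG ** M + G x ** DM) $ i $ j = 0" for i j
    proof -
      have "(DG ** M + G x ** DM) $ i $ j =
        (\<Sum>k\<in>UNIV. \<Sum>m\<in>UNIV. v x $ m * partial m (\<lambda>y. G y $ i $ k) x * M $ k $ j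
            + G x $ i $ k * (v x $ m * partial m (inverse_metric G k j) x))"
        by (simp add: DG_def DM_def matrix_matrix_mult_def sum.distrib sum_distrib_left sum_distrib_right)
      also have "\<dots> = (\<Sum>m\<in>UNIV. v x $ m * (\<Sum>k\<in>UNIV. G x $ i $ k * partial m (inverse_metric G k j) x
          + partial m (\<lambda>y. G y $ i $ k) x * inverse_metric G k j x))"
        unfolding Mij by (subst sum.swap) (simp add: sum_distrib_left algebra_simps)
      also have "\<dots> = 0" by (simp add: G_M_derivative[OF x])
      finally show ?thesis .
    qed
    then show ?thesis by (simp add: vec_eq_iff)
  qed
  have "(\<forall>i j. lie_derivative_metric v G i j x = r * G x $ i $ j) \<longleftrightarrow>
      DG + transpose X ** G x + G x ** X = r *\<^sub>R G x"
    by (simp add: vec_eq_iff lie_derivative_metric_def DG_def X_def matrix_matrix_mult_def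
        transpose_def sum.distrib mult.commute)
  also have "\<dots> \<longleftrightarrow> DM = M ** transpose X + X ** M - r *\<^sub>R M"
    by (rule matrix_lie_derivative_inverse[OF GM MG D])
  also have "\<dots> \<longleftrightarrow> (\<forall>i j. (\<Sum>k\<in>UNIV. v x $ k * partial k (inverse_metric G i j) x) =
       (\<Sum>l\<in>UNIV. inverse_metric G i l x * partial l (\<lambda>y. v y $ j) x
          + inverse_metric G j l x * partial l (\<lambda>y. v y $ i) x) - r * inverse_metric G i j x)"
    using M_sym[OF x] unfolding Mij
    by (simp add: vec_eq_iff DM_def X_def matrix_matrix_mult_def transpose_def sum.distrib mult.commute)
  finally show ?thesis .
qed

text \<open>The conformal equation is differentiated once and combined over three index positions
  with the signs that define the Christoffel symbols. The second derivatives of \<open>v\<close>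
  appear because these symbols do not form a tensor, the gradient of \<open>m\<close> because the
  factor is not constant.\<close>

lemma lie_derivative_lowered_christoffel:
  assumes x: "x \<in> U" and smv: "smooth_on U v" and smm: "smooth_on U m"
    and conf: "\<And>y i j. y \<in> U \<Longrightarrow> lie_derivative_metric v G i j y = m y * G y $ i $ j"
  shows "(\<Sum>k\<in>UNIV. v x $ k * partial k (lowered_christoffel G l p q) x) =
    - (\<Sum>k\<in>UNIV. lowered_christoffel G k p q x * partial l (\<lambda>y. v y $ k) x)
    - (\<Sum>k\<in>UNIV. lowered_christoffel G l k q x * partial p (\<lambda>y. v y $ k) x)
    - (\<Sum>k\<in>UNIV. lowered_christoffel G l p k x * partial q (\<lambda>y. v y $ k) x)
    - (\<Sum>k\<in>UNIV. G x $ l $ k * partial p (partial q (\<lambda>y. v y $ k)) x)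
    + 1/2 * (partial p m x * G x $ l $ q + partial q m x * G x $ l $ p - partial l m x * G x $ p $ q)
    + m x * lowered_christoffel G l p q x"
proof -
  have smv': "smooth_on U (\<lambda>y. v y $ k)" for k by (rule smooth_on_vec_nth[OF open_U smv])
  note sm = smv' smooth_G_nth smm smooth_on_partial
  define g where "g = (\<lambda>i j. \<lambda>y. G y $ i $ j)"
  define w where "w = (\<lambda>k. \<lambda>y. v y $ k)"
  have smw: "smooth_on U (w k)" and smg: "smooth_on U (g i j)" for i j k
    unfolding w_def g_def using sm by auto
  have dw: "w k differentiable (at x)" "g i j differentiable (at x)" "m differentiable (at x)"
    "partial i (w k) differentiable (at x)" "partial k (g i j) differentiable (at x)" for i j k
    by (intro smooth_on_differentiable[OF _ x] smooth_on_partial smw smg smm)+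
  \<comment> \<open>The conformal equation for the pair (i, j), differentiated in direction a and
    expanded by the product rule.\<close>
  have E: "(\<Sum>k\<in>UNIV. w k x * partial a (partial k (g i j)) x + partial a (w k) x * partial k (g i j) x
      + (g k j x * partial a (partial i (w k)) x + partial a (g k j) x * partial i (w k) x)
      + (g i k x * partial a (partial j (w k)) x + partial a (g i k) x * partial j (w k) x))
     = m x * partial a (g i j) x + partial a m x * g i j x" for a i j
  proof -
    have "partial a (\<lambda>y. \<Sum>k\<in>UNIV. w k y * partial k (g i j) y + g k j y * partial i (w k) y
        + g i k y * partial j (w k) y) x = partial a (\<lambda>y. m y * g i j y) x"
      using conf unfolding lie_derivative_metric_def g_def w_def
      by (intro partial_cong[OF open_U x]) simp
    then show ?thesis
      by (simp add: partial_sum partial_mult partial_add dw differentiable_add differentiable_mult)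
  qed
  have gs: "g i j x = g j i x" "partial a (g i j) x = partial a (g j i) x"
     "partial a (partial b (g i j)) x = partial a (partial b (g j i)) x"
    for i j a b unfolding g_def using G_sym[OF x] partial_G_sym[OF x] partial_partial_G_sym[OF x] by metis+
  have pc: "partial a (partial b (g i j)) x = partial b (partial a (g i j)) x"
    "partial a (partial b (w i)) x = partial b (partial a (w i)) x" for a b i j
    by (rule partial_commute[OF open_U _ x], rule smg, rule partial_commute[OF open_U _ x], rule smw)
  have low: "lowered_christoffel G l p q y = 1/2 * (partial p (g l q) y + partial q (g l p) y - partial l (g p q) y)" for l p q y
    by (simp add: lowered_christoffel_def g_def)
  have dlow: "partial k (lowered_christoffel G l p q) x = 1/2 * (partial k (partial p (g l q)) x
     + partial k (partial q (g l p)) x - partial k (partial l (g p q)) x)" for k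
    unfolding low[abs_def]
    by (subst partial_cmult) (simp_all add: partial_diff partial_add dw differentiable_add differentiable_diff)
  have sum3: "(\<Sum>k\<in>UNIV. 1/2 * a k + 1/2 * b k - 1/2 * c k) =
      1/2 * sum a UNIV + 1/2 * sum b UNIV - 1/2 * sum c UNIV" for a b c :: "'n \<Rightarrow> real"
    by (simp add: sum.distrib sum_subtractf sum_distrib_left)
  \<comment> \<open>The right side takes \<open>E\<close> at (a, i, j) = (p, l, q), (q, l, p) and
    (l, p, q) with the Christoffel signs; the sides agree term by term in k once mixed partials
    commute and the metric is symmetric.\<close>
  have "(\<Sum>k\<in>UNIV. w k x * partial k (lowered_christoffel G l p q) x
      + lowered_christoffel G k p q x * partial l (w k) x
      + lowered_christoffel G l k q x * partial p (w k) x
      + lowered_christoffel G l p k x * partial q (w k) x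
      + g l k x * partial p (partial q (w k)) x) =
     (\<Sum>k\<in>UNIV. 1/2 * (w k x * partial p (partial k (g l q)) x + partial p (w k) x * partial k (g l q) x
      + (g k q x * partial p (partial l (w k)) x + partial p (g k q) x * partial l (w k) x)
      + (g l k x * partial p (partial q (w k)) x + partial p (g l k) x * partial q (w k) x))
      + 1/2 * (w k x * partial q (partial k (g l p)) x + partial q (w k) x * partial k (g l p) x
      + (g k p x * partial q (partial l (w k)) x + partial q (g k p) x * partial l (w k) x)
      + (g l k x * partial q (partial p (w k)) x + partial q (g l k) x * partial p (w k) x))
      - 1/2 * (w k x * partial l (partial k (g p q)) x + partial l (w k) x * partial k (g p q) x
      + (g k q x * partial l (partial p (w k)) x + partial l (g k q) x * partial p (w k) x)
      + (g p k x * partial l (partial q (w k)) x + partial l (g p k) x * partial q (w k) x)))"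
  proof (rule sum.cong[OF refl])
    fix k :: 'n
    show "w k x * partial k (lowered_christoffel G l p q) x
      + lowered_christoffel G k p q x * partial l (w k) x
      + lowered_christoffel G l k q x * partial p (w k) x
      + lowered_christoffel G l p k x * partial q (w k) x
      + g l k x * partial p (partial q (w k)) x =
      1/2 * (w k x * partial p (partial k (g l q)) x + partial p (w k) x * partial k (g l q) x
      + (g k q x * partial p (partial l (w k)) x + partial p (g k q) x * partial l (w k) x)
      + (g l k x * partial p (partial q (w k)) x + partial p (g l k) x * partial q (w k) x))
      + 1/2 * (w k x * partial q (partial k (g l p)) x + partial q (w k) x * partial k (g l p) x
      + (g k p x * partial q (partial l (w k)) x + partial q (g k p) x * partial l (w k) x)
      + (g l k x * partial q (partial p (w k)) x + partial q (g l k) x * partial p (w k) x))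
      - 1/2 * (w k x * partial l (partial k (g p q)) x + partial l (w k) x * partial k (g p q) x
      + (g k q x * partial l (partial p (w k)) x + partial l (g k q) x * partial p (w k) x)
      + (g p k x * partial l (partial q (w k)) x + partial l (g p k) x * partial q (w k) x))"
      unfolding dlow unfolding low
        pc(1)[of k p l q] pc(1)[of k q l p] pc(1)[of k l p q]
        pc(2)[of p l k] pc(2)[of q l k] pc(2)[of q p k]
        gs(1)[of p k] gs(2)[of _ k p]
      by (simp add: gs(2)[of _ p k] field_simps)
  qed
  also have "\<dots> = 1/2 * (m x * partial p (g l q) x + partial p m x * g l q x)
      + 1/2 * (m x * partial q (g l p) x + partial q m x * g l p x)
      - 1/2 * (m x * partial l (g p q) x + partial l m x * g p q x)"
    by (simp only: sum3 E)
  also have "\<dots> = 1/2 * (partial p m x * g l q x + partial q m x * g l p x - partial l m x * g p q x)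
    + m x * lowered_christoffel G l p q x"
    unfolding low by (simp add: field_simps)
  finally show ?thesis
    unfolding sum.distrib g_def w_def by simp
qed

text \<open>Raising the index l by the product rule: the undifferentiated factor \<open>m\<close>
  cancels because the inverse metric scales by \<open>- m\<close>, and the Jacobian terms in l
  cancel likewise. Only the gradient of \<open>m\<close> survives, as in the classical conformal
  variation of the Levi-Civita connection.\<close>

lemma lie_derivative_christoffel:
  assumes x: "x \<in> U" and smv: "smooth_on U v" and smm: "smooth_on U m"
    and conf: "\<And>y i j. y \<in> U \<Longrightarrow> lie_derivative_metric v G i j y = m y * G y $ i $ j"
  shows "(\<Sum>k\<in>UNIV. v x $ k * partial k (christoffel G i p q) x) =
    (\<Sum>k\<in>UNIV. partial k (\<lambda>y. v y $ i) x * christoffel G k p q x)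
    - (\<Sum>k\<in>UNIV. partial p (\<lambda>y. v y $ k) x * christoffel G i k q x)
    - (\<Sum>k\<in>UNIV. partial q (\<lambda>y. v y $ k) x * christoffel G i p k x)
    - partial p (partial q (\<lambda>y. v y $ i)) x
    + 1/2 * ((if i = q then partial p m x else 0) + (if i = p then partial q m x else 0)
       - G x $ p $ q * (\<Sum>l\<in>UNIV. inverse_metric G i l x * partial l m x))"
proof -
  define M where "M = (\<lambda>i j. inverse_metric G i j x)"
  define c where "c = (\<lambda>l p q. lowered_christoffel G l p q x)"
  define X where "X = (\<lambda>i k. partial k (\<lambda>y. v y $ i) x)"
  define Y where "Y = (\<lambda>k. partial p (partial q (\<lambda>y. v y $ k)) x)"
  define g where "g = (\<lambda>i j. G x $ i $ j)"
  define r where "r = m x"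
  have dM: "(\<Sum>k\<in>UNIV. v x $ k * partial k (inverse_metric G i l) x) =
      (\<Sum>k\<in>UNIV. M i k * X l k + M l k * X i k) - r * M i l" for l
    using lie_derivative_inverse_metric[OF x, of v "m x"] conf[OF x] unfolding M_def X_def r_def by blast
  have dc: "(\<Sum>k\<in>UNIV. v x $ k * partial k (lowered_christoffel G l p q) x) =
    - (\<Sum>k\<in>UNIV. c k p q * X k l) - (\<Sum>k\<in>UNIV. c l k q * X k p)
    - (\<Sum>k\<in>UNIV. c l p k * X k q) - (\<Sum>k\<in>UNIV. g l k * Y k)
    + 1/2 * (partial p m x * g l q + partial q m x * g l p - partial l m x * g p q)
    + r * c l p q" for l
    using lie_derivative_lowered_christoffel[OF x smv smm conf, of l p q]
    unfolding c_def X_def Y_def g_def r_def by blast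
  have ch: "christoffel G a b d x = (\<Sum>l\<in>UNIV. M a l * c l b d)" for a b d
    by (simp add: christoffel_eq M_def c_def)
  have Mg: "(\<Sum>l\<in>UNIV. M i l * g l j) = (if i = j then 1 else 0)" for j
    unfolding M_def g_def by (rule sum_M_G[OF x])
  have delta: "(if i = j then 1 else 0) * Y j = (if i = j then Y j else 0)" for j by simp
  have "(\<Sum>k\<in>UNIV. v x $ k * partial k (christoffel G i p q) x) =
     (\<Sum>k\<in>UNIV. \<Sum>l\<in>UNIV. M i l * (v x $ k * partial k (lowered_christoffel G l p q) x)
        + (v x $ k * partial k (inverse_metric G i l) x) * c l p q)"
    unfolding christoffel_eq_fun
    by (simp add: partial_sum partial_mult differentiable_inverse_metric differentiable_lowered_christoffel x
        differentiable_mult M_def c_def sum_distrib_left algebra_simps)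
  also have "\<dots> = (\<Sum>l\<in>UNIV. M i l * (\<Sum>k\<in>UNIV. v x $ k * partial k (lowered_christoffel G l p q) x)
        + (\<Sum>k\<in>UNIV. v x $ k * partial k (inverse_metric G i l) x) * c l p q)"
    by (subst sum.swap) (simp add: sum.distrib sum_distrib_left sum_distrib_right)
  also have "\<dots> = (\<Sum>l\<in>UNIV. M i l *
        (- (\<Sum>k\<in>UNIV. c k p q * X k l) - (\<Sum>k\<in>UNIV. c l k q * X k p)
    - (\<Sum>k\<in>UNIV. c l p k * X k q) - (\<Sum>k\<in>UNIV. g l k * Y k)
    + 1/2 * (partial p m x * g l q + partial q m x * g l p - partial l m x * g p q)
    + r * c l p q) + ((\<Sum>k\<in>UNIV. M i k * X l k + M l k * X i k) - r * M i l) * c l p q)"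
    by (simp only: dM dc)
  also have "\<dots> = - (\<Sum>l\<in>UNIV. \<Sum>k\<in>UNIV. M i l * (c k p q * X k l))
      - (\<Sum>l\<in>UNIV. \<Sum>k\<in>UNIV. M i l * (c l k q * X k p))
      - (\<Sum>l\<in>UNIV. \<Sum>k\<in>UNIV. M i l * (c l p k * X k q))
      - (\<Sum>l\<in>UNIV. \<Sum>k\<in>UNIV. M i l * g l k * Y k)
      + 1/2 * (partial p m x * (\<Sum>l\<in>UNIV. M i l * g l q) + partial q m x * (\<Sum>l\<in>UNIV. M i l * g l p)
          - g p q * (\<Sum>l\<in>UNIV. M i l * partial l m x))
      + (\<Sum>l\<in>UNIV. \<Sum>k\<in>UNIV. M i k * (c l p q * X l k))
      + (\<Sum>l\<in>UNIV. \<Sum>k\<in>UNIV. M l k * X i k * c l p q)"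
    by (simp add: sum.distrib sum_subtractf sum_negf sum_distrib_left sum_distrib_right algebra_simps)
  also have "\<dots> = - (\<Sum>l\<in>UNIV. \<Sum>k\<in>UNIV. M i l * (c l k q * X k p))
      - (\<Sum>l\<in>UNIV. \<Sum>k\<in>UNIV. M i l * (c l p k * X k q))
      - (\<Sum>l\<in>UNIV. \<Sum>k\<in>UNIV. M i l * g l k * Y k)
      + 1/2 * (partial p m x * (if i = q then 1 else 0) + partial q m x * (if i = p then 1 else 0)
          - g p q * (\<Sum>l\<in>UNIV. M i l * partial l m x))
      + (\<Sum>l\<in>UNIV. \<Sum>k\<in>UNIV. M l k * X i k * c l p q)"
    unfolding Mg using sum.swap[of "\<lambda>l k. M i l * (c k p q * X k l)" UNIV UNIV] by simp
  also have "(\<Sum>l\<in>UNIV. \<Sum>k\<in>UNIV. M i l * (c l k q * X k p)) = (\<Sum>k\<in>UNIV. X k p * christoffel G i k q x)"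
    unfolding ch by (subst sum.swap) (simp add: sum_distrib_left mult_ac)
  also have "(\<Sum>l\<in>UNIV. \<Sum>k\<in>UNIV. M i l * (c l p k * X k q)) = (\<Sum>k\<in>UNIV. X k q * christoffel G i p k x)"
    unfolding ch by (subst sum.swap) (simp add: sum_distrib_left mult_ac)
  also have "(\<Sum>l\<in>UNIV. \<Sum>k\<in>UNIV. M l k * X i k * c l p q) = (\<Sum>k\<in>UNIV. X i k * christoffel G k p q x)"
    unfolding ch
    by (subst sum.swap) (simp add: sum_distrib_left mult_ac M_def M_sym[OF x])
  also have "(\<Sum>l\<in>UNIV. \<Sum>k\<in>UNIV. M i l * g l k * Y k) = Y i"
    by (subst sum.swap) (simp add: sum_distrib_right[symmetric] Mg delta)
  finally show ?thesis
    unfolding X_def Y_def M_def g_def by simp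
qed

text \<open>Tracing the gradient terms gives half of 1 + 1 - n times the raised gradient of
  \<open>m\<close>. This is the origin of the constant 2 - n in all the symmetries.\<close>

lemma lie_derivative_contracted_christoffel:
  assumes x: "x \<in> U" and smv: "smooth_on U v" and smm: "smooth_on U m"
    and conf: "\<And>y i j. y \<in> U \<Longrightarrow> lie_derivative_metric v G i j y = m y * G y $ i $ j"
  shows "(\<Sum>k\<in>UNIV. v x $ k * partial k (contracted_christoffel G i) x) =
    - m x * contracted_christoffel G i x
    + (\<Sum>k\<in>UNIV. partial k (\<lambda>y. v y $ i) x * contracted_christoffel G k x)
    - (\<Sum>p\<in>UNIV. \<Sum>q\<in>UNIV. inverse_metric G p q x * partial p (partial q (\<lambda>y. v y $ i)) x)
    + (2 - real CARD('n)) / 2 * (\<Sum>l\<in>UNIV. inverse_metric G i l x * partial l m x)"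
proof -
  define M where "M = (\<lambda>i j. inverse_metric G i j x)"
  define C where "C = (\<lambda>i p q. christoffel G i p q x)"
  define X where "X = (\<lambda>i k. partial k (\<lambda>y. v y $ i) x)"
  define Y where "Y = (\<lambda>p q. partial p (partial q (\<lambda>y. v y $ i)) x)"
  define L where "L = (\<Sum>l\<in>UNIV. M i l * partial l m x)"
  define r where "r = m x"
  have Ms: "M a b = M b a" for a b unfolding M_def by (rule M_sym[OF x])
  have dM: "(\<Sum>k\<in>UNIV. v x $ k * partial k (inverse_metric G p q) x) =
      (\<Sum>k\<in>UNIV. M p k * X q k + M q k * X p k) - r * M p q" for p q
    using lie_derivative_inverse_metric[OF x, of v "m x"] conf[OF x] unfolding M_def X_def r_def by blast
  have dC: "(\<Sum>k\<in>UNIV. v x $ k * partial k (christoffel G i p q) x) =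
    (\<Sum>k\<in>UNIV. X i k * C k p q) - (\<Sum>k\<in>UNIV. X k p * C i k q) - (\<Sum>k\<in>UNIV. X k q * C i p k)
    - Y p q + 1/2 * ((if i = q then partial p m x else 0) + (if i = p then partial q m x else 0)
       - G x $ p $ q * L)" for p q
    using lie_derivative_christoffel[OF x smv smm conf, of i p q]
    unfolding C_def X_def Y_def M_def L_def by blast
  \<comment> \<open>The trace of the metric with its inverse; the dimension enters the computation
    here.\<close>
  have Mg: "(\<Sum>p\<in>UNIV. \<Sum>q\<in>UNIV. M p q * G x $ p $ q) = real CARD('n)"
    using sum_M_G[OF x] G_sym[OF x] unfolding M_def by simp
  have "(\<Sum>k\<in>UNIV. v x $ k * partial k (contracted_christoffel G i) x) =
     (\<Sum>k\<in>UNIV. \<Sum>p\<in>UNIV. \<Sum>q\<in>UNIV. M p q * (v x $ k * partial k (christoffel G i p q) x)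
        + (v x $ k * partial k (inverse_metric G p q) x) * C i p q)"
    unfolding contracted_christoffel_eq_fun
    by (simp add: partial_sum partial_mult differentiable_inverse_metric differentiable_christoffel x
        differentiable_mult differentiable_sum M_def C_def sum_distrib_left algebra_simps)
  also have "\<dots> = (\<Sum>p\<in>UNIV. \<Sum>k\<in>UNIV. \<Sum>q\<in>UNIV. M p q * (v x $ k * partial k (christoffel G i p q) x)
        + (v x $ k * partial k (inverse_metric G p q) x) * C i p q)"
    by (rule sum.swap)
  also have "\<dots> = (\<Sum>p\<in>UNIV. \<Sum>q\<in>UNIV. \<Sum>k\<in>UNIV. M p q * (v x $ k * partial k (christoffel G i p q) x)
        + (v x $ k * partial k (inverse_metric G p q) x) * C i p q)"
    by (rule sum.cong[OF refl]) (rule sum.swap)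
  also have "\<dots> = (\<Sum>p\<in>UNIV. \<Sum>q\<in>UNIV. M p q * (\<Sum>k\<in>UNIV. v x $ k * partial k (christoffel G i p q) x)
        + (\<Sum>k\<in>UNIV. v x $ k * partial k (inverse_metric G p q) x) * C i p q)"
    by (simp add: sum.distrib sum_distrib_left sum_distrib_right)
  also have "\<dots> = (\<Sum>p\<in>UNIV. \<Sum>q\<in>UNIV. M p q *
    ((\<Sum>k\<in>UNIV. X i k * C k p q) - (\<Sum>k\<in>UNIV. X k p * C i k q) - (\<Sum>k\<in>UNIV. X k q * C i p k)
    - Y p q + 1/2 * ((if i = q then partial p m x else 0) + (if i = p then partial q m x else 0)
       - G x $ p $ q * L))
        + ((\<Sum>k\<in>UNIV. M p k * X q k + M q k * X p k) - r * M p q) * C i p q)"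
    by (simp only: dM dC)
  also have "\<dots> = (\<Sum>p\<in>UNIV. \<Sum>q\<in>UNIV. \<Sum>k\<in>UNIV. M p q * (X i k * C k p q))
      - (\<Sum>p\<in>UNIV. \<Sum>q\<in>UNIV. \<Sum>k\<in>UNIV. M p q * X k p * C i k q)
      - (\<Sum>p\<in>UNIV. \<Sum>q\<in>UNIV. \<Sum>k\<in>UNIV. M p q * X k q * C i p k)
      - (\<Sum>p\<in>UNIV. \<Sum>q\<in>UNIV. M p q * Y p q)
      + 1/2 * ((\<Sum>p\<in>UNIV. \<Sum>q\<in>UNIV. M p q * (if i = q then partial p m x else 0))
         + (\<Sum>p\<in>UNIV. \<Sum>q\<in>UNIV. M p q * (if i = p then partial q m x else 0))
         - (\<Sum>p\<in>UNIV. \<Sum>q\<in>UNIV. M p q * G x $ p $ q) * L)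
      + (\<Sum>p\<in>UNIV. \<Sum>q\<in>UNIV. \<Sum>k\<in>UNIV. M p k * X q k * C i p q)
      + (\<Sum>p\<in>UNIV. \<Sum>q\<in>UNIV. \<Sum>k\<in>UNIV. M q k * X p k * C i p q)
      - r * (\<Sum>p\<in>UNIV. \<Sum>q\<in>UNIV. M p q * C i p q)"
    by (simp add: sum.distrib sum_subtractf sum_negf sum_distrib_left sum_distrib_right algebra_simps
        del: sum.delta sum.delta')
  also have "(\<Sum>p\<in>UNIV. \<Sum>q\<in>UNIV. \<Sum>k\<in>UNIV. M p k * X q k * C i p q)
      = (\<Sum>p\<in>UNIV. \<Sum>q\<in>UNIV. \<Sum>k\<in>UNIV. M p q * X k q * C i p k)"
    by (rule sum.cong[OF refl]) (rule sum.swap)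
  also have "(\<Sum>p\<in>UNIV. \<Sum>q\<in>UNIV. \<Sum>k\<in>UNIV. M q k * X p k * C i p q)
      = (\<Sum>p\<in>UNIV. \<Sum>q\<in>UNIV. \<Sum>k\<in>UNIV. M p q * X k p * C i k q)"
  proof -
    have "(\<Sum>p\<in>UNIV. \<Sum>q\<in>UNIV. \<Sum>k\<in>UNIV. M q k * X p k * C i p q)
        = (\<Sum>q\<in>UNIV. \<Sum>p\<in>UNIV. \<Sum>k\<in>UNIV. M q k * X p k * C i p q)" by (rule sum.swap)
    also have "\<dots> = (\<Sum>q\<in>UNIV. \<Sum>k\<in>UNIV. \<Sum>p\<in>UNIV. M q k * X p k * C i p q)"
      by (rule sum.cong[OF refl]) (rule sum.swap)
    also have "\<dots> = (\<Sum>k\<in>UNIV. \<Sum>q\<in>UNIV. \<Sum>p\<in>UNIV. M q k * X p k * C i p q)" by (rule sum.swap)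
    finally show ?thesis by (simp add: Ms)
  qed
  also have "(\<Sum>p\<in>UNIV. \<Sum>q\<in>UNIV. \<Sum>k\<in>UNIV. M p q * (X i k * C k p q))
      = (\<Sum>k\<in>UNIV. X i k * (\<Sum>p\<in>UNIV. \<Sum>q\<in>UNIV. M p q * C k p q))"
  proof -
    have "(\<Sum>p\<in>UNIV. \<Sum>q\<in>UNIV. \<Sum>k\<in>UNIV. M p q * (X i k * C k p q))
        = (\<Sum>p\<in>UNIV. \<Sum>k\<in>UNIV. \<Sum>q\<in>UNIV. M p q * (X i k * C k p q))"
      by (rule sum.cong[OF refl]) (rule sum.swap)
    also have "\<dots> = (\<Sum>k\<in>UNIV. \<Sum>p\<in>UNIV. \<Sum>q\<in>UNIV. M p q * (X i k * C k p q))" by (rule sum.swap)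
    finally show ?thesis by (simp add: sum_distrib_left mult_ac)
  qed
  also have "(\<Sum>p\<in>UNIV. \<Sum>q\<in>UNIV. M p q * (if i = q then partial p m x else 0)) = L"
    unfolding L_def by (simp add: Ms[of i] if_distrib cong: if_cong)
  also have "(\<Sum>p\<in>UNIV. \<Sum>q\<in>UNIV. M p q * (if i = p then partial q m x else 0)) = L"
    unfolding L_def by (subst sum.swap) (simp add: if_distrib cong: if_cong)
  finally show ?thesis
    unfolding Mg unfolding M_def C_def X_def Y_def L_def r_def contracted_christoffel_def
    by (simp add: field_simps)
qed

end

subsection \<open>The second prolongation in coordinates\<close>

definition deriv_x :: "'n::finite \<Rightarrow> ((real^'n) \<times> real \<Rightarrow> real) \<Rightarrow> (real^'n) \<times> real \<Rightarrow> real" where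
  "deriv_x i F z = frechet_derivative F (at z) (axis i 1, 0)"

definition deriv_u :: "((real^'n::finite) \<times> real \<Rightarrow> real) \<Rightarrow> (real^'n) \<times> real \<Rightarrow> real" where
  "deriv_u F z = frechet_derivative F (at z) (0, 1)"

lemma smooth_on_deriv_x: "smooth_on W F \<Longrightarrow> smooth_on W (deriv_x i F)"
  unfolding deriv_x_def[abs_def] by (rule smooth_on_derivative)

lemma smooth_on_deriv_u: "smooth_on W F \<Longrightarrow> smooth_on W (deriv_u F)"
  unfolding deriv_u_def[abs_def] by (rule smooth_on_derivative)

lemma frechet_derivative_product:
  fixes F :: "(real^'n::finite) \<times> real \<Rightarrow> real"
  assumes "F differentiable (at z)"
  shows "frechet_derivative F (at z) (axis i 1, c) = deriv_x i F z + c * deriv_u F z"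
proof -
  interpret linear "frechet_derivative F (at z)" by (rule linear_frechet_derivative[OF assms])
  have "(axis i 1, c) = (axis i 1, 0) + c *\<^sub>R (0 :: real^'n, 1 :: real)" by simp
  then show ?thesis unfolding deriv_x_def deriv_u_def by (metis add scale real_scaleR_def)
qed

lemma total_derivative0_eq:
  assumes "F differentiable (at (x, u))"
  shows "total_derivative0 i F (x, u, p) = deriv_x i F (x, u) + p $ i * deriv_u F (x, u)"
  unfolding total_derivative0_def by (simp add: frechet_derivative_product[OF assms])

lemma prolong_coeff1_eq:
  assumes "\<eta> differentiable (at (x, u))" "\<And>k. (\<lambda>z. \<xi> z $ k) differentiable (at (x, u))"
  shows "prolong_coeff1 \<xi> \<eta> i (x, u, p) = deriv_x i \<eta> (x, u) + p $ i * deriv_u \<eta> (x, u)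
     - (\<Sum>k\<in>UNIV. p $ k * (deriv_x i (\<lambda>z. \<xi> z $ k) (x, u) + p $ i * deriv_u (\<lambda>z. \<xi> z $ k) (x, u)))"
  unfolding prolong_coeff1_def by (simp add: total_derivative0_eq assms)

text \<open>The first prolongation coefficient is a polynomial in p whose coefficients are functions
  of (x, u), so the product and chain rules give its total derivative.\<close>

lemma total_derivative1_prolong_coeff1:
  fixes \<xi> :: "(real^'n::finite) \<times> real \<Rightarrow> real^'n"
  assumes W: "open W" "(x, u) \<in> W" and sm: "smooth_on W \<xi>" "smooth_on W \<eta>"
  shows "total_derivative1 j (prolong_coeff1 \<xi> \<eta> i) (x, u, p, q) =
    deriv_x j (deriv_x i \<eta>) (x, u) + p $ j * deriv_u (deriv_x i \<eta>) (x, u)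
    + q $ j $ i * deriv_u \<eta> (x, u)
    + p $ i * (deriv_x j (deriv_u \<eta>) (x, u) + p $ j * deriv_u (deriv_u \<eta>) (x, u))
    - (\<Sum>k\<in>UNIV. q $ j $ k * (deriv_x i (\<lambda>z. \<xi> z $ k) (x, u) + p $ i * deriv_u (\<lambda>z. \<xi> z $ k) (x, u))
       + p $ k * (deriv_x j (deriv_x i (\<lambda>z. \<xi> z $ k)) (x, u) + p $ j * deriv_u (deriv_x i (\<lambda>z. \<xi> z $ k)) (x, u)
          + q $ j $ i * deriv_u (\<lambda>z. \<xi> z $ k) (x, u)
          + p $ i * (deriv_x j (deriv_u (\<lambda>z. \<xi> z $ k)) (x, u) + p $ j * deriv_u (deriv_u (\<lambda>z. \<xi> z $ k)) (x, u))))"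
proof -
  define w where "w = (\<lambda>k z. \<xi> z $ k)"
  have smw: "smooth_on W (w k)" for k unfolding w_def by (rule smooth_on_vec_nth[OF W(1) sm(1)])
  \<comment> \<open>Linear projections to (x, u) and to the components of p. They serve as their own
    derivatives, so the chain rule leaves only derivatives in (x, u).\<close>
  define \<pi> :: "(real^'n) \<times> real \<times> (real^'n) \<Rightarrow> (real^'n) \<times> real" where "\<pi> = (\<lambda>y. (fst y, fst (snd y)))"
  define \<rho> :: "'n \<Rightarrow> (real^'n) \<times> real \<times> (real^'n) \<Rightarrow> real" where "\<rho> = (\<lambda>i y. snd (snd y) $ i)"
  have bpi: "bounded_linear \<pi>" unfolding \<pi>_def
    by (intro bounded_linear_Pair bounded_linear_fst bounded_linear_fst_comp bounded_linear_snd)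
  have bl: "bounded_linear (\<rho> i)" for i unfolding \<rho>_def
    by (intro bounded_linear_compose[OF bounded_linear_vec_nth] bounded_linear_snd_comp bounded_linear_snd)
  have hpi: "(\<pi> has_derivative \<pi>) (at y)" and hr: "(\<rho> i has_derivative \<rho> i) (at y)" for i y
    using bounded_linear_imp_has_derivative bpi bl by blast+
  let ?y = "(x, u, p)"
  let ?h = "(axis j 1, p $ j, q $ j) :: (real^'n) \<times> real \<times> (real^'n)"
  have comp: "((\<lambda>y. F (\<pi> y)) has_derivative (\<lambda>h. frechet_derivative F (at (x, u)) (\<pi> h))) (at ?y)"
    if "smooth_on W F" for F :: "(real^'n) \<times> real \<Rightarrow> real"
    by (rule has_derivative_compose[OF hpi]) (use smooth_on_has_derivative[OF that W(2)] in \<open>simp add: \<pi>_def\<close>)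
  define P where "P = (\<lambda>y. deriv_x i \<eta> (\<pi> y) + \<rho> i y * deriv_u \<eta> (\<pi> y)
     - (\<Sum>k\<in>UNIV. \<rho> k y * (deriv_x i (w k) (\<pi> y) + \<rho> i y * deriv_u (w k) (\<pi> y))))"
  \<comment> \<open>The polynomial formula for the coefficient holds only over \<open>W\<close>, so
    derivatives are compared on an open preimage.\<close>
  have "open (\<pi> -` W)"
    by (rule continuous_open_vimage[OF W(1)]) (simp add: \<pi>_def continuous_intros)
  moreover have "?y \<in> \<pi> -` W" using W(2) by (simp add: \<pi>_def)
  moreover have "prolong_coeff1 \<xi> \<eta> i y = P y" if "y \<in> \<pi> -` W" for y
  proof -
    obtain x' u' p' where y: "y = (x', u', p')" by (cases y) auto
    have "(x', u') \<in> W" using that by (simp add: y \<pi>_def)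
    then show ?thesis
      unfolding y P_def \<pi>_def \<rho>_def w_def
      using prolong_coeff1_eq[OF smooth_on_differentiable[OF sm(2)] smooth_on_differentiable[OF smw[unfolded w_def]]]
      by simp
  qed
  ultimately have "frechet_derivative (prolong_coeff1 \<xi> \<eta> i) (at ?y) = frechet_derivative P (at ?y)"
    by (rule frechet_derivative_cong)
  moreover have "(P has_derivative (\<lambda>h.
      (frechet_derivative (deriv_x i \<eta>) (at (x, u)) (\<pi> h)
        + (\<rho> i ?y * frechet_derivative (deriv_u \<eta>) (at (x, u)) (\<pi> h) + \<rho> i h * deriv_u \<eta> (\<pi> ?y)))
      - (\<Sum>k\<in>UNIV. \<rho> k ?y * (frechet_derivative (deriv_x i (w k)) (at (x, u)) (\<pi> h)
            + (\<rho> i ?y * frechet_derivative (deriv_u (w k)) (at (x, u)) (\<pi> h) + \<rho> i h * deriv_u (w k) (\<pi> ?y)))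
          + \<rho> k h * (deriv_x i (w k) (\<pi> ?y) + \<rho> i ?y * deriv_u (w k) (\<pi> ?y))))) (at ?y)"
    unfolding P_def
    by (intro has_derivative_add has_derivative_diff has_derivative_sum has_derivative_mult comp hr
        smooth_on_deriv_x smooth_on_deriv_u sm(2) smw)
  ultimately have "frechet_derivative (prolong_coeff1 \<xi> \<eta> i) (at ?y) ?h =
      (frechet_derivative (deriv_x i \<eta>) (at (x, u)) (\<pi> ?h)
        + (\<rho> i ?y * frechet_derivative (deriv_u \<eta>) (at (x, u)) (\<pi> ?h) + \<rho> i ?h * deriv_u \<eta> (\<pi> ?y)))
      - (\<Sum>k\<in>UNIV. \<rho> k ?y * (frechet_derivative (deriv_x i (w k)) (at (x, u)) (\<pi> ?h)
            + (\<rho> i ?y * frechet_derivative (deriv_u (w k)) (at (x, u)) (\<pi> ?h) + \<rho> i ?h * deriv_u (w k) (\<pi> ?y)))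
          + \<rho> k ?h * (deriv_x i (w k) (\<pi> ?y) + \<rho> i ?y * deriv_u (w k) (\<pi> ?y)))"
    by (simp add: frechet_derivativeI)
  moreover have "\<pi> ?h = (axis j 1, p $ j)" "\<pi> ?y = (x, u)" "\<rho> k ?h = q $ j $ k" "\<rho> k ?y = p $ k" for k
    by (simp_all add: \<pi>_def \<rho>_def)
  moreover have "frechet_derivative F (at (x, u)) (axis j 1, p $ j) = deriv_x j F (x, u) + p $ j * deriv_u F (x, u)"
    if "smooth_on W F" for F :: "(real^'n) \<times> real \<Rightarrow> real"
    by (rule frechet_derivative_product[OF smooth_on_differentiable[OF that W(2)]])
  ultimately have "frechet_derivative (prolong_coeff1 \<xi> \<eta> i) (at ?y) ?h =
    deriv_x j (deriv_x i \<eta>) (x, u) + p $ j * deriv_u (deriv_x i \<eta>) (x, u)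
    + (p $ i * (deriv_x j (deriv_u \<eta>) (x, u) + p $ j * deriv_u (deriv_u \<eta>) (x, u)) + q $ j $ i * deriv_u \<eta> (x, u))
    - (\<Sum>k\<in>UNIV. p $ k * (deriv_x j (deriv_x i (w k)) (x, u) + p $ j * deriv_u (deriv_x i (w k)) (x, u)
          + (p $ i * (deriv_x j (deriv_u (w k)) (x, u) + p $ j * deriv_u (deriv_u (w k)) (x, u))
            + q $ j $ i * deriv_u (w k) (x, u)))
        + q $ j $ k * (deriv_x i (w k) (x, u) + p $ i * deriv_u (w k) (x, u)))"
    by (simp add: smooth_on_deriv_x smooth_on_deriv_u sm(2) smw)
  then show ?thesis
    unfolding total_derivative1_def w_def by (simp add: algebra_simps)
qed

section \<open>Linear algebra of trace-free symmetric matrices\<close>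

lemma orthogonal_vector_exists:
  fixes v :: "real^'n::finite"
  assumes "CARD('n) \<ge> 2"
  shows "\<exists>z. z \<noteq> 0 \<and> v \<bullet> z = 0"
proof -
  obtain i j :: 'n where "i \<noteq> j"
    using assms card_le_Suc0_iff_eq[of "UNIV :: 'n set"] by fastforce
  show ?thesis
  proof (cases "v $ i = 0")
    case True
    then show ?thesis by (intro exI[of _ "axis i 1"]) (simp add: inner_axis)
  next
    case False
    have "(v $ i *\<^sub>R axis j 1 - v $ j *\<^sub>R axis i 1) $ j = v $ i"
      using \<open>i \<noteq> j\<close> by (simp add: axis_def)
    then have "v $ i *\<^sub>R axis j 1 - v $ j *\<^sub>R axis i (1::real) \<noteq> 0"
      using False by (metis zero_index)
    then show ?thesis
      by (intro exI[of _ "v $ i *\<^sub>R axis j 1 - v $ j *\<^sub>R axis i 1"])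
        (simp add: inner_diff_right inner_axis)
  qed
qed

text \<open>Test with the component of \<open>K\<close> that is Frobenius-orthogonal to \<open>N\<close>.\<close>

lemma proportional_if_annihilates_traceless:
  fixes K N :: "real^'n::finite^'n"
  assumes "transpose K = K" "transpose N = N"
    and "\<And>r. transpose r = r \<Longrightarrow> N \<bullet> r = 0 \<Longrightarrow> K \<bullet> r = 0"
  shows "\<exists>c. K = c *\<^sub>R N"
proof -
  define c where "c = (K \<bullet> N) / (N \<bullet> N)"
  define r where "r = K - c *\<^sub>R N"
  have "transpose r = r"
    using assms(1,2) unfolding r_def transpose_def vec_eq_iff by simp
  moreover have Nr: "N \<bullet> r = 0"
    unfolding r_def c_def by (cases "N = 0") (simp_all add: inner_diff_right inner_commute)
  ultimately have "K \<bullet> r = 0" by (rule assms(3))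
  then have "r \<bullet> r = 0" unfolding r_def using Nr[unfolded r_def] by (simp add: inner_diff_left)
  then show ?thesis by (auto simp: r_def)
qed

lemma inner_matrix: "(A :: real^'n::finite^'m::finite) \<bullet> B = (\<Sum>i\<in>UNIV. \<Sum>j\<in>UNIV. A $ i $ j * B $ i $ j)"
  by (simp add: inner_vec_def)

text \<open>A matrix of rank at most one annihilates some nonzero vector in dimension at least two,
  whereas a nonzero multiple of an invertible matrix annihilates none.\<close>

lemma square_not_proportional_to_invertible:
  fixes v :: "real^'n::finite"
  assumes "CARD('n) \<ge> 2" "M ** B = mat 1" "B ** M = mat 1" "(\<chi> j k. v $ j * v $ k) = c *\<^sub>R M"
  shows "v = 0"
proof (cases "c = 0")
  case True
  then have "v $ j * v $ j = 0" for j
    using arg_cong[OF assms(4), of "\<lambda>K. K $ j $ j"] by simp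
  then show ?thesis by (simp add: vec_eq_iff)
next
  case False
  obtain z where z: "z \<noteq> 0" "v \<bullet> z = 0" using orthogonal_vector_exists[OF assms(1)] by blast
  have "(\<chi> j k. v $ j * v $ k) *v z = (v \<bullet> z) *\<^sub>R v"
    by (simp add: vec_eq_iff matrix_vector_mult_def inner_vec_def sum_distrib_left sum_distrib_right mult_ac)
  then have "c *\<^sub>R (M *v z) = 0"
    using z assms(4) by (simp add: scaleR_matrix_vector_assoc)
  then have "B *v (M *v z) = 0" using False by simp
  then have "z = 0" using assms(3) by (simp add: matrix_vector_mul_assoc)
  then show ?thesis using z by simp
qed

text \<open>The part of the second prolongation coefficient that is linear in the second derivatives.\<close>

definition principal_part ::
  "((real^'n::finite) \<times> real \<Rightarrow> real^'n) \<Rightarrow> ((real^'n) \<times> real \<Rightarrow> real) \<Rightarrow> real^'n \<Rightarrow> real \<Rightarrow> real^'n \<Rightarrow> real^'n^'n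
     \<Rightarrow> 'n \<Rightarrow> 'n \<Rightarrow> real" where
  "principal_part \<xi> \<eta> x u p q i j = q $ j $ i * deriv_u \<eta> (x, u)
     - (\<Sum>k\<in>UNIV. q $ j $ k * (deriv_x i (\<lambda>z. \<xi> z $ k) (x, u) + p $ i * deriv_u (\<lambda>z. \<xi> z $ k) (x, u))
          + p $ k * q $ j $ i * deriv_u (\<lambda>z. \<xi> z $ k) (x, u))
     - (\<Sum>k\<in>UNIV. q $ i $ k * (deriv_x j (\<lambda>z. \<xi> z $ k) (x, u) + p $ j * deriv_u (\<lambda>z. \<xi> z $ k) (x, u)))"

text \<open>The complement of \<open>principal_part\<close>: a polynomial in p of degree at most
  three, free of second derivatives of the unknown.\<close>

definition lower_order_part ::
  "((real^'n::finite) \<times> real \<Rightarrow> real^'n) \<Rightarrow> ((real^'n) \<times> real \<Rightarrow> real) \<Rightarrow> real^'n \<Rightarrow> real \<Rightarrow> real^'n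
     \<Rightarrow> 'n \<Rightarrow> 'n \<Rightarrow> real" where
  "lower_order_part \<xi> \<eta> x u p i j =
    deriv_x j (deriv_x i \<eta>) (x, u) + p $ j * deriv_u (deriv_x i \<eta>) (x, u)
    + p $ i * (deriv_x j (deriv_u \<eta>) (x, u) + p $ j * deriv_u (deriv_u \<eta>) (x, u))
    - (\<Sum>k\<in>UNIV. p $ k * (deriv_x j (deriv_x i (\<lambda>z. \<xi> z $ k)) (x, u) + p $ j * deriv_u (deriv_x i (\<lambda>z. \<xi> z $ k)) (x, u)
          + p $ i * (deriv_x j (deriv_u (\<lambda>z. \<xi> z $ k)) (x, u) + p $ j * deriv_u (deriv_u (\<lambda>z. \<xi> z $ k)) (x, u))))"

section \<open>The symmetry condition over one chart: splitting by order in the jet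
  variables\<close>

locale jet_domain = local_metric U G for U :: "(real^'n::finite) set" and G +
  fixes J :: "real set"
  assumes open_J: "open J" and connected_J: "connected J" and J_nonempty: "J \<noteq> {}"
    and dim: "CARD('n) \<ge> 3"
begin

lemma open_domain: "open (U \<times> J)"
  using open_U open_J by (rule open_Times)

text \<open>The nonlinearity contributes one number, its derivative \<open>f'\<close> at u; keeping
  that as a parameter treats all equations at once.\<close>

lemma has_derivative_poisson_jet:
  assumes x: "x \<in> U" and f: "(f has_real_derivative f') (at u)"
  shows "(poisson_jet G f has_derivative (\<lambda>(dx, du, dp, dq).
     (\<Sum>i\<in>UNIV. \<Sum>j\<in>UNIV. inverse_metric G i j x * dq $ i $ j
        + frechet_derivative (inverse_metric G i j) (at x) dx * q $ i $ j)
     - (\<Sum>i\<in>UNIV. contracted_christoffel G i x * dp $ i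
        + frechet_derivative (contracted_christoffel G i) (at x) dx * p $ i) + f' * du)) (at (x, u, p, q))"
proof -
  let ?y = "(x, u, p, q)"
  have fsth: "(fst has_derivative fst) (at ?y)"
    by (rule bounded_linear_imp_has_derivative[OF bounded_linear_fst])
  have uh: "((\<lambda>y. fst (snd y)) has_derivative (\<lambda>y. fst (snd y))) (at ?y)"
    by (rule bounded_linear_imp_has_derivative) (intro bounded_linear_fst_comp bounded_linear_snd)
  have ph: "((\<lambda>y. fst (snd (snd y)) $ i) has_derivative (\<lambda>y. fst (snd (snd y)) $ i)) (at ?y)" for i
    by (rule bounded_linear_imp_has_derivative)
      (intro bounded_linear_compose[OF bounded_linear_vec_nth] bounded_linear_fst_comp bounded_linear_snd_comp bounded_linear_snd)
  have qh: "((\<lambda>y. snd (snd (snd y)) $ i $ j) has_derivative (\<lambda>y. snd (snd (snd y)) $ i $ j)) (at ?y)" for i j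
    by (rule bounded_linear_imp_has_derivative)
      (intro bounded_linear_compose[OF bounded_linear_vec_nth] bounded_linear_snd_comp bounded_linear_snd)
  have xh: "((\<lambda>y. F (fst y)) has_derivative (\<lambda>h. frechet_derivative F (at x) (fst h))) (at ?y)"
    if "F differentiable (at x)" for F :: "real^'n \<Rightarrow> real"
    by (rule has_derivative_compose[OF fsth]) (use frechet_derivative_works_at[OF that] in simp)
  have fh: "((\<lambda>y. f (fst (snd y))) has_derivative (\<lambda>h. f' * fst (snd h))) (at ?y)"
    by (rule has_derivative_compose[OF uh]) (use f in \<open>simp add: has_field_derivative_def\<close>)
  have pj: "poisson_jet G f = (\<lambda>y. (\<Sum>i\<in>UNIV. \<Sum>j\<in>UNIV. inverse_metric G i j (fst y) * snd (snd (snd y)) $ i $ j)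
      - (\<Sum>i\<in>UNIV. contracted_christoffel G i (fst y) * fst (snd (snd y)) $ i) + f (fst (snd y)))"
    by (auto simp: poisson_jet_def laplace_jet_def fun_eq_iff)
  have "(poisson_jet G f has_derivative (\<lambda>h.
     (\<Sum>i\<in>UNIV. \<Sum>j\<in>UNIV. inverse_metric G i j (fst ?y) * snd (snd (snd h)) $ i $ j
        + frechet_derivative (inverse_metric G i j) (at x) (fst h) * snd (snd (snd ?y)) $ i $ j)
     - (\<Sum>i\<in>UNIV. contracted_christoffel G i (fst ?y) * fst (snd (snd h)) $ i
        + frechet_derivative (contracted_christoffel G i) (at x) (fst h) * fst (snd (snd ?y)) $ i)
     + f' * fst (snd h))) (at ?y)"
    unfolding pj
    by (intro has_derivative_add has_derivative_diff has_derivative_sum has_derivative_mult xh qh ph fh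
        differentiable_inverse_metric differentiable_contracted_christoffel x)
  then show ?thesis by (simp add: case_prod_beta')
qed

lemma prolong_coeff2_eq:
  assumes "x \<in> U" "u \<in> J" "smooth_on (U \<times> J) \<xi>" "smooth_on (U \<times> J) \<eta>"
  shows "prolong_coeff2 \<xi> \<eta> i j (x, u, p, q) =
    principal_part \<xi> \<eta> x u p q i j + lower_order_part \<xi> \<eta> x u p i j"
proof -
  have xu: "(x, u) \<in> U \<times> J" using assms by simp
  have "(\<lambda>z. \<xi> z $ k) differentiable (at (x, u))" for k
    by (rule smooth_on_differentiable[OF smooth_on_vec_nth[OF open_domain assms(3)] xu])
  then show ?thesis
    unfolding prolong_coeff2_def principal_part_def lower_order_part_def
    by (simp add: total_derivative0_eq total_derivative1_prolong_coeff1[OF open_domain xu assms(3,4)]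
        sum.distrib sum_subtractf algebra_simps)
qed

text \<open>Sorted by q: the first double sum is linear in q and everything after it is free of q,
  so differences of two jets over the same (x, u, p) see the first sum only.\<close>

lemma prolongation2_poisson:
  assumes x: "x \<in> U" and u: "u \<in> J" and sm: "smooth_on (U \<times> J) \<xi>" "smooth_on (U \<times> J) \<eta>"
    and f: "(f has_real_derivative f') (at u)"
  shows "prolongation2 \<xi> \<eta> (poisson_jet G f) (x, u, p, q) =
    (\<Sum>i\<in>UNIV. \<Sum>j\<in>UNIV. inverse_metric G i j x * principal_part \<xi> \<eta> x u p q i j
        + (\<Sum>k\<in>UNIV. \<xi> (x, u) $ k * partial k (inverse_metric G i j) x) * q $ i $ j)
    + (\<Sum>i\<in>UNIV. \<Sum>j\<in>UNIV. inverse_metric G i j x * lower_order_part \<xi> \<eta> x u p i j)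
    - (\<Sum>i\<in>UNIV. contracted_christoffel G i x * (deriv_x i \<eta> (x, u) + p $ i * deriv_u \<eta> (x, u)
           - (\<Sum>k\<in>UNIV. p $ k * (deriv_x i (\<lambda>z. \<xi> z $ k) (x, u) + p $ i * deriv_u (\<lambda>z. \<xi> z $ k) (x, u))))
        + (\<Sum>k\<in>UNIV. \<xi> (x, u) $ k * partial k (contracted_christoffel G i) x) * p $ i)
    + f' * \<eta> (x, u)"
proof -
  have xu: "(x, u) \<in> U \<times> J" using x u by simp
  have dk: "(\<lambda>z. \<xi> z $ k) differentiable (at (x, u))" for k
    by (rule smooth_on_differentiable[OF smooth_on_vec_nth[OF open_domain sm(1)] xu])
  have de: "\<eta> differentiable (at (x, u))" by (rule smooth_on_differentiable[OF sm(2) xu])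
  show ?thesis
    unfolding prolongation2_def
    by (simp add: frechet_derivativeI[OF has_derivative_poisson_jet[OF x f]] prolong_coeff2_eq[OF x u sm]
        prolong_coeff1_eq[OF de dk] frechet_derivative_real_eq_sum differentiable_inverse_metric x
        differentiable_contracted_christoffel sum.distrib distrib_left)
qed

lemma poisson_jet_eq: "poisson_jet G f (x, u, p, q) =
    matrix_inv (G x) \<bullet> q - (\<Sum>i\<in>UNIV. contracted_christoffel G i x * p $ i) + f u"
  by (simp add: poisson_jet_def laplace_jet_def inner_matrix inverse_metric_def)

text \<open>A suitable multiple of the inverse metric itself is a solution: its pairing with the
  coefficient matrix of \<open>H\<close> is a squared Frobenius norm, positive for every
  signature.\<close>

lemma exists_hessian:
  assumes "x \<in> U"
  shows "\<exists>q. transpose q = q \<and> poisson_jet G f (x, u, p, q) = 0"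
proof -
  define M where "M = matrix_inv (G x)"
  define t where "t = (\<Sum>i\<in>UNIV. contracted_christoffel G i x * p $ i) - f u"
  have "M \<noteq> 0"
    unfolding M_def by (rule matrix_right_inverse_nonzero[OF matrix_inv_right_left(2)[OF invertible_G[OF assms]]])
  then have "M \<bullet> ((t / (M \<bullet> M)) *\<^sub>R M) = t" by simp
  moreover have "transpose ((t / (M \<bullet> M)) *\<^sub>R M) = (t / (M \<bullet> M)) *\<^sub>R M"
    using matrix_inv_sym[OF assms] unfolding M_def[symmetric] by (simp add: transpose_def vec_eq_iff)
  ultimately show ?thesis
    by (intro exI[of _ "(t / (M \<bullet> M)) *\<^sub>R M"] conjI) (simp_all add: poisson_jet_eq M_def[symmetric] t_def)
qed

definition infinitesimal_symmetry ::
  "(real \<Rightarrow> real) \<Rightarrow> ((real^'n) \<times> real \<Rightarrow> real^'n) \<Rightarrow> ((real^'n) \<times> real \<Rightarrow> real) \<Rightarrow> bool" where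
  "infinitesimal_symmetry f \<xi> \<eta> \<longleftrightarrow> (\<forall>x\<in>U. \<forall>u\<in>J. \<forall>p q. transpose q = q \<longrightarrow>
     poisson_jet G f (x, u, p, q) = 0 \<longrightarrow> prolongation2 \<xi> \<eta> (poisson_jet G f) (x, u, p, q) = 0)"

lemma principal_part_add:
  "principal_part \<xi> \<eta> x u p (q + r) i j = principal_part \<xi> \<eta> x u p q i j + principal_part \<xi> \<eta> x u p r i j"
  unfolding principal_part_def by (simp add: sum.distrib algebra_simps)

text \<open>Since \<open>H\<close> is affine in q, adding a trace-free \<open>r\<close> to a
  solution gives another solution; the difference of the two symmetry conditions is the linear part
  evaluated at \<open>r\<close>.\<close>

lemma principal_part_traceless:
  assumes x: "x \<in> U" and u: "u \<in> J" and sm: "smooth_on (U \<times> J) \<xi>" "smooth_on (U \<times> J) \<eta>"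
    and f: "(f has_real_derivative f') (at u)"
    and sym: "infinitesimal_symmetry f \<xi> \<eta>"
    and r: "transpose r = r" "matrix_inv (G x) \<bullet> r = 0"
  shows "(\<Sum>i\<in>UNIV. \<Sum>j\<in>UNIV. inverse_metric G i j x * principal_part \<xi> \<eta> x u p r i j
        + (\<Sum>k\<in>UNIV. \<xi> (x, u) $ k * partial k (inverse_metric G i j) x) * r $ i $ j) = 0"
proof -
  obtain q where q: "transpose q = q" "poisson_jet G f (x, u, p, q) = 0" using exists_hessian[OF x] by blast
  have "transpose (q + r) = q + r" using q r by (simp add: transpose_def vec_eq_iff)
  moreover have "poisson_jet G f (x, u, p, q + r) = 0"
    using q(2) r(2) by (simp add: poisson_jet_eq inner_add_right)
  ultimately have "prolongation2 \<xi> \<eta> (poisson_jet G f) (x, u, p, q + r) = 0"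
      "prolongation2 \<xi> \<eta> (poisson_jet G f) (x, u, p, q) = 0"
    using sym q x u unfolding infinitesimal_symmetry_def by blast+
  then show ?thesis
    unfolding prolongation2_poisson[OF x u sm f]
    by (simp add: principal_part_add sum.distrib algebra_simps)
qed

text \<open>With v = \<xi>_u, subtracting the condition at p = 0 from that at p leaves the terms
  bilinear in p and v. For p = G v they reduce to twice r(v, v) plus a multiple of the trace of r.
  Hence v v^T annihilates all trace-free r and is a multiple of g^{-1}, and its rank forces v =
  0.\<close>

lemma symmetry_deriv_u_zero:
  assumes x: "x \<in> U" and u: "u \<in> J" and sm: "smooth_on (U \<times> J) \<xi>" "smooth_on (U \<times> J) \<eta>"
    and f: "(f has_real_derivative f') (at u)"
    and sym: "infinitesimal_symmetry f \<xi> \<eta>"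
  shows "deriv_u (\<lambda>z. \<xi> z $ k) (x, u) = 0"
proof -
  define M where "M = matrix_inv (G x)"
  have Mij: "inverse_metric G i j x = M $ i $ j" for i j by (simp add: M_def inverse_metric_def)
  have Msym: "M $ i $ j = M $ j $ i" for i j using M_sym[OF x, of i j] by (simp add: Mij)
  define v where "v = (\<chi> k. deriv_u (\<lambda>z. \<xi> z $ k) (x, u))"
  \<comment> \<open>Lowering the index of v makes the contraction of the inverse metric with p
    return v, which turns the bilinear form into a square.\<close>
  define p where "p = G x *v v"
  have "M *v p = v"
    unfolding p_def M_def by (simp add: matrix_vector_mul_assoc matrix_inv_right_left[OF invertible_G[OF x]])
  then have Mp: "(\<Sum>j\<in>UNIV. M $ i $ j * p $ j) = v $ i" for i
    by (simp add: matrix_vector_mult_def vec_eq_iff)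
  have "(\<chi> j k. v $ j * v $ k) \<bullet> r = 0" if r: "transpose r = r" "M \<bullet> r = 0" for r
  proof -
    have rs: "r $ i $ j = r $ j $ i" for i j using r(1) by (metis (no_types, lifting) transpose_def vec_lambda_beta)
    have tr: "(\<Sum>i\<in>UNIV. \<Sum>j\<in>UNIV. M $ i $ j * r $ i $ j) = 0" using r(2) by (simp add: inner_matrix)
    note F = principal_part_traceless[OF x u sm f sym r[unfolded M_def]]
    have Z: "(\<Sum>i\<in>UNIV. \<Sum>j\<in>UNIV. M $ i $ j * (principal_part \<xi> \<eta> x u p r i j - principal_part \<xi> \<eta> x u 0 r i j)) = 0"
      using F[of p] F[of 0] unfolding Mij by (simp add: sum.distrib sum_subtractf algebra_simps)
    have PP: "principal_part \<xi> \<eta> x u p r i j - principal_part \<xi> \<eta> x u 0 r i j =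
      - (\<Sum>k\<in>UNIV. r $ j $ k * p $ i * v $ k) - r $ i $ j * (\<Sum>k\<in>UNIV. p $ k * v $ k)
        - (\<Sum>k\<in>UNIV. r $ i $ k * p $ j * v $ k)" for i j
      unfolding principal_part_def rs[of j i]
      by (simp add: v_def sum.distrib sum_subtractf sum_distrib_left algebra_simps)
    define pv where "pv = (\<Sum>k\<in>UNIV. p $ k * v $ k)"
    from Z have "(\<Sum>i\<in>UNIV. \<Sum>j\<in>UNIV. \<Sum>k\<in>UNIV. M $ i $ j * (r $ j $ k * p $ i * v $ k))
        + (\<Sum>i\<in>UNIV. \<Sum>j\<in>UNIV. M $ i $ j * r $ i $ j) * pv
        + (\<Sum>i\<in>UNIV. \<Sum>j\<in>UNIV. \<Sum>k\<in>UNIV. M $ i $ j * (r $ i $ k * p $ j * v $ k)) = 0"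
      unfolding PP pv_def[symmetric]
      by (simp add: right_diff_distrib sum_subtractf sum_negf sum_distrib_left sum_distrib_right mult.assoc)
    moreover have "(\<Sum>i\<in>UNIV. \<Sum>j\<in>UNIV. \<Sum>k\<in>UNIV. M $ i $ j * (r $ j $ k * p $ i * v $ k)) =
       (\<Sum>i\<in>UNIV. \<Sum>j\<in>UNIV. \<Sum>k\<in>UNIV. M $ i $ j * (r $ i $ k * p $ j * v $ k))"
      by (subst sum.swap) (simp add: Msym)
    moreover have "(\<Sum>i\<in>UNIV. \<Sum>j\<in>UNIV. \<Sum>k\<in>UNIV. M $ i $ j * (r $ i $ k * p $ j * v $ k)) =
      (\<Sum>i\<in>UNIV. \<Sum>k\<in>UNIV. v $ i * v $ k * r $ i $ k)"
    proof (rule sum.cong[OF refl])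
      fix i
      have "(\<Sum>j\<in>UNIV. \<Sum>k\<in>UNIV. M $ i $ j * (r $ i $ k * p $ j * v $ k)) =
         (\<Sum>k\<in>UNIV. (\<Sum>j\<in>UNIV. M $ i $ j * p $ j) * v $ k * r $ i $ k)"
        by (subst sum.swap) (simp add: sum_distrib_left sum_distrib_right mult_ac)
      then show "(\<Sum>j\<in>UNIV. \<Sum>k\<in>UNIV. M $ i $ j * (r $ i $ k * p $ j * v $ k)) =
         (\<Sum>k\<in>UNIV. v $ i * v $ k * r $ i $ k)" by (simp add: Mp)
    qed
    ultimately show ?thesis using tr by (simp add: inner_matrix)
  qed
  then obtain c where "(\<chi> j k. v $ j * v $ k) = c *\<^sub>R M"
    using proportional_if_annihilates_traceless[of "\<chi> j k. v $ j * v $ k" M] matrix_inv_sym[OF x]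
    unfolding M_def[symmetric] by (auto simp: transpose_def vec_eq_iff mult.commute)
  then have "v = 0"
    using square_not_proportional_to_invertible[of M "G x" v c] dim matrix_inv_right_left[OF invertible_G[OF x]]
    by (simp add: M_def)
  then show ?thesis by (simp add: v_def vec_eq_iff)
qed

lemma has_derivative_affine_in_u:
  assumes x: "x \<in> U" and u: "u \<in> J" and F: "\<And>y w. y \<in> U \<Longrightarrow> w \<in> J \<Longrightarrow> F (y, w) = a y * w + b y"
    and d: "a differentiable (at x)" "b differentiable (at x)"
  shows "deriv_x i F (x, u) = partial i a x * u + partial i b x" "deriv_u F (x, u) = a x"
proof -
  have fsth: "(fst has_derivative fst) (at (x, u))"
    by (rule bounded_linear_imp_has_derivative[OF bounded_linear_fst])
  have sndh: "(snd has_derivative snd) (at (x, u))"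
    by (rule bounded_linear_imp_has_derivative[OF bounded_linear_snd])
  have xh: "((\<lambda>y. H (fst y)) has_derivative (\<lambda>h. frechet_derivative H (at x) (fst h))) (at (x, u))"
    if "H differentiable (at x)" for H :: "real^'n \<Rightarrow> real"
    by (rule has_derivative_compose[OF fsth]) (use frechet_derivative_works_at[OF that] in simp)
  have "((\<lambda>z. a (fst z) * snd z + b (fst z)) has_derivative (\<lambda>h. (a (fst (x, u)) * snd h
     + frechet_derivative a (at x) (fst h) * snd (x, u)) + frechet_derivative b (at x) (fst h))) (at (x, u))"
    by (intro has_derivative_add has_derivative_mult xh d sndh)
  moreover have "frechet_derivative F (at (x, u)) = frechet_derivative (\<lambda>z. a (fst z) * snd z + b (fst z)) (at (x, u))"
    using F x u by (intro frechet_derivative_cong[OF open_domain]) auto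
  ultimately have D: "frechet_derivative F (at (x, u)) h = a x * snd h
     + frechet_derivative a (at x) (fst h) * u + frechet_derivative b (at x) (fst h)" for h
    by (simp add: frechet_derivativeI)
  have "frechet_derivative a (at x) 0 = 0" "frechet_derivative b (at x) 0 = 0"
    using linear_0[OF linear_frechet_derivative] d by blast+
  then show "deriv_x i F (x, u) = partial i a x * u + partial i b x" "deriv_u F (x, u) = a x"
    unfolding deriv_x_def deriv_u_def partial_def by (simp_all add: D)
qed

text \<open>A general slope \<open>c\<close> covers three uses: c = 0 for the components of \<xi>
  and for \<eta>_u, and c = a(x) for \<eta> itself. Connectedness of \<open>J\<close> carries the
  identity from one u to all others.\<close>

lemma constant_in_u:
  fixes F :: "(real^'n) \<times> real \<Rightarrow> real"
  assumes sm: "smooth_on (U \<times> J) F" and x: "x \<in> U" and D: "\<And>u. u \<in> J \<Longrightarrow> deriv_u F (x, u) = c"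
    and u: "u \<in> J" "w \<in> J"
  shows "F (x, u) - c * u = F (x, w) - c * w"
proof (rule has_derivative_zero_unique_connected[OF open_J connected_J _ u, of "\<lambda>u. F (x, u) - c * u"])
  fix t assume t: "t \<in> J"
  have xt: "(x, t) \<in> U \<times> J" using x t by simp
  have "((\<lambda>t. (x, t)) has_derivative (\<lambda>h. (0, h))) (at t)"
    by (auto intro!: derivative_eq_intros)
  from has_derivative_compose[OF this smooth_on_has_derivative[OF sm xt]]
  have "((\<lambda>t. F (x, t)) has_derivative (\<lambda>h. frechet_derivative F (at (x, t)) (0, h))) (at t)" .
  moreover have "frechet_derivative F (at (x, t)) (0, h) = h * c" for h
    using linear_scale[OF linear_frechet_derivative[OF smooth_on_differentiable[OF sm xt]], of h "(0, 1)"]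
      D[OF t] by (simp add: deriv_u_def)
  ultimately have "((\<lambda>t. F (x, t)) has_derivative (\<lambda>h. h * c)) (at t)" by simp
  from has_derivative_diff[OF this has_derivative_mult_right[OF has_derivative_ident, of c]]
  show "((\<lambda>u. F (x, u) - c * u) has_derivative (\<lambda>x. 0)) (at t)" by (simp add: mult.commute)
qed

text \<open>The components of the Lie derivative of the contravariant metric g^{ij} along
  \<open>v\<close>.\<close>

definition lie_inverse_metric :: "(real^'n \<Rightarrow> real^'n) \<Rightarrow> 'n \<Rightarrow> 'n \<Rightarrow> real^'n \<Rightarrow> real" where
  "lie_inverse_metric v i j x = (\<Sum>k\<in>UNIV. v x $ k * partial k (inverse_metric G i j) x)
     - (\<Sum>l\<in>UNIV. inverse_metric G i l x * partial l (\<lambda>y. v y $ j) x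
          + inverse_metric G j l x * partial l (\<lambda>y. v y $ i) x)"

lemma conformal_iff_lie_inverse_metric:
  "x \<in> U \<Longrightarrow> (\<forall>i j. lie_derivative_metric v G i j x = r * G x $ i $ j) \<longleftrightarrow>
    (\<forall>i j. lie_inverse_metric v i j x = - r * inverse_metric G i j x)"
  unfolding lie_derivative_inverse_metric lie_inverse_metric_def
  by (simp add: algebra_simps)

text \<open>Once \<xi> does not depend on u, the coefficient of q is the tensor L_v g^{-1} +
  \<eta>_u g^{-1}. Symmetry of q permits the two Jacobian terms to be symmetrised into the Lie
  derivative.\<close>

lemma prolongation2_projectable:
  assumes x: "x \<in> U" and u: "u \<in> J" and sm: "smooth_on (U \<times> J) \<xi>" "smooth_on (U \<times> J) \<eta>"
    and f: "(f has_real_derivative f') (at u)"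
    and smv: "smooth_on U v" and v: "\<forall>y\<in>U. \<forall>w\<in>J. \<xi> (y, w) = v y"
    and q: "transpose q = q"
  shows "prolongation2 \<xi> \<eta> (poisson_jet G f) (x, u, p, q) =
    (\<Sum>i\<in>UNIV. \<Sum>j\<in>UNIV. (lie_inverse_metric v i j x + deriv_u \<eta> (x, u) * inverse_metric G i j x) * q $ i $ j)
    + (\<Sum>i\<in>UNIV. \<Sum>j\<in>UNIV. inverse_metric G i j x *
        (deriv_x j (deriv_x i \<eta>) (x, u) + p $ j * deriv_u (deriv_x i \<eta>) (x, u)
         + p $ i * (deriv_x j (deriv_u \<eta>) (x, u) + p $ j * deriv_u (deriv_u \<eta>) (x, u))
         - (\<Sum>k\<in>UNIV. p $ k * partial j (partial i (\<lambda>y. v y $ k)) x)))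
    - (\<Sum>i\<in>UNIV. contracted_christoffel G i x * (deriv_x i \<eta> (x, u) + p $ i * deriv_u \<eta> (x, u)
           - (\<Sum>k\<in>UNIV. p $ k * partial i (\<lambda>y. v y $ k) x))
        + (\<Sum>k\<in>UNIV. v x $ k * partial k (contracted_christoffel G i) x) * p $ i)
    + f' * \<eta> (x, u)"
proof -
  have smk: "smooth_on U (\<lambda>y. v y $ k)" for k by (rule smooth_on_vec_nth[OF open_U smv])
  have d: "(\<lambda>y. v y $ k) differentiable (at y)" "partial i (\<lambda>y. v y $ k) differentiable (at y)" if "y \<in> U" for y i k
    using that smooth_on_differentiable smooth_on_partial smk by blast+
  note aff = has_derivative_affine_in_u[where a="\<lambda>y. 0", simplified]
  have X: "deriv_x i (\<lambda>z. \<xi> z $ k) (y, w) = partial i (\<lambda>y. v y $ k) y"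
    and Ux: "deriv_u (\<lambda>z. \<xi> z $ k) (y, w) = 0" if "y \<in> U" "w \<in> J" for y w i k
    by (rule aff[OF that _ d(1)[OF that(1)]], simp add: v)+
  have XX: "deriv_x j (deriv_x i (\<lambda>z. \<xi> z $ k)) (x, u) = partial j (partial i (\<lambda>y. v y $ k)) x"
     and UX: "deriv_u (deriv_x i (\<lambda>z. \<xi> z $ k)) (x, u) = 0" for i j k
    by (rule aff[OF x u _ d(2)[OF x]], simp add: X)+
  have XU: "deriv_x j (deriv_u (\<lambda>z. \<xi> z $ k)) (x, u) = 0"
     and UU: "deriv_u (deriv_u (\<lambda>z. \<xi> z $ k)) (x, u) = 0" for j k
    using aff[OF x u, of "deriv_u (\<lambda>z. \<xi> z $ k)" "\<lambda>y. 0"] by (simp_all add: Ux)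
  have qs: "q $ i $ j = q $ j $ i" for i j using q by (metis (no_types, lifting) transpose_def vec_lambda_beta)
  define M where "M = (\<lambda>i j. inverse_metric G i j x)"
  have Ms: "M i j = M j i" for i j unfolding M_def by (rule M_sym[OF x])
  define X' where "X' = (\<lambda>i k. partial k (\<lambda>y. v y $ i) x)"
  \<comment> \<open>Three relabellings of summation indices: the first is pure reordering, the
    second uses symmetry of the inverse metric, the third symmetry of q.\<close>
  have 1: "(\<Sum>i\<in>UNIV. \<Sum>j\<in>UNIV. M i j * (\<Sum>k\<in>UNIV. q $ i $ k * X' k j)) =
      (\<Sum>i\<in>UNIV. \<Sum>j\<in>UNIV. (\<Sum>l\<in>UNIV. M i l * X' j l) * q $ i $ j)"
    by (rule sum.cong[OF refl]) (simp add: sum_distrib_left sum_distrib_right mult_ac, rule sum.swap)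
  have 2: "(\<Sum>i\<in>UNIV. \<Sum>j\<in>UNIV. M i j * (\<Sum>k\<in>UNIV. q $ j $ k * X' k i)) =
      (\<Sum>i\<in>UNIV. \<Sum>j\<in>UNIV. (\<Sum>l\<in>UNIV. M i l * X' j l) * q $ i $ j)"
    unfolding 1[symmetric] by (subst sum.swap) (simp add: Ms)
  have 3: "(\<Sum>i\<in>UNIV. \<Sum>j\<in>UNIV. (\<Sum>l\<in>UNIV. M j l * X' i l) * q $ i $ j) =
      (\<Sum>i\<in>UNIV. \<Sum>j\<in>UNIV. (\<Sum>l\<in>UNIV. M i l * X' j l) * q $ i $ j)"
    by (subst sum.swap) (simp add: qs)
  define d where "d = (\<lambda>i j. (\<Sum>k\<in>UNIV. v x $ k * partial k (inverse_metric G i j) x))"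
  define e where "e = deriv_u \<eta> (x, u)"
  have "(\<Sum>i\<in>UNIV. \<Sum>j\<in>UNIV. M i j * (q $ j $ i * e - (\<Sum>k\<in>UNIV. q $ j $ k * X' k i)
            - (\<Sum>k\<in>UNIV. q $ i $ k * X' k j)) + d i j * q $ i $ j) =
     (\<Sum>i\<in>UNIV. \<Sum>j\<in>UNIV. M i j * q $ j $ i * e + d i j * q $ i $ j)
       - (\<Sum>i\<in>UNIV. \<Sum>j\<in>UNIV. M i j * (\<Sum>k\<in>UNIV. q $ j $ k * X' k i))
       - (\<Sum>i\<in>UNIV. \<Sum>j\<in>UNIV. M i j * (\<Sum>k\<in>UNIV. q $ i $ k * X' k j))"
    by (simp add: right_diff_distrib sum.distrib sum_subtractf mult.assoc)
  also have "\<dots> = (\<Sum>i\<in>UNIV. \<Sum>j\<in>UNIV. M i j * q $ j $ i * e + d i j * q $ i $ j)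
       - (\<Sum>i\<in>UNIV. \<Sum>j\<in>UNIV. (\<Sum>l\<in>UNIV. M i l * X' j l) * q $ i $ j)
       - (\<Sum>i\<in>UNIV. \<Sum>j\<in>UNIV. (\<Sum>l\<in>UNIV. M j l * X' i l) * q $ i $ j)"
    unfolding 1 2 3 ..
  also have "\<dots> = (\<Sum>i\<in>UNIV. \<Sum>j\<in>UNIV. (d i j - (\<Sum>l\<in>UNIV. M i l * X' j l + M j l * X' i l) + e * M i j) * q $ i $ j)"
    unfolding sum_subtractf[symmetric]
    by (intro sum.cong refl) (simp add: qs[of j i for i j] sum.distrib algebra_simps)
  finally have main: "(\<Sum>i\<in>UNIV. \<Sum>j\<in>UNIV. M i j * (q $ j $ i * e - (\<Sum>k\<in>UNIV. q $ j $ k * X' k i)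
            - (\<Sum>k\<in>UNIV. q $ i $ k * X' k j)) + d i j * q $ i $ j) =
     (\<Sum>i\<in>UNIV. \<Sum>j\<in>UNIV. (lie_inverse_metric v i j x + e * M i j) * q $ i $ j)"
    unfolding lie_inverse_metric_def d_def M_def X'_def .
  show ?thesis
    unfolding prolongation2_poisson[OF x u sm f] principal_part_def lower_order_part_def
    using main unfolding M_def X'_def d_def e_def
    by (simp add: X[OF x u] Ux[OF x u] XX UX XU UU bspec[OF bspec[OF v x] u])
qed

end

subsection \<open>Local determining equations\<close>

context local_metric
begin

lemma G_nonzero: "x \<in> U \<Longrightarrow> G x \<noteq> 0"
  by (rule matrix_right_inverse_nonzero[OF matrix_inv_right_left(1)[OF invertible_G]])

text \<open>The coefficient of the Frobenius projection of L_v g onto g. For a conformal field it is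
  the factor, and as a quotient of smooth expressions it shows that factors obtained point by point
  form a smooth function.\<close>

definition conformal_factor :: "(real^'n \<Rightarrow> real^'n) \<Rightarrow> real^'n \<Rightarrow> real" where
  "conformal_factor v x = (\<Sum>i\<in>UNIV. \<Sum>j\<in>UNIV. lie_derivative_metric v G i j x * G x $ i $ j)
     * inverse (\<Sum>i\<in>UNIV. \<Sum>j\<in>UNIV. G x $ i $ j * G x $ i $ j)"

lemma conformal_factor_eq:
  assumes x: "x \<in> U" and "\<And>i j. lie_derivative_metric v G i j x = m * G x $ i $ j"
  shows "conformal_factor v x = m"
proof -
  have "(\<Sum>i\<in>UNIV. \<Sum>j\<in>UNIV. G x $ i $ j * G x $ i $ j) \<noteq> 0"
    using G_nonzero[OF x] by (simp add: inner_matrix[symmetric])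
  then show ?thesis unfolding conformal_factor_def
    by (simp add: assms(2) sum_distrib_left[symmetric] mult.assoc)
qed

lemma smooth_lie_derivative_metric:
  assumes "smooth_on U v"
  shows "smooth_on U (lie_derivative_metric v G i j)"
  unfolding lie_derivative_metric_def[abs_def]
  by (intro smooth_on_sum smooth_on_add smooth_on_mult smooth_on_partial smooth_on_vec_nth open_U assms smooth_G)

lemma smooth_conformal_factor:
  assumes "smooth_on U v"
  shows "smooth_on U (conformal_factor v)"
  unfolding conformal_factor_def[abs_def]
proof (intro smooth_on_mult smooth_on_sum smooth_on_inverse smooth_lie_derivative_metric smooth_on_vec_nth open_U assms smooth_G)
  show "(\<Sum>i\<in>UNIV. \<Sum>j\<in>UNIV. G x $ i $ j * G x $ i $ j) \<noteq> 0" if "x \<in> U" for x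
    using G_nonzero[OF that] by (simp add: inner_matrix[symmetric])
qed

lemma sum_inverse_metric_zero:
  assumes x: "x \<in> U" and "\<And>i. (\<Sum>j\<in>UNIV. inverse_metric G i j x * w j) = 0"
  shows "w j = 0"
proof -
  have "(\<Sum>i\<in>UNIV. G x $ j $ i * (\<Sum>k\<in>UNIV. inverse_metric G i k x * w k)) =
     (\<Sum>k\<in>UNIV. (\<Sum>i\<in>UNIV. G x $ j $ i * inverse_metric G i k x) * w k)"
    by (simp add: sum_distrib_left sum_distrib_right mult.assoc) (rule sum.swap)
  also have "\<dots> = (\<Sum>k\<in>UNIV. if j = k then w k else 0)"
    by (intro sum.cong refl) (simp add: sum_G_M[OF x])
  finally show ?thesis by (simp add: assms(2))
qed

text \<open>For indefinite g a given covector may be null. If all were, polarisation would make the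
  symmetric form g^{-1} zero, contradicting invertibility.\<close>

lemma exists_nonnull_covector:
  assumes x: "x \<in> U"
  shows "\<exists>p :: real^'n. (\<Sum>i\<in>UNIV. \<Sum>j\<in>UNIV. inverse_metric G i j x * (p $ i * p $ j)) \<noteq> 0"
proof (rule ccontr)
  define M where "M = matrix_inv (G x)"
  assume "\<not> ?thesis"
  then have "p \<bullet> (M *v p) = 0" for p
    by (simp add: inverse_metric_def M_def inner_vec_def matrix_vector_mult_def sum_distrib_left mult_ac)
  note Q = this
  have "p \<bullet> (M *v q) + q \<bullet> (M *v p) = 0" for p q
    using Q[of "p + q"] Q[of p] Q[of q] by (simp add: matrix_vector_right_distrib inner_add_left inner_add_right)
  moreover have "q \<bullet> (M *v p) = p \<bullet> (M *v q)" for p q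
    using matrix_inv_sym[OF x] dot_lmul_matrix[of q M p] transpose_matrix_vector[of M q]
    unfolding M_def by (metis inner_commute)
  ultimately have "p \<bullet> (M *v q) = 0" for p q by (metis mult_2 mult_eq_0_iff zero_neq_numeral)
  then have "M *v q = 0" for q by (metis inner_eq_zero_iff)
  then have "(M ** G x) *v q = 0" for q by (simp flip: matrix_vector_mul_assoc)
  then have "q = 0" for q :: "real^'n"
    using matrix_inv_right_left(2)[OF invertible_G[OF x]] by (simp add: M_def)
  from this[of "axis undefined 1"] show False by (simp add: axis_eq_0_iff)
qed

end

context jet_domain
begin

lemma smooth_on_slice:
  assumes "smooth_on (U \<times> J) F" "u \<in> J"
  shows "smooth_on U (\<lambda>x. F (x, u))"
proof -
  have "bounded_linear (\<lambda>x :: real^'n. (x, 0 :: real))"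
    by (intro bounded_linear_Pair bounded_linear_ident bounded_linear_zero)
  from smooth_on_affine[OF open_domain open_U this, of "(0, u)", OF _ assms(1)] assms(2)
  show ?thesis by simp
qed

lemma lie_inverse_metric_sym:
  "x \<in> U \<Longrightarrow> lie_inverse_metric v i j x = lie_inverse_metric v j i x"
  unfolding lie_inverse_metric_def by (simp add: partial_inverse_metric_sym[of x _ i j] add.commute)

lemma exists_trace:
  assumes "x \<in> U"
  shows "\<exists>q. transpose q = q \<and> matrix_inv (G x) \<bullet> q = t"
  \<comment> \<open>At p = 0 with the constant nonlinearity -t the equation \<open>H = 0\<close>
    reads trace = t.\<close>
  using exists_hessian[OF assms, of "\<lambda>_. - t" _ 0] by (simp add: poisson_jet_eq)

text \<open>At p = 0 the difference of two solution jets involves only the coefficient of q, and the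
  summand \<eta>_u g^{-1} drops out on trace-free matrices; so L_v g^{-1} is a multiple of
  g^{-1}.\<close>

lemma symmetry_conformal:
  assumes x: "x \<in> U" and u: "u \<in> J" and sm: "smooth_on (U \<times> J) \<xi>" "smooth_on (U \<times> J) \<eta>"
    and f: "(f has_real_derivative f') (at u)"
    and smv: "smooth_on U v" and v: "\<forall>y\<in>U. \<forall>w\<in>J. \<xi> (y, w) = v y"
    and sym: "infinitesimal_symmetry f \<xi> \<eta>"
  shows "\<exists>m. \<forall>i j. lie_derivative_metric v G i j x = m * G x $ i $ j"
proof -
  define M where "M = matrix_inv (G x)"
  define K :: "real^'n^'n" where "K = (\<chi> i j. lie_inverse_metric v i j x)"
  have "K \<bullet> r = 0" if r: "transpose r = r" "M \<bullet> r = 0" for r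
  proof -
    obtain q where q: "transpose q = q" "poisson_jet G f (x, u, 0, q) = 0" using exists_hessian[OF x] by blast
    have qr: "transpose (q + r) = q + r" using q r by (simp add: transpose_def vec_eq_iff)
    moreover have "poisson_jet G f (x, u, 0, q + r) = 0"
      using q(2) r(2) by (simp add: poisson_jet_eq inner_add_right M_def)
    ultimately have "prolongation2 \<xi> \<eta> (poisson_jet G f) (x, u, 0, q + r) = 0"
        "prolongation2 \<xi> \<eta> (poisson_jet G f) (x, u, 0, q) = 0"
      using sym q x u unfolding infinitesimal_symmetry_def by blast+
    then have "(\<Sum>i\<in>UNIV. \<Sum>j\<in>UNIV. (lie_inverse_metric v i j x + deriv_u \<eta> (x, u) * inverse_metric G i j x) * r $ i $ j) = 0"
      unfolding prolongation2_projectable[OF x u sm f smv v q(1)] prolongation2_projectable[OF x u sm f smv v qr]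
      by (simp add: distrib_left sum.distrib)
    then have "K \<bullet> r + deriv_u \<eta> (x, u) * (M \<bullet> r) = 0"
      by (simp add: inner_matrix K_def M_def inverse_metric_def distrib_right sum.distrib sum_distrib_left mult.assoc)
    then show ?thesis using r by simp
  qed
  moreover have "transpose K = K"
    using lie_inverse_metric_sym[OF x] by (simp add: K_def transpose_def vec_eq_iff)
  ultimately obtain c where c: "K = c *\<^sub>R M"
    using proportional_if_annihilates_traceless[of K M] matrix_inv_sym[OF x] unfolding M_def by blast
  have "K $ i $ j = c * M $ i $ j" for i j by (simp add: c)
  \<comment> \<open>The double sign matches the convention that g scales by m exactly if its inverse
    scales by - m.\<close>
  then have "lie_inverse_metric v i j x = - (- c) * inverse_metric G i j x" for i j
    by (simp add: K_def M_def inverse_metric_def)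
  then show ?thesis using conformal_iff_lie_inverse_metric[OF x] by blast
qed

text \<open>The quadratic terms in \<open>p\<close> are isolated by an even second difference in \<open>p\<close>.\<close>

lemma symmetry_deriv_uu_zero:
  assumes x: "x \<in> U" and u: "u \<in> J" and sm: "smooth_on (U \<times> J) \<xi>" "smooth_on (U \<times> J) \<eta>"
    and f: "(f has_real_derivative f') (at u)"
    and smv: "smooth_on U v" and v: "\<forall>y\<in>U. \<forall>w\<in>J. \<xi> (y, w) = v y"
    and sym: "infinitesimal_symmetry f \<xi> \<eta>"
  shows "deriv_u (deriv_u \<eta>) (x, u) = 0"
proof -
  define M where "M = (\<lambda>i j. inverse_metric G i j x)"
  obtain p :: "real^'n" where p: "(\<Sum>i\<in>UNIV. \<Sum>j\<in>UNIV. M i j * (p $ i * p $ j)) \<noteq> 0"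
    using exists_nonnull_covector[OF x] unfolding M_def by blast
  \<comment> \<open>\<open>q0\<close> balances f and \<open>q1\<close> balances the term of
    \<open>H\<close> linear in p, so (p, q0 + q1), (-p, q0 - q1) and (0, q0) all lie on
    \<open>H = 0\<close>.\<close>
  obtain q0 where q0: "transpose q0 = q0" "matrix_inv (G x) \<bullet> q0 = - f u" using exists_trace[OF x] by blast
  obtain q1 where q1: "transpose q1 = q1"
    "matrix_inv (G x) \<bullet> q1 = (\<Sum>i\<in>UNIV. contracted_christoffel G i x * p $ i)" using exists_trace[OF x] by blast
  define E where "E = (\<lambda>p q. prolongation2 \<xi> \<eta> (poisson_jet G f) (x, u, p, q))"
  have t: "transpose (q0 + q1) = q0 + q1" "transpose (q0 - q1) = q0 - q1"
    using q0(1) q1(1) by (simp_all add: transpose_def vec_eq_iff)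
  have "poisson_jet G f (x, u, p, q0 + q1) = 0" "poisson_jet G f (x, u, - p, q0 - q1) = 0"
    "poisson_jet G f (x, u, 0, q0) = 0"
    using q0(2) q1(2) by (simp_all add: poisson_jet_eq inner_add_right inner_diff_right sum_negf)
  then have z: "E p (q0 + q1) = 0" "E (- p) (q0 - q1) = 0" "E 0 q0 = 0"
    using sym x u t q0 unfolding infinitesimal_symmetry_def E_def by blast+
  define N where "N = (\<lambda>i j. lie_inverse_metric v i j x + deriv_u \<eta> (x, u) * M i j)"
  define a where "a = (\<lambda>i j. deriv_x j (deriv_x i \<eta>) (x, u))"
  define b where "b = (\<lambda>i. deriv_u (deriv_x i \<eta>) (x, u))"
  define c where "c = (\<lambda>j. deriv_x j (deriv_u \<eta>) (x, u))"
  define e where "e = deriv_u (deriv_u \<eta>) (x, u)"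
  define k where "k = (\<lambda>i j k. partial j (partial i (\<lambda>y. v y $ k)) x)"
  define D where "D = (\<lambda>i. contracted_christoffel G i x)"
  define d where "d = (\<lambda>i. deriv_x i \<eta> (x, u))"
  define h where "h = deriv_u \<eta> (x, u)"
  define X where "X = (\<lambda>i k. partial i (\<lambda>y. v y $ k) x)"
  define dD where "dD = (\<lambda>i. \<Sum>k\<in>UNIV. v x $ k * partial k (contracted_christoffel G i) x)"
  have E: "E p q = (\<Sum>i\<in>UNIV. \<Sum>j\<in>UNIV. N i j * q $ i $ j)
    + (\<Sum>i\<in>UNIV. \<Sum>j\<in>UNIV. M i j * (a i j + p $ j * b i + p $ i * (c j + p $ j * e) - (\<Sum>l\<in>UNIV. p $ l * k i j l)))
    - (\<Sum>i\<in>UNIV. D i * (d i + p $ i * h - (\<Sum>l\<in>UNIV. p $ l * X i l)) + dD i * p $ i) + f' * \<eta> (x, u)"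
    if "transpose q = q" for p q
    unfolding E_def prolongation2_projectable[OF x u sm f smv v that] N_def M_def a_def b_def c_def e_def k_def
      D_def d_def h_def X_def dD_def ..
  \<comment> \<open>Terms odd in (p, q1) cancel between the first two values, and those free of p
    and q1 against the third; twice the \<eta>_uu term remains.\<close>
  have "E p (q0 + q1) + E (- p) (q0 - q1) - 2 * E 0 q0 = 2 * (e * (\<Sum>i\<in>UNIV. \<Sum>j\<in>UNIV. M i j * (p $ i * p $ j)))"
    unfolding E[OF t(1)] E[OF t(2)] E[OF q0(1)]
    by (simp add: sum.distrib sum_subtractf sum_negf sum_distrib_left[of _ _ UNIV] distrib_left right_diff_distrib
       distrib_right left_diff_distrib mult_ac)
  then show ?thesis using z p by (simp add: e_def)
qed

abbreviation local_laplacian :: "(real^'n \<Rightarrow> real) \<Rightarrow> real^'n \<Rightarrow> real" where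
  "local_laplacian a x \<equiv> laplace_jet G x (\<chi> i. partial i a x) (\<chi> i j. partial i (partial j a) x)"

text \<open>On \<open>H = 0\<close> the trace of q is expressed by lower-order terms. The
  Christoffel symbols and the second derivatives of \<open>v\<close> then cancel against the Lie
  derivative of the contracted Christoffel symbols. An affine function of p remains, whose
  coefficients are the two determining equations.\<close>

lemma prolongation2_conformal:
  assumes x: "x \<in> U" and u: "u \<in> J" and sm: "smooth_on (U \<times> J) \<xi>" "smooth_on (U \<times> J) \<eta>"
    and f: "(f has_real_derivative f') (at u)"
    and smv: "smooth_on U v" and v: "\<forall>y\<in>U. \<forall>w\<in>J. \<xi> (y, w) = v y"
    and sma: "smooth_on U a" and smb: "smooth_on U b"
    and \<eta>: "\<forall>y\<in>U. \<forall>w\<in>J. \<eta> (y, w) = a y * w + b y"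
    and smm: "smooth_on U m"
    and conf: "\<forall>y\<in>U. \<forall>i j. lie_derivative_metric v G i j y = m y * G y $ i $ j"
    and q: "transpose q = q" and H: "poisson_jet G f (x, u, p, q) = 0"
  shows "prolongation2 \<xi> \<eta> (poisson_jet G f) (x, u, p, q) =
    (\<Sum>i\<in>UNIV. p $ i * (\<Sum>j\<in>UNIV. inverse_metric G i j x *
        (2 * partial j a x - (2 - real CARD('n)) / 2 * partial j m x)))
    + (local_laplacian a x * u + local_laplacian b x + (a x * u + b x) * f' - (a x - m x) * f u)"
proof -
  have d: "a differentiable (at y)" "b differentiable (at y)"
      "partial i a differentiable (at y)" "partial i b differentiable (at y)" if "y \<in> U" for y i
    using smooth_on_differentiable sma smb smooth_on_partial that by blast+
  note aff = has_derivative_affine_in_u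
  have e1: "deriv_x i \<eta> (y, w) = partial i a y * w + partial i b y" "deriv_u \<eta> (y, w) = a y"
    if "y \<in> U" "w \<in> J" for y w i
    by (rule aff[OF that _ d(1,2)[OF that(1)]]; use \<eta> in simp)+
  have e2: "deriv_x j (deriv_x i \<eta>) (x, u) = partial j (partial i a) x * u + partial j (partial i b) x"
    "deriv_u (deriv_x i \<eta>) (x, u) = partial i a x" for i j
    by (rule aff[OF x u _ d(3,4)[OF x]]; simp add: e1)+
  have e3: "deriv_x j (deriv_u \<eta>) (x, u) = partial j a x" "deriv_u (deriv_u \<eta>) (x, u) = 0" for j
    using aff[OF x u, of "deriv_u \<eta>" "\<lambda>y. 0" a] e1(2) d(1)[OF x] by auto
  define M where "M = (\<lambda>i j. inverse_metric G i j x)"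
  define \<Gamma> where "\<Gamma> = (\<lambda>i. contracted_christoffel G i x)"
  define X where "X = (\<lambda>i k. partial k (\<lambda>y. v y $ i) x)"
  define Y where "Y = (\<lambda>k p q. partial p (partial q (\<lambda>y. v y $ k)) x)"
  define r where "r = m x"
  define \<alpha> where "\<alpha> = a x"
  define n where "n = real CARD('n)"
  have Ms: "M i j = M j i" for i j unfolding M_def by (rule M_sym[OF x])
  have smk: "smooth_on U (\<lambda>y. v y $ k)" for k by (rule smooth_on_vec_nth[OF open_U smv])
  have Ys: "Y k i j = Y k j i" for k i j unfolding Y_def by (rule partial_commute[OF open_U smk x])
  have as: "partial j (partial i c) x = partial i (partial j c) x" if "smooth_on U c"
    for i j and c :: "real^'n \<Rightarrow> real"
    by (rule partial_commute[OF open_U that x])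
  have L: "lie_inverse_metric v i j x = - r * M i j" for i j
    using conformal_iff_lie_inverse_metric[OF x, of v "m x"] conf x unfolding M_def r_def by blast
  have tr: "(\<Sum>i\<in>UNIV. \<Sum>j\<in>UNIV. M i j * q $ i $ j) = (\<Sum>i\<in>UNIV. \<Gamma> i * p $ i) - f u"
    using H by (simp add: poisson_jet_def laplace_jet_def M_def \<Gamma>_def)
  have G1: "(\<Sum>k\<in>UNIV. v x $ k * partial k (contracted_christoffel G i) x) =
      - r * \<Gamma> i + (\<Sum>k\<in>UNIV. X i k * \<Gamma> k) - (\<Sum>p\<in>UNIV. \<Sum>q\<in>UNIV. M p q * Y i p q)
      + (2 - n) / 2 * (\<Sum>l\<in>UNIV. M i l * partial l m x)" for i
    using lie_derivative_contracted_christoffel[OF x smv smm, of i] conf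
    unfolding M_def \<Gamma>_def X_def Y_def r_def n_def by blast
  have lap: "local_laplacian c x = (\<Sum>i\<in>UNIV. \<Sum>j\<in>UNIV. M i j * partial j (partial i c) x) - (\<Sum>i\<in>UNIV. \<Gamma> i * partial i c x)"
    if "smooth_on U c" for c
    unfolding laplace_jet_def M_def \<Gamma>_def using as[OF that] by simp
  \<comment> \<open>The equation \<open>H = 0\<close> is used here; eliminating the trace of q
    produces the term (a - m) f.\<close>
  have q1: "(\<Sum>i\<in>UNIV. \<Sum>j\<in>UNIV. (- r * M i j + \<alpha> * M i j) * q $ i $ j) = (\<alpha> - r) * ((\<Sum>i\<in>UNIV. \<Gamma> i * p $ i) - f u)"
    unfolding tr[symmetric] by (simp add: sum_distrib_left algebra_simps)
  have c1: "(\<Sum>i\<in>UNIV. \<Gamma> i * (\<Sum>k\<in>UNIV. p $ k * X k i)) = (\<Sum>i\<in>UNIV. p $ i * (\<Sum>k\<in>UNIV. X i k * \<Gamma> k))"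
    by (simp add: sum_distrib_left mult_ac, rule sum.swap)
  have c2: "(\<Sum>i\<in>UNIV. \<Sum>j\<in>UNIV. M i j * (\<Sum>k\<in>UNIV. p $ k * Y k j i)) =
     (\<Sum>i\<in>UNIV. p $ i * (\<Sum>r\<in>UNIV. \<Sum>s\<in>UNIV. M r s * Y i r s))"
  proof -
    have "(\<Sum>i\<in>UNIV. \<Sum>j\<in>UNIV. M i j * (\<Sum>k\<in>UNIV. p $ k * Y k j i)) =
        (\<Sum>i\<in>UNIV. \<Sum>k\<in>UNIV. \<Sum>j\<in>UNIV. M i j * (p $ k * Y k i j))"
    proof (rule sum.cong[OF refl])
      fix i
      have "(\<Sum>j\<in>UNIV. M i j * (\<Sum>k\<in>UNIV. p $ k * Y k j i)) = (\<Sum>j\<in>UNIV. \<Sum>k\<in>UNIV. M i j * (p $ k * Y k i j))"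
        by (simp add: sum_distrib_left Ys)
      then show "(\<Sum>j\<in>UNIV. M i j * (\<Sum>k\<in>UNIV. p $ k * Y k j i)) = (\<Sum>k\<in>UNIV. \<Sum>j\<in>UNIV. M i j * (p $ k * Y k i j))"
        by (simp only: sum.swap[of "\<lambda>j k. M i j * (p $ k * Y k i j)"])
    qed
    also have "\<dots> = (\<Sum>k\<in>UNIV. \<Sum>i\<in>UNIV. \<Sum>j\<in>UNIV. M i j * (p $ k * Y k i j))" by (rule sum.swap)
    finally show ?thesis by (simp add: sum_distrib_left mult_ac)
  qed
  have c3: "(\<Sum>i\<in>UNIV. \<Sum>j\<in>UNIV. M i j * (p $ j * partial i a x)) = (\<Sum>i\<in>UNIV. p $ i * (\<Sum>j\<in>UNIV. M i j * partial j a x))"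
    by (subst sum.swap) (simp add: sum_distrib_left mult_ac Ms)
  have c4: "(\<Sum>i\<in>UNIV. \<Sum>j\<in>UNIV. M i j * (p $ i * partial j a x)) = (\<Sum>i\<in>UNIV. p $ i * (\<Sum>j\<in>UNIV. M i j * partial j a x))"
    by (simp add: sum_distrib_left mult_ac)
  \<comment> \<open>The terms p_j a_i and p_i a_j contract to the same sum by symmetry of the
    inverse metric, hence the factor 2.\<close>
  have s1: "(\<Sum>i\<in>UNIV. \<Sum>j\<in>UNIV. M i j *
        (partial j (partial i a) x * u + partial j (partial i b) x + p $ j * partial i a x + p $ i * partial j a x
         - (\<Sum>k\<in>UNIV. p $ k * Y k j i))) =
     (\<Sum>i\<in>UNIV. \<Sum>j\<in>UNIV. M i j * partial j (partial i a) x) * u + (\<Sum>i\<in>UNIV. \<Sum>j\<in>UNIV. M i j * partial j (partial i b) x)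
       + 2 * (\<Sum>i\<in>UNIV. p $ i * (\<Sum>j\<in>UNIV. M i j * partial j a x))
       - (\<Sum>i\<in>UNIV. p $ i * (\<Sum>r\<in>UNIV. \<Sum>s\<in>UNIV. M r s * Y i r s))"
    unfolding right_diff_distrib distrib_left sum_subtractf sum.distrib c2 c3 c4
    by (simp add: sum_distrib_right mult.assoc)
  have s2: "(\<Sum>i\<in>UNIV. \<Gamma> i * (partial i a x * u + partial i b x + p $ i * \<alpha> - (\<Sum>k\<in>UNIV. p $ k * X k i))
      + (- r * \<Gamma> i + (\<Sum>k\<in>UNIV. X i k * \<Gamma> k) - (\<Sum>p\<in>UNIV. \<Sum>q\<in>UNIV. M p q * Y i p q)
      + (2 - n) / 2 * (\<Sum>l\<in>UNIV. M i l * partial l m x)) * p $ i) =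
     (\<Sum>i\<in>UNIV. \<Gamma> i * partial i a x) * u + (\<Sum>i\<in>UNIV. \<Gamma> i * partial i b x) + (\<alpha> - r) * (\<Sum>i\<in>UNIV. \<Gamma> i * p $ i)
      - (\<Sum>i\<in>UNIV. p $ i * (\<Sum>r\<in>UNIV. \<Sum>s\<in>UNIV. M r s * Y i r s))
      + (2 - n) / 2 * (\<Sum>i\<in>UNIV. p $ i * (\<Sum>l\<in>UNIV. M i l * partial l m x))"
  proof -
    define A where "A = (\<lambda>i. \<Sum>k\<in>UNIV. p $ k * X k i)"
    define B where "B = (\<lambda>i. \<Sum>k\<in>UNIV. X i k * \<Gamma> k)"
    define C where "C = (\<lambda>i. \<Sum>p\<in>UNIV. \<Sum>q\<in>UNIV. M p q * Y i p q)"
    define F where "F = (\<lambda>i. \<Sum>l\<in>UNIV. M i l * partial l m x)"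
    have AB: "(\<Sum>i\<in>UNIV. \<Gamma> i * A i) = (\<Sum>i\<in>UNIV. p $ i * B i)" unfolding A_def B_def by (rule c1)
    have "(\<Sum>i\<in>UNIV. \<Gamma> i * (partial i a x * u + partial i b x + p $ i * \<alpha> - A i)
      + (- r * \<Gamma> i + B i - C i + (2 - n) / 2 * F i) * p $ i) =
      (\<Sum>i\<in>UNIV. (\<Gamma> i * partial i a x) * u + \<Gamma> i * partial i b x + (\<alpha> - r) * (\<Gamma> i * p $ i)
       - \<Gamma> i * A i + p $ i * B i - p $ i * C i + (2 - n) / 2 * (p $ i * F i))"
      by (intro sum.cong refl) (simp add: algebra_simps)
    also have "\<dots> = (\<Sum>i\<in>UNIV. \<Gamma> i * partial i a x) * u + (\<Sum>i\<in>UNIV. \<Gamma> i * partial i b x) + (\<alpha> - r) * (\<Sum>i\<in>UNIV. \<Gamma> i * p $ i)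
      - (\<Sum>i\<in>UNIV. p $ i * C i) + (2 - n) / 2 * (\<Sum>i\<in>UNIV. p $ i * F i)"
      unfolding sum.distrib sum_subtractf AB sum_distrib_left[symmetric] sum_distrib_right[symmetric] by simp
    finally show ?thesis unfolding A_def B_def C_def F_def .
  qed
  have s3: "(\<Sum>i\<in>UNIV. p $ i * (\<Sum>j\<in>UNIV. M i j * (2 * partial j a x - (2 - n) / 2 * partial j m x))) =
     2 * (\<Sum>i\<in>UNIV. p $ i * (\<Sum>j\<in>UNIV. M i j * partial j a x))
     - (2 - n) / 2 * (\<Sum>i\<in>UNIV. p $ i * (\<Sum>l\<in>UNIV. M i l * partial l m x))"
    by (simp add: sum_distrib_left right_diff_distrib sum_subtractf mult_ac)
  have P: "prolongation2 \<xi> \<eta> (poisson_jet G f) (x, u, p, q) =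
     (\<Sum>i\<in>UNIV. \<Sum>j\<in>UNIV. (- r * M i j + \<alpha> * M i j) * q $ i $ j)
     + (\<Sum>i\<in>UNIV. \<Sum>j\<in>UNIV. M i j *
        (partial j (partial i a) x * u + partial j (partial i b) x + p $ j * partial i a x + p $ i * partial j a x
         - (\<Sum>k\<in>UNIV. p $ k * Y k j i)))
     - (\<Sum>i\<in>UNIV. \<Gamma> i * (partial i a x * u + partial i b x + p $ i * \<alpha> - (\<Sum>k\<in>UNIV. p $ k * X k i))
      + (- r * \<Gamma> i + (\<Sum>k\<in>UNIV. X i k * \<Gamma> k) - (\<Sum>p\<in>UNIV. \<Sum>q\<in>UNIV. M p q * Y i p q)
      + (2 - n) / 2 * (\<Sum>l\<in>UNIV. M i l * partial l m x)) * p $ i)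
     + f' * (\<alpha> * u + b x)"
    unfolding prolongation2_projectable[OF x u sm f smv v q] e1[OF x u] e2 e3 bspec[OF bspec[OF \<eta> x] u] L G1
    unfolding M_def \<Gamma>_def X_def Y_def \<alpha>_def by simp
  show ?thesis
    unfolding P q1 s1 s2 M_def[THEN fun_cong, THEN fun_cong, symmetric] n_def[symmetric] s3 lap[OF sma] lap[OF smb]
    unfolding \<alpha>_def r_def by (simp add: algebra_simps)
qed

end

section \<open>Equivalence of the symmetry condition with the determining equations in one
  chart\<close>

context jet_domain
begin

lemma two_points: "\<exists>s t. s \<in> J \<and> t \<in> J \<and> s \<noteq> t"
proof -
  obtain s where s: "s \<in> J" using J_nonempty by blast
  then obtain e where "e > 0" "ball s e \<subseteq> J" using open_J open_contains_ball by blast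
  then have "s + e / 2 \<in> J" by (auto simp: dist_real_def subset_iff)
  with s \<open>e > 0\<close> show ?thesis by (intro exI[of _ s] exI[of _ "s + e / 2"]) auto
qed

text \<open>The coefficients are solved from the values of \<eta> at two fixed points of
  \<open>J\<close>. In the converse directions this is how they inherit smoothness from the given
  field.\<close>

lemma smooth_on_affine_coefficients:
  fixes \<eta> :: "(real^'n) \<times> real \<Rightarrow> real"
  assumes sm: "smooth_on (U \<times> J) \<eta>"
    and \<eta>: "\<forall>y\<in>U. \<forall>w\<in>J. \<eta> (y, w) = a y * w + b y"
  shows "smooth_on U a" "smooth_on U b"
proof -
  obtain s t where st: "s \<in> J" "t \<in> J" "s \<noteq> t" using two_points by blast
  have "smooth_on U (\<lambda>x. inverse (s - t) * (\<eta> (x, s) + (-1) * \<eta> (x, t)))"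
    by (intro smooth_on_mult smooth_on_add smooth_on_const smooth_on_slice sm st open_U)
  moreover have "inverse (s - t) * (\<eta> (x, s) + (-1) * \<eta> (x, t)) = a x" if "x \<in> U" for x
  proof -
    have "\<eta> (x, s) + (-1) * \<eta> (x, t) = (s - t) * a x"
      using bspec[OF bspec[OF \<eta> that] st(1)] bspec[OF bspec[OF \<eta> that] st(2)] by (simp add: algebra_simps)
    then show ?thesis using st(3) by simp
  qed
  ultimately show a: "smooth_on U a" by (rule smooth_on_eqI[OF open_U])
  have "smooth_on U (\<lambda>x. \<eta> (x, s) + (- s) * a x)"
    by (intro smooth_on_mult smooth_on_add smooth_on_const smooth_on_slice sm st open_U a)
  moreover have "\<eta> (x, s) + (- s) * a x = b x" if "x \<in> U" for x
    using \<eta> that st by simp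
  ultimately show "smooth_on U b" by (rule smooth_on_eqI[OF open_U])
qed

text \<open>All coefficient functions are explicit expressions in \<xi> and \<eta> at a single
  \<open>u0\<close>, so the same formulas can be used in every chart and compared on
  overlaps.\<close>

lemma infinitesimal_symmetryD:
  fixes \<xi> :: "(real^'n) \<times> real \<Rightarrow> real^'n" and \<eta> :: "(real^'n) \<times> real \<Rightarrow> real"
  assumes sm: "smooth_on (U \<times> J) \<xi>" "smooth_on (U \<times> J) \<eta>"
    and f: "\<And>u. u \<in> J \<Longrightarrow> (f has_real_derivative f' u) (at u)"
    and sym: "infinitesimal_symmetry f \<xi> \<eta>" and u0: "u0 \<in> J"
  defines "v \<equiv> \<lambda>x. \<xi> (x, u0)" and "a \<equiv> \<lambda>x. deriv_u \<eta> (x, u0)"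
  defines "b \<equiv> \<lambda>x. \<eta> (x, u0) - u0 * a x" and "m \<equiv> conformal_factor v"
  shows "smooth_on U v" "smooth_on U a" "smooth_on U b" "smooth_on U m"
    "\<forall>x\<in>U. \<forall>u\<in>J. \<xi> (x, u) = v x" "\<forall>x\<in>U. \<forall>u\<in>J. \<eta> (x, u) = a x * u + b x"
    "\<forall>x\<in>U. \<forall>i j. lie_derivative_metric v G i j x = m x * G x $ i $ j"
    "\<forall>x\<in>U. \<forall>i. partial i a x = (2 - real CARD('n)) / 4 * partial i m x"
    "\<forall>x\<in>U. \<forall>u\<in>J. local_laplacian a x * u + local_laplacian b x + (a x * u + b x) * f' u = (a x - m x) * f u"
proof -
  show smv: "smooth_on U v" unfolding v_def by (rule smooth_on_slice[OF sm(1) u0])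
  show v: "\<forall>x\<in>U. \<forall>u\<in>J. \<xi> (x, u) = v x"
  proof (intro ballI)
    fix x u assume xu: "x \<in> U" "u \<in> J"
    have "\<xi> (x, u) $ k = \<xi> (x, u0) $ k" for k
      using constant_in_u[OF smooth_on_vec_nth[OF open_domain sm(1), of k] xu(1) symmetry_deriv_u_zero[OF xu(1) _ sm f sym] xu(2) u0]
      by simp
    then show "\<xi> (x, u) = v x" by (simp add: v_def vec_eq_iff)
  qed
  have uu: "deriv_u (deriv_u \<eta>) (x, u) = 0" if "x \<in> U" "u \<in> J" for x u
    by (rule symmetry_deriv_uu_zero[OF that sm f[OF that(2)] smv v sym])
  have a: "deriv_u \<eta> (x, u) = a x" if "x \<in> U" "u \<in> J" for x u
    using constant_in_u[OF smooth_on_deriv_u[OF sm(2)] that(1) uu[OF that(1)] that(2) u0] by (simp add: a_def)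
  show \<eta>: "\<forall>x\<in>U. \<forall>u\<in>J. \<eta> (x, u) = a x * u + b x"
  proof (intro ballI)
    fix x u assume xu: "x \<in> U" "u \<in> J"
    show "\<eta> (x, u) = a x * u + b x"
      using constant_in_u[OF sm(2) xu(1) a[OF xu(1)] xu(2) u0] by (simp add: b_def algebra_simps)
  qed
  show sma: "smooth_on U a" and smb: "smooth_on U b"
    using smooth_on_affine_coefficients[OF sm(2) \<eta>] by auto
  show smm: "smooth_on U m" unfolding m_def by (rule smooth_conformal_factor[OF smv])
  show conf: "\<forall>x\<in>U. \<forall>i j. lie_derivative_metric v G i j x = m x * G x $ i $ j"
  proof
    fix x assume x: "x \<in> U"
    obtain r where r: "\<forall>i j. lie_derivative_metric v G i j x = r * G x $ i $ j"
      using symmetry_conformal[OF x u0 sm f[OF u0] smv v sym] by blast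
    then have "m x = r" unfolding m_def by (intro conformal_factor_eq[OF x]) auto
    with r show "\<forall>i j. lie_derivative_metric v G i j x = m x * G x $ i $ j" by simp
  qed
  define E where "E = (\<lambda>x u. local_laplacian a x * u + local_laplacian b x + (a x * u + b x) * f' u - (a x - m x) * f u)"
  define c where "c = (\<lambda>x i. \<Sum>j\<in>UNIV. inverse_metric G i j x * (2 * partial j a x - (2 - real CARD('n)) / 2 * partial j m x))"
  \<comment> \<open>An affine function of p that vanishes identically: p = 0 isolates the constant
    term, unit vectors then isolate each linear coefficient.\<close>
  have Z: "(\<Sum>i\<in>UNIV. p $ i * c x i) + E x u = 0" if xu: "x \<in> U" "u \<in> J" for x u p
  proof -
    obtain q where q: "transpose q = q" "poisson_jet G f (x, u, p, q) = 0" using exists_hessian[OF xu(1)] by blast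
    then have "prolongation2 \<xi> \<eta> (poisson_jet G f) (x, u, p, q) = 0"
      using sym xu unfolding infinitesimal_symmetry_def by blast
    then show ?thesis
      unfolding prolongation2_conformal[OF xu sm f[OF xu(2)] smv v sma smb \<eta> smm conf q] E_def c_def .
  qed
  have E: "E x u = 0" if "x \<in> U" "u \<in> J" for x u using Z[OF that, of 0] by simp
  then show "\<forall>x\<in>U. \<forall>u\<in>J. local_laplacian a x * u + local_laplacian b x + (a x * u + b x) * f' u = (a x - m x) * f u"
    unfolding E_def by simp
  show "\<forall>x\<in>U. \<forall>i. partial i a x = (2 - real CARD('n)) / 4 * partial i m x"
  proof (intro ballI allI)
    fix x i assume x: "x \<in> U"
    have "c x k = 0" for k
    proof -
      have "(\<Sum>i\<in>UNIV. axis k 1 $ i * c x i) = 0" using Z[OF x u0, of "axis k 1"] E[OF x u0] by simp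
      moreover have "axis k 1 $ i * c x i = (if i = k then c x i else 0)" for i by (simp add: axis_def)
      ultimately show ?thesis by simp
    qed
    from sum_inverse_metric_zero[OF x this[unfolded c_def], of i]
    show "partial i a x = (2 - real CARD('n)) / 4 * partial i m x" by (simp add: field_simps)
  qed
qed

lemma infinitesimal_symmetryI:
  fixes \<xi> :: "(real^'n) \<times> real \<Rightarrow> real^'n" and \<eta> :: "(real^'n) \<times> real \<Rightarrow> real"
  assumes sm: "smooth_on (U \<times> J) \<xi>" "smooth_on (U \<times> J) \<eta>"
    and f: "\<And>u. u \<in> J \<Longrightarrow> (f has_real_derivative f' u) (at u)"
    and v: "\<forall>x\<in>U. \<forall>u\<in>J. \<xi> (x, u) = v x" and \<eta>: "\<forall>x\<in>U. \<forall>u\<in>J. \<eta> (x, u) = a x * u + b x"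
    and smv: "smooth_on U v" and smm: "smooth_on U m"
    and conf: "\<forall>x\<in>U. \<forall>i j. lie_derivative_metric v G i j x = m x * G x $ i $ j"
    and am: "\<forall>x\<in>U. \<forall>i. partial i a x = (2 - real CARD('n)) / 4 * partial i m x"
    and det: "\<forall>x\<in>U. \<forall>u\<in>J. local_laplacian a x * u + local_laplacian b x + (a x * u + b x) * f' u = (a x - m x) * f u"
  shows "infinitesimal_symmetry f \<xi> \<eta>"
proof -
  have sma: "smooth_on U a" and smb: "smooth_on U b"
    using smooth_on_affine_coefficients[OF sm(2) \<eta>] by auto
  show ?thesis
    unfolding infinitesimal_symmetry_def
  proof (intro ballI allI impI)
    fix x u p q assume xu: "x \<in> U" "u \<in> J" and q: "transpose q = q" "poisson_jet G f (x, u, p, q) = 0"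
    show "prolongation2 \<xi> \<eta> (poisson_jet G f) (x, u, p, q) = 0"
      using prolongation2_conformal[OF xu sm f[OF xu(2)] smv v sma smb \<eta> smm conf q] det am xu
      by simp
  qed
qed

end

subsection \<open>Change of charts\<close>

lemma bounded_bilinear_matrix_mult: "bounded_bilinear ((**) :: real^'n::finite^'n \<Rightarrow> real^'n^'n \<Rightarrow> real^'n^'n)"
proof -
  have "bilinear ((**) :: real^'n::finite^'n \<Rightarrow> real^'n^'n \<Rightarrow> real^'n^'n)"
    unfolding bilinear_def by (auto intro!: linearI simp: matrix_mult_distribs)
  then show ?thesis by (simp add: bilinear_conv_bounded_bilinear)
qed

lemma bounded_bilinear_matrix_vector_mult:
  "bounded_bilinear ((*v) :: real^'n::finite^'n \<Rightarrow> real^'n \<Rightarrow> real^'n)"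
proof -
  have "bilinear ((*v) :: real^'n::finite^'n \<Rightarrow> real^'n \<Rightarrow> real^'n)"
    unfolding bilinear_def
    by (auto intro!: linearI simp: matrix_vector_right_distrib matrix_vector_mult_add_rdistrib
        matrix_vector_mult_scaleR scaleR_matrix_vector_assoc)
  then show ?thesis by (simp add: bilinear_conv_bounded_bilinear)
qed

lemma bounded_linear_transpose: "bounded_linear (transpose :: real^'n::finite^'n \<Rightarrow> real^'n^'n)"
  by (simp add: linear_conv_bounded_linear[symmetric]) (auto intro!: linearI simp: transpose_def vec_eq_iff)

definition jacobian_matrix :: "(real^'n \<Rightarrow> real^'n) \<Rightarrow> real^'n::finite \<Rightarrow> real^'n^'n" where
  "jacobian_matrix F x = (\<chi> i j. partial j F x $ i)"

lemma jacobian_matrix_works: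
  assumes "F differentiable (at x)"
  shows "frechet_derivative F (at x) h = jacobian_matrix F x *v h"
  using frechet_derivative_eq_sum_partial[OF assms, of h]
  by (simp add: jacobian_matrix_def vec_eq_iff matrix_vector_mult_def mult.commute)

lemma smooth_on_jacobian_matrix:
  fixes F :: "real^'n::finite \<Rightarrow> real^'n"
  assumes "open S" "smooth_on S F"
  shows "smooth_on S (jacobian_matrix F)"
proof -
  \<comment> \<open>\<open>L j\<close> places a vector into column j, so the Jacobian is a finite
    sum of bounded linear images of the partial derivatives.\<close>
  define L :: "'n \<Rightarrow> real^'n \<Rightarrow> real^'n^'n" where "L = (\<lambda>j w. \<chi> i k. if k = j then w $ i else 0)"
  have "bounded_linear (L j)" for j
    unfolding L_def linear_conv_bounded_linear[symmetric]
    by (auto intro!: linearI simp: vec_eq_iff)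
  then have "smooth_on S (\<lambda>x. \<Sum>j\<in>UNIV. L j (partial j F x))"
    by (intro smooth_on_sum[OF assms(1)] smooth_on_bounded_linear[OF assms(1), of "L _"] smooth_on_partial[OF assms(2)])
  moreover have "(\<Sum>j\<in>UNIV. L j (partial j F x)) = jacobian_matrix F x" for x
    by (simp add: L_def jacobian_matrix_def vec_eq_iff)
  ultimately show ?thesis by simp
qed

lemma partial_matrix_nth:
  fixes F :: "real^'m::finite \<Rightarrow> real^'n::finite^'k::finite"
  assumes "F differentiable (at x)"
  shows "partial k (\<lambda>y. F y $ r $ j) x = partial k F x $ r $ j"
proof -
  have "(\<lambda>y. F y $ r) differentiable (at x)"
    using bounded_linear.has_derivative[OF bounded_linear_vec_nth frechet_derivative_works_at[OF assms]]
    unfolding differentiable_def by blast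
  then have "partial k (\<lambda>y. F y $ r $ j) x = partial k (\<lambda>y. F y $ r) x $ j" by (rule partial_vec_nth)
  then show ?thesis by (simp add: partial_vec_nth[OF assms])
qed

text \<open>The second derivative of \<open>F\<close> as a symmetric bilinear map in
  \<open>h\<close> and \<open>w\<close>. It allows the direction of differentiation to be exchanged
  with the argument in the pullback computation.\<close>

lemma jacobian_matrix_derivative_symmetric:
  fixes F :: "real^'n::finite \<Rightarrow> real^'n"
  assumes "open S" "smooth_on S F" "x \<in> S"
  shows "frechet_derivative (jacobian_matrix F) (at x) h *v w = frechet_derivative (jacobian_matrix F) (at x) w *v h"
proof -
  have d: "jacobian_matrix F differentiable (at x)"
    by (rule smooth_on_differentiable[OF smooth_on_jacobian_matrix[OF assms(1,2)] assms(3)])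
  have c: "partial k (jacobian_matrix F) x $ r $ j = partial k (partial j (\<lambda>y. F y $ r)) x" for k r j
  proof -
    have "partial k (jacobian_matrix F) x $ r $ j = partial k (\<lambda>y. jacobian_matrix F y $ r $ j) x"
      by (rule partial_matrix_nth[OF d, symmetric])
    also have "\<dots> = partial k (partial j (\<lambda>y. F y $ r)) x"
      by (rule partial_cong[OF assms(1,3)])
        (simp add: jacobian_matrix_def partial_vec_nth smooth_on_differentiable[OF assms(2)])
    finally show ?thesis .
  qed
  have s: "partial k (partial j (\<lambda>y. F y $ r)) x = partial j (partial k (\<lambda>y. F y $ r)) x" for j k r
    by (rule partial_commute[OF assms(1) smooth_on_vec_nth[OF assms(1,2)] assms(3)])
  have e: "(frechet_derivative (jacobian_matrix F) (at x) h *v w) $ r =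
     (\<Sum>j\<in>UNIV. \<Sum>k\<in>UNIV. h $ k * partial k (partial j (\<lambda>y. F y $ r)) x * w $ j)" for r h w
    by (simp add: frechet_derivative_eq_sum_partial[OF d] matrix_vector_mult_def c sum_distrib_right)
  show ?thesis
    unfolding vec_eq_iff e by (subst sum.swap) (simp add: s mult_ac)
qed

lemma lie_derivative_metric_matrix:
  fixes v :: "real^'n::finite \<Rightarrow> real^'n"
  assumes "G differentiable (at x)" "v differentiable (at x)"
  shows "(\<chi> i j. lie_derivative_metric v G i j x) =
    frechet_derivative G (at x) (v x) + transpose (jacobian_matrix v x) ** G x + G x ** jacobian_matrix v x"
proof -
  have c: "partial k (\<lambda>y. G y $ r $ j) x = partial k G x $ r $ j" for k r j
    by (rule partial_matrix_nth[OF assms(1)])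
  show ?thesis
    by (simp add: vec_eq_iff lie_derivative_metric_def frechet_derivative_eq_sum_partial[OF assms(1)] c
        matrix_matrix_mult_def transpose_def jacobian_matrix_def partial_vec_nth[OF assms(2)] sum.distrib mult.commute)
qed

text \<open>Naturality of the Lie derivative. Differentiating G = P^T (G' o \<phi>) P along v
  produces derivatives of P; differentiating the relation between v and v' shows that they are
  exactly the difference between the two Jacobian terms.\<close>

lemma lie_derivative_metric_pullback:
  fixes \<phi> :: "real^'n::finite \<Rightarrow> real^'n"
  assumes O: "open O'" "x \<in> O'" and \<phi>: "smooth_on O' \<phi>"
    and G': "G' differentiable (at (\<phi> x))" and v': "v' differentiable (at (\<phi> x))"
    and G: "\<And>y. y \<in> O' \<Longrightarrow> G y = transpose (jacobian_matrix \<phi> y) ** G' (\<phi> y) ** jacobian_matrix \<phi> y"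
    and v: "\<And>y. y \<in> O' \<Longrightarrow> v' (\<phi> y) = jacobian_matrix \<phi> y *v v y" and dv: "v differentiable (at x)"
  shows "(\<chi> i j. lie_derivative_metric v G i j x) =
    transpose (jacobian_matrix \<phi> x) ** (\<chi> i j. lie_derivative_metric v' G' i j (\<phi> x)) ** jacobian_matrix \<phi> x"
proof -
  define P where "P = jacobian_matrix \<phi> x"
  define DP where "DP = frechet_derivative (jacobian_matrix \<phi>) (at x)"
  define DG' where "DG' = frechet_derivative G' (at (\<phi> x))"
  define X where "X = jacobian_matrix v x"
  define X' where "X' = jacobian_matrix v' (\<phi> x)"
  define B where "B = G' (\<phi> x)"
  have hP: "(jacobian_matrix \<phi> has_derivative DP) (at x)" unfolding DP_def
    by (rule smooth_on_has_derivative[OF smooth_on_jacobian_matrix[OF O(1) \<phi>] O(2)])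
  have d\<phi>: "\<phi> differentiable (at x)" by (rule smooth_on_differentiable[OF \<phi> O(2)])
  have h\<phi>: "(\<phi> has_derivative (\<lambda>h. P *v h)) (at x)"
    using frechet_derivative_works_at[OF d\<phi>] unfolding P_def jacobian_matrix_works[OF d\<phi>, abs_def] .
  have hG': "((\<lambda>y. G' (\<phi> y)) has_derivative (\<lambda>h. DG' (P *v h))) (at x)"
    unfolding DG'_def by (rule has_derivative_compose[OF h\<phi> frechet_derivative_works_at[OF G']])
  have hv': "((\<lambda>y. v' (\<phi> y)) has_derivative (\<lambda>h. X' *v (P *v h))) (at x)"
    using has_derivative_compose[OF h\<phi> frechet_derivative_works_at[OF v']]
    unfolding jacobian_matrix_works[OF v'] X'_def .
  have hv: "(v has_derivative (\<lambda>h. X *v h)) (at x)"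
    using frechet_derivative_works_at[OF dv] unfolding X_def jacobian_matrix_works[OF dv, abs_def] .
  have "((\<lambda>y. jacobian_matrix \<phi> y *v v y) has_derivative (\<lambda>h. P *v (X *v h) + DP h *v v x)) (at x)"
    using bounded_bilinear.FDERIV[OF bounded_bilinear_matrix_vector_mult hP hv] by (simp add: P_def)
  moreover have "((\<lambda>y. jacobian_matrix \<phi> y *v v y) has_derivative (\<lambda>h. X' *v (P *v h))) (at x)"
    by (rule has_derivative_transform_within_open[OF hv' O v])
  ultimately have "(\<lambda>h. P *v (X *v h) + DP h *v v x) = (\<lambda>h. X' *v (P *v h))"
    by (rule has_derivative_unique)
  \<comment> \<open>Symmetry of the second derivative moves \<open>v x\<close> into the
    differentiation slot, which makes this an identity of matrices applied to
    \<open>h\<close>.\<close>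
  then have "P *v (X *v h) + DP (v x) *v h = X' *v (P *v h)" for h
    using jacobian_matrix_derivative_symmetric[OF O(1) \<phi> O(2), of h "v x"] unfolding DP_def by metis
  then have XP: "X' ** P = P ** X + DP (v x)"
    by (intro matrix_eq[THEN iffD2]) (simp add: matrix_vector_mul_assoc[symmetric] matrix_vector_mult_add_rdistrib)
  have tXP: "transpose P ** transpose X' = transpose X ** transpose P + transpose (DP (v x))"
    using arg_cong[OF XP, of transpose]
    by (simp add: matrix_transpose_mul linear_simps(1)[OF bounded_linear_transpose])
  have htP: "((\<lambda>y. transpose (jacobian_matrix \<phi> y)) has_derivative (\<lambda>h. transpose (DP h))) (at x)"
    by (rule bounded_linear.has_derivative[OF bounded_linear_transpose hP])
  have "((\<lambda>y. transpose (jacobian_matrix \<phi> y) ** G' (\<phi> y) ** jacobian_matrix \<phi> y) has_derivative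
     (\<lambda>h. (transpose P ** B) ** DP h + (transpose P ** DG' (P *v h) + transpose (DP h) ** B) ** P)) (at x)"
    using bounded_bilinear.FDERIV[OF bounded_bilinear_matrix_mult
        bounded_bilinear.FDERIV[OF bounded_bilinear_matrix_mult htP hG'] hP]
    by (simp add: P_def B_def)
  then have hG: "(G has_derivative (\<lambda>h. (transpose P ** B) ** DP h + (transpose P ** DG' (P *v h) + transpose (DP h) ** B) ** P)) (at x)"
    by (rule has_derivative_transform_within_open[OF _ O]) (simp add: G)
  have dG: "G differentiable (at x)" using hG unfolding differentiable_def by blast
  have vx: "v' (\<phi> x) = P *v v x" using v[OF O(2)] by (simp add: P_def)
  have Gx: "G x = transpose P ** B ** P" using G[OF O(2)] by (simp add: P_def B_def)
  have "(\<chi> i j. lie_derivative_metric v G i j x) =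
      (transpose P ** B) ** DP (v x) + (transpose P ** DG' (P *v v x) + transpose (DP (v x)) ** B) ** P
      + transpose X ** (transpose P ** B ** P) + (transpose P ** B ** P) ** X"
    unfolding lie_derivative_metric_matrix[OF dG dv] frechet_derivativeI[OF hG] Gx X_def ..
  also have "\<dots> = transpose P ** DG' (P *v v x) ** P + (transpose X ** transpose P + transpose (DP (v x))) ** B ** P
      + transpose P ** B ** (P ** X + DP (v x))"
    by (simp add: matrix_mult_distribs matrix_mul_assoc)
  also have "\<dots> = transpose P ** (DG' (P *v v x) + transpose X' ** B + B ** X') ** P"
    unfolding XP[symmetric] tXP[symmetric] by (simp add: matrix_mult_distribs matrix_mul_assoc)
  also have "DG' (P *v v x) + transpose X' ** B + B ** X' = (\<chi> i j. lie_derivative_metric v' G' i j (\<phi> x))"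
    unfolding lie_derivative_metric_matrix[OF G' v'] vx DG'_def B_def X'_def ..
  finally show ?thesis unfolding P_def .
qed

subsection \<open>Globalisation over a connected manifold\<close>

lemma homeomorphic_map_open_image:
  assumes "homeomorphic_map (subtopology X S) (top_of_set T) f" "openin X W" "W \<subseteq> S" "open T"
  shows "open (f ` W)"
proof -
  have "openin (subtopology X S) W" using assms(2,3) by (metis openin_subtopology inf.absorb1)
  then have "openin (top_of_set T) (f ` W)"
    using homeomorphic_imp_open_map[OF assms(1)] by (simp add: open_map_def)
  then show ?thesis using assms(4) openin_open_trans by blast
qed

lemma transition_snd:
  assumes "inj_on (snd c) (fst c)" "p \<in> fst c"
  shows "transition c d (snd c p) = snd d p"
  unfolding transition_def by (simp add: assms)

lemma transition_jacobian_eq: "transition_jacobian c d = jacobian_matrix (transition c d)"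
  by (rule ext) (simp add: transition_jacobian_def jacobian_matrix_def)

text \<open>Besides the passage from \<mu> to a, this is applied to \<open>laplacian g b\<close>
  when the determining equations make it affine in \<mu>, and thereby relates the biharmonic
  condition to the harmonic one.\<close>

lemma laplacian_affine:
  assumes "open U" "x \<in> U" and sm: "smooth_on U (m c)"
    and a: "\<And>y. y \<in> U \<Longrightarrow> a c y = r * m c y + C"
  shows "laplacian g a c x = r * laplacian g m c x"
proof -
  have d: "m c differentiable (at y)" "partial i (m c) differentiable (at y)" if "y \<in> U" for y i
    using smooth_on_differentiable sm smooth_on_partial that by blast+
  have 1: "partial i (a c) y = r * partial i (m c) y" if y: "y \<in> U" for y i
  proof -
    have "partial i (a c) y = partial i (\<lambda>y. r * m c y + C) y"
      by (rule partial_cong[OF assms(1) y a])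
    also have "\<dots> = r * partial i (m c) y"
      using d(1)[OF y] by (simp add: partial_add partial_cmult differentiable_mult)
    finally show ?thesis .
  qed
  have 2: "partial j (partial i (a c)) x = r * partial j (partial i (m c)) x" for i j
  proof -
    have "partial j (partial i (a c)) x = partial j (\<lambda>y. r * partial i (m c) y) x"
      by (rule partial_cong[OF assms(1,2) 1])
    then show ?thesis using d(2)[OF assms(2)] by (simp add: partial_cmult)
  qed
  show ?thesis
    unfolding laplacian_def laplace_jet_def
    by (simp add: 1[OF assms(2)] 2 right_diff_distrib sum_distrib_left mult_ac)
qed

locale connected_pseudo_riemannian_manifold =
  fixes X :: "'a topology" and A :: "('a,'n::finite) chart set" and g :: "('a,'n) metric_comps"
  assumes manifold: "smooth_manifold X A" and connected: "connected_space X"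
    and metric: "pseudo_riemannian_metric A g" and dim3: "CARD('n) \<ge> 3"
begin

lemma is_chart: "c \<in> A \<Longrightarrow> is_chart X c"
  using manifold by (auto simp: smooth_manifold_def)

lemma open_chart_range: "c \<in> A \<Longrightarrow> open (chart_range c)"
  using is_chart by (auto simp: is_chart_def)

lemma inj_on_chart: "c \<in> A \<Longrightarrow> inj_on (snd c) (fst c)"
proof -
  assume c: "c \<in> A"
  have "topspace (subtopology X (fst c)) = fst c"
    using is_chart[OF c] openin_subset by (fastforce simp: is_chart_def)
  then show ?thesis
    using is_chart[OF c] homeomorphic_map_def unfolding is_chart_def by metis
qed

lemma open_chart_overlap: "c \<in> A \<Longrightarrow> d \<in> A \<Longrightarrow> open (chart_overlap c d)"
  unfolding chart_overlap_def
  using is_chart[of c] is_chart[of d]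
  by (intro homeomorphic_map_open_image[of X "fst c" "chart_range c"]) (auto simp: is_chart_def)

lemma smooth_transition: "c \<in> A \<Longrightarrow> d \<in> A \<Longrightarrow> smooth_on (chart_overlap c d) (transition c d)"
  using manifold by (auto simp: smooth_manifold_def)

lemma overlap_subset: "x \<in> chart_overlap c d \<Longrightarrow> x \<in> chart_range c"
  by (auto simp: chart_overlap_def chart_range_def)

lemma transition_in_range: "c \<in> A \<Longrightarrow> x \<in> chart_overlap c d \<Longrightarrow> transition c d x \<in> chart_range d"
  using inj_on_chart[of c] by (auto simp: chart_overlap_def chart_range_def transition_snd)

lemma local_metric: "c \<in> A \<Longrightarrow> local_metric (chart_range c) (g c)"
  using metric open_chart_range by unfold_locales (auto simp: pseudo_riemannian_metric_def)

lemma jet_domain: "c \<in> A \<Longrightarrow> open_interval J \<Longrightarrow> jet_domain (chart_range c) (g c) J"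
  using local_metric[of c] dim3
  by (auto simp: jet_domain_def jet_domain_axioms_def open_interval_def)

lemma lie_point_symmetry_iff:
  assumes "open_interval J"
  shows "lie_point_symmetry A g J f V \<longleftrightarrow> smooth_point_field A J V \<and>
    (\<forall>c\<in>A. jet_domain.infinitesimal_symmetry (chart_range c) (g c) J f (fst (V c)) (snd (V c)))"
  unfolding lie_point_symmetry_def
  using jet_domain.infinitesimal_symmetry_def[OF jet_domain[OF _ assms]] by auto

text \<open>The metric and its Lie derivative transform by the same congruence, so their ratio is a
  scalar; a nonzero metric matrix determines that ratio.\<close>

lemma conformal_factor_transition:
  assumes cd: "c \<in> A" "d \<in> A" and x: "x \<in> chart_overlap c d" and \<xi>: "smooth_vector_field A \<xi>"
    and conf: "\<And>c x i j. c \<in> A \<Longrightarrow> x \<in> chart_range c \<Longrightarrow>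
      lie_derivative_metric (\<xi> c) (g c) i j x = \<mu> c x * g c x $ i $ j"
  shows "\<mu> d (transition c d x) = \<mu> c x"
proof -
  let ?\<phi> = "transition c d"
  have xr: "x \<in> chart_range c" "?\<phi> x \<in> chart_range d"
    using overlap_subset[OF x] transition_in_range[OF cd(1) x] by auto
  have dg: "g d differentiable (at (?\<phi> x))"
    using metric xr cd smooth_on_differentiable by (auto simp: pseudo_riemannian_metric_def)
  have d\<xi>: "\<xi> d differentiable (at (?\<phi> x))" "\<xi> c differentiable (at x)"
    using \<xi> xr cd smooth_on_differentiable by (auto simp: smooth_vector_field_def)
  have gt: "g c y = transpose (jacobian_matrix ?\<phi> y) ** g d (?\<phi> y) ** jacobian_matrix ?\<phi> y"
    and \<xi>t: "\<xi> d (?\<phi> y) = jacobian_matrix ?\<phi> y *v \<xi> c y" if "y \<in> chart_overlap c d" for y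
    using metric \<xi> cd that unfolding pseudo_riemannian_metric_def smooth_vector_field_def transition_jacobian_eq
    by blast+
  have "(\<chi> i j. lie_derivative_metric (\<xi> c) (g c) i j x) =
    transpose (jacobian_matrix ?\<phi> x) ** (\<chi> i j. lie_derivative_metric (\<xi> d) (g d) i j (?\<phi> x)) ** jacobian_matrix ?\<phi> x"
    by (rule lie_derivative_metric_pullback[OF open_chart_overlap[OF cd] x smooth_transition[OF cd] dg d\<xi>(1) gt \<xi>t d\<xi>(2)])
  moreover have "(\<chi> i j. lie_derivative_metric (\<xi> c) (g c) i j x) = \<mu> c x *\<^sub>R g c x"
    using conf[OF cd(1) xr(1)] by (simp add: vec_eq_iff)
  moreover have "(\<chi> i j. lie_derivative_metric (\<xi> d) (g d) i j (?\<phi> x)) = \<mu> d (?\<phi> x) *\<^sub>R g d (?\<phi> x)"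
    using conf[OF cd(2) xr(2)] by (simp add: vec_eq_iff)
  ultimately have "\<mu> c x *\<^sub>R g c x = \<mu> d (?\<phi> x) *\<^sub>R g c x"
    by (simp add: matrix_mult_distribs gt[OF x])
  then show ?thesis
    using local_metric.G_nonzero[OF local_metric[OF cd(1)] xr(1)] by simp
qed

text \<open>A family with zero derivative is locally constant in each chart. Leaving
  \<open>W\<close> arbitrary lets the same statement make both a level set and its complement
  open.\<close>

lemma openin_value_set:
  assumes h: "\<And>c x. c \<in> A \<Longrightarrow> x \<in> chart_range c \<Longrightarrow> (h c has_derivative (\<lambda>_. 0)) (at x)"
  shows "openin X {p \<in> topspace X. \<exists>c\<in>A. p \<in> fst c \<and> h c (snd c p) \<in> W}"
proof (subst openin_subopen, intro ballI)
  fix p assume "p \<in> {p \<in> topspace X. \<exists>c\<in>A. p \<in> fst c \<and> h c (snd c p) \<in> W}"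
  then obtain c where c: "c \<in> A" "p \<in> fst c" "h c (snd c p) \<in> W" and p: "p \<in> topspace X" by blast
  have ch: "openin X (fst c)" "homeomorphic_map (subtopology X (fst c)) (top_of_set (chart_range c)) (snd c)"
    using is_chart[OF c(1)] by (auto simp: is_chart_def)
  have fc: "fst c \<subseteq> topspace X" using ch(1) openin_subset by blast
  obtain e where e: "e > 0" "ball (snd c p) e \<subseteq> chart_range c"
    using open_chart_range[OF c(1)] c(2) open_contains_ball unfolding chart_range_def by blast
  have const: "h c y = h c (snd c p)" if "y \<in> ball (snd c p) e" for y
  proof (rule has_derivative_zero_unique_connected[where f="h c" and s="ball (snd c p) e"])
    show "open (ball (snd c p) e)" "connected (ball (snd c p) e)" by simp_all
    show "(h c has_derivative (\<lambda>_. 0)) (at x)" if "x \<in> ball (snd c p) e" for x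
      using h[OF c(1)] e(2) that by blast
    show "y \<in> ball (snd c p) e" "snd c p \<in> ball (snd c p) e" using that e(1) by simp_all
  qed
  define N where "N = {q \<in> topspace (subtopology X (fst c)). snd c q \<in> ball (snd c p) e}"
  have "openin (subtopology X (fst c)) N"
    unfolding N_def
    using homeomorphic_imp_continuous_map[OF ch(2)] e(2)
    by (intro openin_continuous_map_preimage) (auto intro: open_subset)
  then have "openin X N" using ch(1) openin_trans_full by blast
  moreover have "p \<in> N" using c p e by (simp add: N_def)
  moreover have "N \<subseteq> {p \<in> topspace X. \<exists>c\<in>A. p \<in> fst c \<and> h c (snd c p) \<in> W}"
    using c const fc by (auto simp: N_def)
  ultimately show "\<exists>T. openin X T \<and> p \<in> T \<and> T \<subseteq> {p \<in> topspace X. \<exists>c\<in>A. p \<in> fst c \<and> h c (snd c p) \<in> W}"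
    by blast
qed

text \<open>Compatibility on overlaps makes the level set of a value and its complement disjoint;
  both are open, so connectedness leaves only one value.\<close>

lemma zero_derivative_constant:
  assumes h: "\<And>c x. c \<in> A \<Longrightarrow> x \<in> chart_range c \<Longrightarrow> (h c has_derivative (\<lambda>_. 0)) (at x)"
    and inv: "\<And>c d x. c \<in> A \<Longrightarrow> d \<in> A \<Longrightarrow> x \<in> chart_overlap c d \<Longrightarrow> h d (transition c d x) = h c x"
  shows "\<exists>C. \<forall>c\<in>A. \<forall>x\<in>chart_range c. h c x = C"
\<comment> \<open>The empty space counts as connected and offers no base point.\<close>
proof (cases "topspace X = {}")
  case True
  then have "chart_range c = {}" if "c \<in> A" for c
    using is_chart[OF that] openin_subset by (fastforce simp: is_chart_def chart_range_def)
  then show ?thesis by blast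
next
  case False
  have same: "h c (snd c p) = h d (snd d p)" if "c \<in> A" "d \<in> A" "p \<in> fst c" "p \<in> fst d" for c d p
    using inv[OF that(1,2), of "snd c p"] transition_snd[OF inj_on_chart[OF that(1)] that(3), of d] that
    by (auto simp: chart_overlap_def)
  have cover: "\<exists>c\<in>A. p \<in> fst c" if "p \<in> topspace X" for p
    using manifold that unfolding smooth_manifold_def by blast
  from False obtain p0 where p0: "p0 \<in> topspace X" by blast
  obtain c0 where c0: "c0 \<in> A" "p0 \<in> fst c0" using cover[OF p0] by blast
  define C where "C = h c0 (snd c0 p0)"
  define S where "S = (\<lambda>W. {p \<in> topspace X. \<exists>c\<in>A. p \<in> fst c \<and> h c (snd c p) \<in> W})"
  have "openin X (S {C})" "openin X (S (- {C}))" unfolding S_def by (rule openin_value_set[OF h]; assumption)+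
  moreover have "S {C} \<inter> S (- {C}) = {}"
  proof -
    have False if p: "p \<in> S {C}" "p \<in> S (- {C})" for p
    proof -
      obtain c d where "c \<in> A" "p \<in> fst c" "h c (snd c p) = C" "d \<in> A" "p \<in> fst d" "h d (snd d p) \<noteq> C"
        using p unfolding S_def by blast
      then show False using same[of c d p] by simp
    qed
    then show ?thesis by blast
  qed
  moreover have "topspace X \<subseteq> S {C} \<union> S (- {C})" unfolding S_def using cover by blast
  moreover have "S {C} \<noteq> {}" unfolding S_def C_def using p0 c0 by blast
  ultimately have empty: "S (- {C}) = {}"
    using connected unfolding connected_space_def by blast
  have "h c x = C" if "c \<in> A" "x \<in> chart_range c" for c x
  proof -
    obtain p where p: "p \<in> fst c" "x = snd c p" using \<open>x \<in> chart_range c\<close> by (auto simp: chart_range_def)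
    have "p \<in> topspace X" using is_chart[OF \<open>c \<in> A\<close>] openin_subset p(1) by (fastforce simp: is_chart_def)
    have "p \<notin> S (- {C})" by (simp add: empty)
    then have "h c (snd c p) \<notin> - {C}"
      using \<open>p \<in> topspace X\<close> \<open>c \<in> A\<close> p(1) unfolding S_def by blast
    then show ?thesis by (simp add: p(2))
  qed
  then show ?thesis by (intro exI[of _ C] ballI)
qed

text \<open>The chartwise data are glued: \<xi> by its transformation law at u0, \<mu> by
  naturality, a and b by comparison in u. \<open>C\<close> is the integration constant of the
  gradient equation between a and \<mu>, the same in all charts by connectedness.\<close>

lemma lie_point_symmetryD:
  assumes J: "open_interval J" and f: "\<And>u. u \<in> J \<Longrightarrow> (f has_real_derivative f' u) (at u)"
    and sym: "lie_point_symmetry A g J f V"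
  defines "n \<equiv> real CARD('n)"
  shows "\<exists>\<xi> \<mu> b C. conformal_killing_field A g \<xi> \<mu> \<and> smooth_function A b \<and>
    field_eq A J V \<xi> (\<lambda>c x u. ((2 - n) / 4 * \<mu> c x + C) * u + b c x) \<and>
    (\<forall>c\<in>A. \<forall>x\<in>chart_range c. \<forall>u\<in>J. (2 - n) / 4 * laplacian g \<mu> c x * u + laplacian g b c x
       + (((2 - n) / 4 * \<mu> c x + C) * u + b c x) * f' u = ((2 - n) / 4 * \<mu> c x + C - \<mu> c x) * f u)"
proof -
  have V: "smooth_point_field A J V"
    and symm: "\<And>c. c \<in> A \<Longrightarrow> jet_domain.infinitesimal_symmetry (chart_range c) (g c) J f (fst (V c)) (snd (V c))"
    using sym lie_point_symmetry_iff[OF J] by auto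
  obtain u0 where u0: "u0 \<in> J" using J by (auto simp: open_interval_def)
  define \<xi> :: "('a,'n) vector_comps" where "\<xi> = (\<lambda>c x. fst (V c) (x, u0))"
  define \<alpha> :: "('a,'n) scalar_comps" where "\<alpha> = (\<lambda>c x. deriv_u (snd (V c)) (x, u0))"
  define b :: "('a,'n) scalar_comps" where "b = (\<lambda>c x. snd (V c) (x, u0) - u0 * \<alpha> c x)"
  define \<mu> :: "('a,'n) scalar_comps" where "\<mu> = (\<lambda>c. local_metric.conformal_factor (g c) (\<xi> c))"
  have smV: "smooth_on (chart_range c \<times> J) (fst (V c))" "smooth_on (chart_range c \<times> J) (snd (V c))" if "c \<in> A" for c
    using V that by (auto simp: smooth_point_field_def)
  note D = jet_domain.infinitesimal_symmetryD[OF jet_domain[OF _ J] smV f symm u0,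
      folded \<xi>_def \<alpha>_def b_def \<mu>_def n_def]
  have D1: "smooth_on (chart_range c) (\<xi> c)" "smooth_on (chart_range c) (\<alpha> c)" "smooth_on (chart_range c) (b c)"
    "smooth_on (chart_range c) (\<mu> c)" if "c \<in> A" for c
    using D(1-4)[OF that that that _ that] unfolding \<xi>_def \<alpha>_def b_def \<mu>_def by blast+
  have D2: "fst (V c) (x, u) = \<xi> c x" "snd (V c) (x, u) = \<alpha> c x * u + b c x"
    if "c \<in> A" "x \<in> chart_range c" "u \<in> J" for c x u
    using D(5,6)[OF that(1) that(1) that(1) _ that(1)] that unfolding \<xi>_def \<alpha>_def b_def by blast+
  have conf: "lie_derivative_metric (\<xi> c) (g c) i j x = \<mu> c x * g c x $ i $ j"
    if "c \<in> A" "x \<in> chart_range c" for c x i j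
    using D(7)[OF that(1) that(1) that(1) _ that(1)] that unfolding \<xi>_def \<mu>_def by blast
  have grad: "partial i (\<alpha> c) x = (2 - n) / 4 * partial i (\<mu> c) x"
    if "c \<in> A" "x \<in> chart_range c" for c x i
    using D(8)[OF that(1) that(1) that(1) _ that(1)] that unfolding \<xi>_def \<mu>_def \<alpha>_def n_def by blast
  have det: "laplacian g \<alpha> c x * u + laplacian g b c x + (\<alpha> c x * u + b c x) * f' u = (\<alpha> c x - \<mu> c x) * f u"
    if "c \<in> A" "x \<in> chart_range c" "u \<in> J" for c x u
    using D(9)[OF that(1) that(1) that(1) _ that(1)] that unfolding \<xi>_def \<mu>_def \<alpha>_def b_def laplacian_def by blast
  have \<xi>: "smooth_vector_field A \<xi>"
    using V u0 D1(1) unfolding smooth_vector_field_def smooth_point_field_def \<xi>_def by blast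
  have \<mu>: "smooth_function A \<mu>"
    unfolding smooth_function_def using D1(4) conformal_factor_transition[OF _ _ _ \<xi> conf] by blast
  have inv: "\<alpha> d (transition c d x) = \<alpha> c x \<and> b d (transition c d x) = b c x"
    if "c \<in> A" "d \<in> A" "x \<in> chart_overlap c d" for c d x
  proof -
    \<comment> \<open>Equality of two affine functions of u at two distinct points separates the
      slope from the constant term.\<close>
    obtain s t where st: "s \<in> J" "t \<in> J" "s \<noteq> t"
      using jet_domain.two_points[OF jet_domain[OF \<open>c \<in> A\<close> J]] by blast
    have "\<alpha> d (transition c d x) * u + b d (transition c d x) = \<alpha> c x * u + b c x" if u: "u \<in> J" for u
    proof -
      have "snd (V d) (transition c d x, u) = snd (V c) (x, u)"
        using V u \<open>c \<in> A\<close> \<open>d \<in> A\<close> \<open>x \<in> chart_overlap c d\<close> unfolding smooth_point_field_def by blast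
      then show ?thesis
        using D2(2) u that overlap_subset transition_in_range \<open>c \<in> A\<close> \<open>d \<in> A\<close> \<open>x \<in> chart_overlap c d\<close> by metis
    qed
    from this[OF st(1)] this[OF st(2)] have e: "\<alpha> d (transition c d x) * s + b d (transition c d x) = \<alpha> c x * s + b c x"
      "\<alpha> d (transition c d x) * t + b d (transition c d x) = \<alpha> c x * t + b c x" by auto
    then have "(\<alpha> d (transition c d x) - \<alpha> c x) * (s - t) = 0" by (simp add: algebra_simps)
    then have "\<alpha> d (transition c d x) = \<alpha> c x" using st by simp
    then show ?thesis using e by simp
  qed
  have b: "smooth_function A b"
    unfolding smooth_function_def using D1(3) inv by blast
  \<comment> \<open>The gradient equation says that this difference has zero derivative in every
    chart.\<close>
  have "\<exists>C. \<forall>c\<in>A. \<forall>x\<in>chart_range c. (\<lambda>c x. \<alpha> c x - (2 - n) / 4 * \<mu> c x) c x = C"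
  proof (rule zero_derivative_constant)
    fix c x assume cx: "c \<in> A" "x \<in> chart_range c"
    have d: "\<alpha> c differentiable (at x)" "\<mu> c differentiable (at x)"
      using smooth_on_differentiable D1(2,4) cx by blast+
    then have dd: "(\<lambda>x. \<alpha> c x - (2 - n) / 4 * \<mu> c x) differentiable (at x)"
      by (intro differentiable_diff differentiable_mult differentiable_const)
    have "partial i (\<lambda>x. \<alpha> c x - (2 - n) / 4 * \<mu> c x) x = 0" for i
    proof -
      have "(\<lambda>x. (2 - n) / 4 * \<mu> c x) differentiable (at x)"
        by (intro differentiable_mult differentiable_const d)
      from partial_diff[OF d(1) this] grad[OF cx, of i] show ?thesis
        by (simp only: partial_cmult[OF d(2)])
    qed
    then have "frechet_derivative (\<lambda>x. \<alpha> c x - (2 - n) / 4 * \<mu> c x) (at x) h = 0" for h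
      unfolding frechet_derivative_eq_sum_partial[OF dd] by simp
    then show "((\<lambda>x. \<alpha> c x - (2 - n) / 4 * \<mu> c x) has_derivative (\<lambda>_. 0)) (at x)"
      using frechet_derivative_works_at[OF dd] by presburger
  next
    fix c d x assume "c \<in> A" "d \<in> A" "x \<in> chart_overlap c d"
    then show "\<alpha> d (transition c d x) - (2 - n) / 4 * \<mu> d (transition c d x) = \<alpha> c x - (2 - n) / 4 * \<mu> c x"
      using inv \<mu> unfolding smooth_function_def by simp
  qed
  then obtain C where C: "\<And>c x. c \<in> A \<Longrightarrow> x \<in> chart_range c \<Longrightarrow> \<alpha> c x = (2 - n) / 4 * \<mu> c x + C"
    by (auto simp: algebra_simps)
  have lap: "laplacian g \<alpha> c x = (2 - n) / 4 * laplacian g \<mu> c x" if "c \<in> A" "x \<in> chart_range c" for c x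
    by (rule laplacian_affine[where m=\<mu> and a=\<alpha>, OF open_chart_range[OF that(1)] that(2) D1(4)[OF that(1)] C[OF that(1)]])
  have "conformal_killing_field A g \<xi> \<mu>" unfolding conformal_killing_field_def using \<xi> \<mu> conf by blast
  moreover have "field_eq A J V \<xi> (\<lambda>c x u. ((2 - n) / 4 * \<mu> c x + C) * u + b c x)"
    unfolding field_eq_def using D2 C by simp
  moreover have "(2 - n) / 4 * laplacian g \<mu> c x * u + laplacian g b c x
       + (((2 - n) / 4 * \<mu> c x + C) * u + b c x) * f' u = ((2 - n) / 4 * \<mu> c x + C - \<mu> c x) * f u"
    if "c \<in> A" "x \<in> chart_range c" "u \<in> J" for c x u
    using det[OF that] lap[OF that(1,2)] C[OF that(1,2)] by simp
  ultimately show ?thesis using b by blast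
qed

text \<open>One criterion for the converse of every case; the constant \<open>C\<close> and the
  function \<open>b\<close> are left to be chosen so that the given field takes the normal
  form.\<close>

lemma lie_point_symmetryI:
  assumes J: "open_interval J" and f: "\<And>u. u \<in> J \<Longrightarrow> (f has_real_derivative f' u) (at u)"
    and V: "smooth_point_field A J V" and conf: "conformal_killing_field A g \<xi> \<mu>"
    and eq: "field_eq A J V \<xi> (\<lambda>c x u. ((2 - real CARD('n)) / 4 * \<mu> c x + C) * u + b c x)"
    and det: "\<And>c x u. c \<in> A \<Longrightarrow> x \<in> chart_range c \<Longrightarrow> u \<in> J \<Longrightarrow>
       (2 - real CARD('n)) / 4 * laplacian g \<mu> c x * u + laplacian g b c x
       + (((2 - real CARD('n)) / 4 * \<mu> c x + C) * u + b c x) * f' u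
       = ((2 - real CARD('n)) / 4 * \<mu> c x + C - \<mu> c x) * f u"
  shows "lie_point_symmetry A g J f V"
  unfolding lie_point_symmetry_iff[OF J]
proof (intro conjI ballI V)
  fix c assume c: "c \<in> A"
  define n where "n = real CARD('n)"
  define \<alpha> :: "('a,'n) scalar_comps" where "\<alpha> = (\<lambda>c x. (2 - n) / 4 * \<mu> c x + C)"
  have smm: "smooth_on (chart_range c) (\<mu> c)" and smx: "smooth_on (chart_range c) (\<xi> c)"
    using conf c unfolding conformal_killing_field_def smooth_function_def smooth_vector_field_def by blast+
  have lap: "laplacian g \<alpha> c x = (2 - n) / 4 * laplacian g \<mu> c x" if "x \<in> chart_range c" for x
    by (rule laplacian_affine[where m=\<mu> and a=\<alpha>, OF open_chart_range[OF c] that smm]) (simp add: \<alpha>_def)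
  have grad: "partial i (\<alpha> c) x = (2 - n) / 4 * partial i (\<mu> c) x" if "x \<in> chart_range c" for x i
  proof -
    have d: "\<mu> c differentiable (at x)" by (rule smooth_on_differentiable[OF smm that])
    have "(\<lambda>x. (2 - n) / 4 * \<mu> c x) differentiable (at x)"
      by (intro differentiable_mult differentiable_const d)
    from partial_add[OF this differentiable_const, of i C] show ?thesis
      unfolding \<alpha>_def by (simp only: partial_cmult[OF d] partial_const add_0_right)
  qed
  have E: "laplacian g \<alpha> c x * u + laplacian g b c x + (\<alpha> c x * u + b c x) * f' u = (\<alpha> c x - \<mu> c x) * f u"
    if "x \<in> chart_range c" "u \<in> J" for x u
    unfolding lap[OF that(1)] using det[OF c that] by (simp only: \<alpha>_def n_def)
  show "jet_domain.infinitesimal_symmetry (chart_range c) (g c) J f (fst (V c)) (snd (V c))"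
  proof (rule jet_domain.infinitesimal_symmetryI[OF jet_domain[OF c J] _ _ f _ _ smx smm])
    show "smooth_on (chart_range c \<times> J) (fst (V c))" "smooth_on (chart_range c \<times> J) (snd (V c))"
      using V c by (auto simp: smooth_point_field_def)
    show "\<forall>x\<in>chart_range c. \<forall>u\<in>J. fst (V c) (x, u) = \<xi> c x"
      "\<forall>x\<in>chart_range c. \<forall>u\<in>J. snd (V c) (x, u) = \<alpha> c x * u + b c x"
      using eq c unfolding field_eq_def \<alpha>_def n_def by auto
    show "\<forall>x\<in>chart_range c. \<forall>i j. lie_derivative_metric (\<xi> c) (g c) i j x = \<mu> c x * g c x $ i $ j"
      using conf c unfolding conformal_killing_field_def by blast
    show "\<forall>x\<in>chart_range c. \<forall>i. partial i (\<alpha> c) x = (2 - real CARD('n)) / 4 * partial i (\<mu> c) x"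
      using grad by (simp add: n_def)
    show "\<forall>x\<in>chart_range c. \<forall>u\<in>J. laplace_jet (g c) x (\<chi> i. partial i (\<alpha> c) x) (\<chi> i j. partial i (partial j (\<alpha> c)) x) * u +
        laplace_jet (g c) x (\<chi> i. partial i (b c) x) (\<chi> i j. partial i (partial j (b c)) x) +
        (\<alpha> c x * u + b c x) * f' u = (\<alpha> c x - \<mu> c x) * f u"
      using E unfolding laplacian_def by blast
  qed
qed

end

subsection \<open>The determining equations for special nonlinearities\<close>

lemma zero_function_derivative:
  assumes "open J" "\<And>u. u \<in> J \<Longrightarrow> h u = 0" "(h has_real_derivative D) (at u)" "u \<in> J"
  shows "D = 0"
proof -
  have "((\<lambda>_. 0) has_real_derivative D) (at u)"
    using has_field_derivative_transform_within_open[OF assms(3,1,4)] assms(2) by fastforce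
  then show ?thesis using DERIV_unique DERIV_const by blast
qed

text \<open>Two differentiations remove \<open>P * u + Q\<close> and leave a linear polynomial times
  exp, which has no zero.\<close>

lemma exp_linear_independent:
  fixes P Q a b :: real
  assumes h: "\<And>u. P * u + Q + (a * u + b) * exp u = 0"
  shows "P = 0" "Q = 0" "a = 0" "b = 0"
proof -
  have "((\<lambda>u. P * u + Q + (a * u + b) * exp u) has_real_derivative P + (a * u + (a + b)) * exp u) (at u)" for u
    by (auto intro!: derivative_eq_intros simp: algebra_simps)
  from zero_function_derivative[OF open_UNIV h this UNIV_I]
  have 1: "P + (a * u + (a + b)) * exp u = 0" for u .
  have "((\<lambda>u. P + (a * u + (a + b)) * exp u) has_real_derivative (a * u + (2 * a + b)) * exp u) (at u)" for u
    by (auto intro!: derivative_eq_intros simp: algebra_simps)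
  from zero_function_derivative[OF open_UNIV 1 this UNIV_I]
  have "(a * u + (2 * a + b)) * exp u = 0" for u .
  then have "a * u + (2 * a + b) = 0" for u by simp
  from this[of 0] this[of 1] show ab: "a = 0" "b = 0" by auto
  from h[of 0] h[of 1] show "P = 0" "Q = 0" by (simp_all add: ab)
qed

text \<open>For the square, f' = 2 u is proportional to u. The four functions of the generic power
  case collapse to the three monomials here.\<close>

lemma quadratic_zero:
  fixes P Q d :: real
  assumes J: "open_interval J" and h: "\<And>u. u \<in> J \<Longrightarrow> P * u + Q + d * u ^ 2 = 0"
  shows "P = 0" "Q = 0" "d = 0"
proof -
  have oJ: "open J" using J by (simp add: open_interval_def)
  obtain u where u: "u \<in> J" using J by (auto simp: open_interval_def)
  have 1: "P + 2 * d * u = 0" if "u \<in> J" for u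
    by (rule zero_function_derivative[OF oJ h _ that]) (auto intro!: derivative_eq_intros)
  have "2 * d = 0"
    by (rule zero_function_derivative[OF oJ 1 _ u]) (auto intro!: derivative_eq_intros)
  then show "d = 0" by simp
  with 1[OF u] show "P = 0" by simp
  with \<open>d = 0\<close> h[OF u] show "Q = 0" by simp
qed

text \<open>The Euler operator \<open>u d/du\<close> acts diagonally on \<open>u\<close>, \<open>1\<close>, \<open>f u / u\<close> and \<open>f u\<close>.\<close>

lemma euler_operator_step:
  fixes P Q c d p :: real
  assumes "open K" "0 \<notin> K"
    and f: "\<And>u. u \<in> K \<Longrightarrow> (f has_real_derivative f' u) (at u)" "\<And>u. u \<in> K \<Longrightarrow> u * f' u = p * f u"
    and h: "\<And>u. u \<in> K \<Longrightarrow> P * u + Q + c * (f u / u) + d * f u = 0" and u: "u \<in> K"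
  shows "P * u + (p - 1) * c * (f u / u) + p * d * f u = 0"
proof -
  have u0: "u \<noteq> 0" using assms(2) u by blast
  have D: "((\<lambda>u. P * u + Q + c * (f u / u) + d * f u) has_real_derivative
      P + c * ((f' u * u - f u) / (u * u)) + d * f' u) (at u)"
    using u0 f(1)[OF u] by (auto intro!: derivative_eq_intros simp: algebra_simps)
  have "P + c * ((f' u * u - f u) / (u * u)) + d * f' u = 0"
    by (rule zero_function_derivative[OF assms(1) h D u])
  then have "u * (P + c * ((f' u * u - f u) / (u * u)) + d * f' u) = 0" by (simp only: mult_zero_right)
  moreover have "u * (P + c * ((f' u * u - f u) / (u * u)) + d * f' u)
      = P * u + c * ((u * f' u - f u) / u) + d * (u * f' u)"
    using u0 by (simp add: field_simps)
  ultimately have "P * u + c * ((p * f u - f u) / u) + d * (p * f u) = 0"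
    unfolding f(2)[OF u] by (simp only:)
  then show ?thesis by (simp add: algebra_simps diff_divide_distrib)
qed

text \<open>The functions u, 1, f u / u and f u are eigenfunctions of u d/du with eigenvalues 1, 0,
  p - 1 and p. These are distinct exactly when p avoids 0, 1 and 2, so applying the operator
  repeatedly separates the coefficients.\<close>

lemma power_linear_independent:
  fixes P Q c d p :: real
  assumes J: "open_interval J" and p: "p \<noteq> 0" "p \<noteq> 1" "p \<noteq> 2"
    and f: "\<And>u. u \<in> J \<Longrightarrow> (f has_real_derivative f' u) (at u)" "\<And>u. u \<in> J \<Longrightarrow> u * f' u = p * f u"
    and f0: "\<And>u. u \<in> J \<Longrightarrow> u \<noteq> 0 \<Longrightarrow> f u \<noteq> 0"
    and h: "\<And>u. u \<in> J \<Longrightarrow> P * u + Q + c * f' u + d * f u = 0"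
  shows "P = 0" "Q = 0" "c = 0" "d = 0"
proof -
  \<comment> \<open>Removing 0 permits division by u; an open interval keeps other points.\<close>
  define K where "K = J - {0}"
  have K: "open K" "0 \<notin> K" using J by (auto simp: K_def open_interval_def)
  have "\<exists>u. u \<in> K"
  proof -
    obtain s where s: "s \<in> J" using J by (auto simp: open_interval_def)
    obtain e where "e > 0" "ball s e \<subseteq> J" using J s open_contains_ball unfolding open_interval_def by blast
    then have "s + e / 2 \<in> J" by (auto simp: dist_real_def subset_iff)
    then show ?thesis using s \<open>e > 0\<close> by (cases "s = 0") (auto simp: K_def intro: exI[of _ s] exI[of _ "s + e/2"])
  qed
  then obtain u where u: "u \<in> K" by blast
  have u0: "u \<noteq> 0" using u K by blast
  have fK: "(f has_real_derivative f' u) (at u)" "u * f' u = p * f u" if "u \<in> K" for u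
    using f that by (auto simp: K_def)
  have fu: "f u \<noteq> 0" using f0 u by (auto simp: K_def)
  have h0: "P * u + Q + c * p * (f u / u) + d * f u = 0" if "u \<in> K" for u
  proof -
    have "u \<noteq> 0" "u \<in> J" using that by (auto simp: K_def)
    then have "f' u = p * (f u / u)" using fK(2)[OF that] by (simp add: field_simps)
    then show ?thesis using h[OF \<open>u \<in> J\<close>] by (simp add: algebra_simps)
  qed
  have h1: "P * u + (p - 1) * (c * p) * (f u / u) + p * d * f u = 0" if "u \<in> K" for u
    by (rule euler_operator_step[OF K fK h0 that])
  have h1': "P * u + 0 + (p - 1) * (c * p) * (f u / u) + p * d * f u = 0" if "u \<in> K" for u
    using h1[OF that] by simp
  have h2: "P * u + (p - 1) * ((p - 1) * (c * p)) * (f u / u) + p * (p * d) * f u = 0" if "u \<in> K" for u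
    by (rule euler_operator_step[OF K fK h1' that])
  \<comment> \<open>Subtracting \<open>h1\<close> from \<open>h2\<close> eliminates the eigenvalue
    1, that is, the coefficient \<open>P\<close>.\<close>
  have h3: "0 * u + 0 + (p - 1) * (p - 2) * (c * p) * (f u / u) + p * (p - 1) * d * f u = 0" if "u \<in> K" for u
  proof -
    have eliminate: "(p - 1) * (p - 2) * s * w + p * (p - 1) * d * z =
        (r + (p - 1) * ((p - 1) * s) * w + p * (p * d) * z) - (r + (p - 1) * s * w + p * d * z)" for r s w z
      by (simp add: algebra_simps)
    have "(p - 1) * (p - 2) * (c * p) * (f u / u) + p * (p - 1) * d * f u = 0"
      unfolding eliminate[where r="P * u"] h1[OF that] h2[OF that] by simp
    then show ?thesis by (simp only: mult_zero_left add_0_left)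
  qed
  have h4: "0 * u + (p - 1) * ((p - 1) * (p - 2) * (c * p)) * (f u / u) + p * (p * (p - 1) * d) * f u = 0" if "u \<in> K" for u
    by (rule euler_operator_step[OF K fK h3 that])
  \<comment> \<open>Subtracting \<open>h4\<close> from p times \<open>h3\<close> eliminates the
    eigenvalue p and isolates \<open>c\<close>.\<close>
  have "(p - 1) * (p - 2) * s * w = p * (0 * u + 0 + (p - 1) * (p - 2) * s * w + p * (p - 1) * d * z)
      - (0 * u + (p - 1) * ((p - 1) * (p - 2) * s) * w + p * (p * (p - 1) * d) * z)" for s w z
    by (simp add: algebra_simps)
  from this[of "c * p" "f u / u" "f u"] have "(p - 1) * (p - 2) * (c * p) * (f u / u) = 0"
    unfolding h4[OF u] h3[OF u] by simp
  then show c: "c = 0" using p u0 fu by simp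
  then show d: "d = 0" using h3[OF u] p fu by simp
  show P: "P = 0" using h1[OF u] c d u0 by simp
  show "Q = 0" using h0[OF u] c d P by simp
qed

text \<open>Euler's homogeneity relation and nonvanishing away from 0 are what the linear
  independence argument uses of a power; they hold for real and for integer exponents alike, so the
  two readings of u^p need no separate treatment later.\<close>

lemma power_function_on_derivative:
  assumes J: "open J" and p: "p \<noteq> 0" and f: "power_function_on p J f"
  shows "\<exists>f'. (\<forall>u\<in>J. (f has_real_derivative f' u) (at u) \<and> u * f' u = p * f u)"
    and "\<And>u. u \<in> J \<Longrightarrow> u \<noteq> 0 \<Longrightarrow> f u \<noteq> 0"
proof -
  consider (powr) "J \<subseteq> {0<..}" "\<forall>u\<in>J. f u = u powr p" |
    (powi) k where "p = of_int k" "k \<ge> 0 \<or> 0 \<notin> J" "\<forall>u\<in>J. f u = u powi k"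
    using f unfolding power_function_on_def by blast
  note cs = this
  show "\<exists>f'. (\<forall>u\<in>J. (f has_real_derivative f' u) (at u) \<and> u * f' u = p * f u)"
    using cs
  proof cases
    case powr
    have "(f has_real_derivative p * u powr (p - 1)) (at u)" "u * (p * u powr (p - 1)) = p * f u" if "u \<in> J" for u
    proof -
      have "u > 0" using powr that by auto
      then have "((\<lambda>u. u powr p) has_real_derivative p * u powr (p - 1)) (at u)"
        by (rule has_real_derivative_powr)
      then show "(f has_real_derivative p * u powr (p - 1)) (at u)"
        by (rule has_field_derivative_transform_within_open[OF _ J that]) (use powr in simp)
      show "u * (p * u powr (p - 1)) = p * f u"
        using powr(2) that \<open>u > 0\<close> by (simp add: powr_diff)
    qed
    then show ?thesis by (intro exI[of _ "\<lambda>u. p * u powr (p - 1)"]) blast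
  next
    case powi
    have "k \<noteq> 0" using powi(1) p by auto
    have "(f has_real_derivative p * u powi (k - 1)) (at u)" "u * (p * u powi (k - 1)) = p * f u" if "u \<in> J" for u
    proof -
      have "((\<lambda>u. u powi k) has_real_derivative p * u powi (k - 1)) (at u)"
      proof (cases "u = 0")
        case False
        then show ?thesis unfolding powi(1)
          by (auto intro!: derivative_eq_intros)
      next
        \<comment> \<open>If 0 belongs to \<open>J\<close>, the exponent is a positive integer and
          the power is a monomial, whose derivative formula holds at 0 as well.\<close>
        case True
        then have "k > 0" using powi(2) that \<open>k \<noteq> 0\<close> by auto
        then have "k = int (nat k)" "nat k > 0" by auto
        then have "(\<lambda>u::real. u powi k) = (\<lambda>u. u ^ nat k)" "u powi (k - 1) = u ^ (nat k - 1)"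
          by (auto simp: power_int_def nat_diff_distrib)
        then show ?thesis unfolding powi(1) using \<open>k > 0\<close>
          by (auto intro!: derivative_eq_intros)
      qed
      then show "(f has_real_derivative p * u powi (k - 1)) (at u)"
        by (rule has_field_derivative_transform_within_open[OF _ J that]) (use powi in simp)
      show "u * (p * u powi (k - 1)) = p * f u"
      proof (cases "u = 0")
        case False
        then show ?thesis using powi(3) that by (simp add: power_int_diff)
      next
        case True
        then show ?thesis using powi(3) that \<open>k \<noteq> 0\<close> by simp
      qed
    qed
    then show ?thesis by (intro exI[of _ "\<lambda>u. p * u powi (k - 1)"]) blast
  qed
  show "f u \<noteq> 0" if "u \<in> J" "u \<noteq> 0" for u
    using cs
  proof cases
    case powr
    then show ?thesis using that by simp
  next
    case powi
    then show ?thesis using that by simp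
  qed
qed

lemma power_function_on_2:
  assumes "power_function_on 2 J f" "u \<in> J"
  shows "f u = u ^ 2"
proof -
  consider "J \<subseteq> {0<..}" "\<forall>u\<in>J. f u = u powr 2" | k where "2 = real_of_int k" "\<forall>u\<in>J. f u = u powi k"
    using assms unfolding power_function_on_def by blast
  then show ?thesis
  proof cases
    case 1
    then show ?thesis using assms(2) by (auto simp: powr_numeral subset_iff)
  next
    case 2
    then have "k = 2" by linarith
    then show ?thesis using 2(2) assms(2) by (simp add: power_int_def)
  qed
qed

lemma field_eq_cong:
  assumes "\<And>c x u. c \<in> A \<Longrightarrow> x \<in> chart_range c \<Longrightarrow> u \<in> J \<Longrightarrow> h c x u = h' c x u"
  shows "field_eq A J V \<xi> h \<longleftrightarrow> field_eq A J V \<xi> h'"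
  using assms unfolding field_eq_def by auto

section \<open>The classification for each nonlinearity\<close>

context connected_pseudo_riemannian_manifold
begin

lemma n_ge_3: "real CARD('n) \<ge> 3"
  using dim3 by linarith

lemma open_interval_UNIV: "open_interval UNIV"
  by (simp add: open_interval_def)

lemma conformal_killing_field_cong:
  assumes "\<And>c x. c \<in> A \<Longrightarrow> x \<in> chart_range c \<Longrightarrow> \<mu> c x = \<mu>' c x"
    and "conformal_killing_field A g \<xi> \<mu>"
  shows "conformal_killing_field A g \<xi> \<mu>'"
proof -
  have \<mu>: "smooth_function A \<mu>" using assms(2) by (simp add: conformal_killing_field_def)
  have "smooth_on (chart_range c) (\<mu>' c)" if "c \<in> A" for c
    using smooth_on_eqI[OF open_chart_range[OF that], of "\<mu> c" "\<mu>' c"] \<mu> assms(1) that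
    unfolding smooth_function_def by blast
  moreover have "\<mu>' d (transition c d x) = \<mu>' c x" if "c \<in> A" "d \<in> A" "x \<in> chart_overlap c d" for c d x
    using \<mu> assms(1) that overlap_subset transition_in_range unfolding smooth_function_def by metis
  ultimately have "smooth_function A \<mu>'" unfolding smooth_function_def by blast
  then show ?thesis using assms unfolding conformal_killing_field_def by auto
qed

lemma smooth_conformal_factor_chart:
  "conformal_killing_field A g \<xi> \<mu> \<Longrightarrow> c \<in> A \<Longrightarrow> smooth_on (chart_range c) (\<mu> c)"
  unfolding conformal_killing_field_def smooth_function_def by blast

lemma laplacian_const:
  assumes "c \<in> A" "x \<in> chart_range c" "\<And>y. y \<in> chart_range c \<Longrightarrow> a c y = C"
  shows "laplacian g a c x = 0"
proof -
  have "laplacian g a c x = 0 * laplacian g (\<lambda>_ _. 0) c x"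
    by (rule laplacian_affine[OF open_chart_range[OF assms(1)] assms(2) smooth_on_const]) (simp add: assms(3))
  then show ?thesis by simp
qed

text \<open>Inserting \<mu> = 4 (C - l) / (n + 2), with l = \<Delta>b / k, into (2 - n) \<mu> / 4:
  the fours cancel, which explains the coefficient (n - 2) / (n + 2) of the constant-source
  case.\<close>

lemma weight_in_source_terms:
  "(2 - real CARD('n)) / 4 * (4 / (real CARD('n) + 2) * (C - l)) = (real CARD('n) - 2) / (real CARD('n) + 2) * (l - C)"
  using n_ge_3 by (simp add: field_simps)

text \<open>The determining equation is an affine function of u whose two coefficients must vanish;
  n > 2 makes the slope a nonzero multiple of \<Delta>\<mu>.\<close>

lemma symmetries_zero:
  assumes V: "smooth_point_field A UNIV V"
  shows "lie_point_symmetry A g UNIV (\<lambda>u. 0) V \<longleftrightarrow>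
         (\<exists>\<xi> \<mu> b C. conformal_killing_field A g \<xi> \<mu> \<and> smooth_function A b \<and>
            vanishes A (laplacian g b) \<and> vanishes A (laplacian g \<mu>) \<and>
            field_eq A UNIV V \<xi> (\<lambda>c x u. ((2 - real CARD('n)) / 4 * \<mu> c x + C) * u + b c x))"
    (is "_ = ?R")
proof
  assume "lie_point_symmetry A g UNIV (\<lambda>u. 0) V"
  from lie_point_symmetryD[OF open_interval_UNIV _ this, of "\<lambda>_. 0"]
  obtain \<xi> \<mu> b C where *: "conformal_killing_field A g \<xi> \<mu>" "smooth_function A b"
    "field_eq A UNIV V \<xi> (\<lambda>c x u. ((2 - real CARD('n)) / 4 * \<mu> c x + C) * u + b c x)"
    and det: "\<And>c x u. c \<in> A \<Longrightarrow> x \<in> chart_range c \<Longrightarrow> (2 - real CARD('n)) / 4 * laplacian g \<mu> c x * u + laplacian g b c x = 0"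
    by auto
  have b: "laplacian g b c x = 0" if "c \<in> A" "x \<in> chart_range c" for c x
    using det[OF that, of 0] by simp
  moreover have "laplacian g \<mu> c x = 0" if "c \<in> A" "x \<in> chart_range c" for c x
    using det[OF that, of 1] b[OF that] n_ge_3 by simp
  ultimately show ?R
    using * unfolding vanishes_def by blast
next
  assume ?R
  then obtain \<xi> \<mu> b C where *: "conformal_killing_field A g \<xi> \<mu>"
            "vanishes A (laplacian g b)" "vanishes A (laplacian g \<mu>)"
            "field_eq A UNIV V \<xi> (\<lambda>c x u. ((2 - real CARD('n)) / 4 * \<mu> c x + C) * u + b c x)" by blast
  show "lie_point_symmetry A g UNIV (\<lambda>u. 0) V"
    by (rule lie_point_symmetryI[OF open_interval_UNIV DERIV_const V *(1,4)])
      (use *(2,3) in \<open>simp add: vanishes_def\<close>)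
qed

text \<open>The part free of u reads \<Delta>b = k (C - (n + 2) \<mu> / 4), so b determines \<mu>;
  the part linear in u says \<Delta>\<mu> = 0, which by this affine relation amounts to
  \<Delta>\<Delta>b = 0.\<close>

lemma symmetries_constant:
  assumes k: "k \<noteq> 0" and V: "smooth_point_field A UNIV V"
  shows "lie_point_symmetry A g UNIV (\<lambda>u. k) V \<longleftrightarrow>
         (\<exists>\<xi> b C.
            conformal_killing_field A g \<xi>
              (\<lambda>c x. 4 / (real CARD('n) + 2) * (C - 1 / k * laplacian g b c x)) \<and>
            smooth_function A b \<and> vanishes A (laplacian g (laplacian g b)) \<and>
            field_eq A UNIV V \<xi> (\<lambda>c x u.
              ((real CARD('n) - 2) / (real CARD('n) + 2) * (1 / k * laplacian g b c x - C) + C) * u + b c x))"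
    (is "_ = ?R")
proof
  assume "lie_point_symmetry A g UNIV (\<lambda>u. k) V"
  from lie_point_symmetryD[OF open_interval_UNIV _ this, of "\<lambda>_. 0"]
  obtain \<xi> \<mu> b C where *: "conformal_killing_field A g \<xi> \<mu>" "smooth_function A b"
    "field_eq A UNIV V \<xi> (\<lambda>c x u. ((2 - real CARD('n)) / 4 * \<mu> c x + C) * u + b c x)"
    and det: "\<And>c x u. c \<in> A \<Longrightarrow> x \<in> chart_range c \<Longrightarrow> (2 - real CARD('n)) / 4 * laplacian g \<mu> c x * u + laplacian g b c x
        = ((2 - real CARD('n)) / 4 * \<mu> c x + C - \<mu> c x) * k"
    by auto
  have b: "laplacian g b c x = (- k * (real CARD('n) + 2) / 4) * \<mu> c x + k * C" if "c \<in> A" "x \<in> chart_range c" for c x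
    using det[OF that, of 0] by (simp add: field_simps)
  have m: "laplacian g \<mu> c x = 0" if "c \<in> A" "x \<in> chart_range c" for c x
    using det[OF that, of 0] det[OF that, of 1] n_ge_3 by simp
  have \<mu>: "\<mu> c x = 4 / (real CARD('n) + 2) * (C - 1 / k * laplacian g b c x)" if "c \<in> A" "x \<in> chart_range c" for c x
  proof -
    have "1 / k * laplacian g b c x = C - (real CARD('n) + 2) / 4 * \<mu> c x"
      unfolding b[OF that] using k by (simp add: field_simps)
    then have "4 / (real CARD('n) + 2) * (C - 1 / k * laplacian g b c x) = 4 / (real CARD('n) + 2) * ((real CARD('n) + 2) / 4 * \<mu> c x)" by simp
    moreover have "real CARD('n) + 2 \<noteq> 0" using n_ge_3 by linarith
    ultimately show ?thesis by simp
  qed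
  have "laplacian g (laplacian g b) c x = 0" if "c \<in> A" "x \<in> chart_range c" for c x
    using laplacian_affine[where m=\<mu> and a="laplacian g b", OF open_chart_range[OF that(1)] that(2)
        smooth_conformal_factor_chart[OF *(1) that(1)] b[OF that(1)]] m[OF that] by simp
  moreover have "conformal_killing_field A g \<xi> (\<lambda>c x. 4 / (real CARD('n) + 2) * (C - 1 / k * laplacian g b c x))"
    by (rule conformal_killing_field_cong[OF \<mu> *(1)])
  moreover have "field_eq A UNIV V \<xi> (\<lambda>c x u.
              ((real CARD('n) - 2) / (real CARD('n) + 2) * (1 / k * laplacian g b c x - C) + C) * u + b c x)"
  proof (rule field_eq_cong[THEN iffD1, OF _ *(3)])
    fix c x and u :: real assume cx: "c \<in> A" "x \<in> chart_range c"
    have "(2 - real CARD('n)) / 4 * \<mu> c x = (real CARD('n) - 2) / (real CARD('n) + 2) * (1 / k * laplacian g b c x - C)"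
      unfolding \<mu>[OF cx] by (rule weight_in_source_terms)
    then show "((2 - real CARD('n)) / 4 * \<mu> c x + C) * u + b c x = ((real CARD('n) - 2) / (real CARD('n) + 2) * (1 / k * laplacian g b c x - C) + C) * u + b c x"
      by (simp only:)
  qed
  ultimately show ?R using *(2) unfolding vanishes_def by blast
next
  assume ?R
  then obtain \<xi> b C where conf: "conformal_killing_field A g \<xi> (\<lambda>c x. 4 / (real CARD('n) + 2) * (C - 1 / k * laplacian g b c x))"
    and b: "vanishes A (laplacian g (laplacian g b))"
    and eq: "field_eq A UNIV V \<xi> (\<lambda>c x u. ((real CARD('n) - 2) / (real CARD('n) + 2) * (1 / k * laplacian g b c x - C) + C) * u + b c x)"
    by blast
  define \<mu> :: "('a,'n) scalar_comps" where "\<mu> = (\<lambda>c x. 4 / (real CARD('n) + 2) * (C - 1 / k * laplacian g b c x))"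
  have L: "laplacian g b c x = (- k * (real CARD('n) + 2) / 4) * \<mu> c x + k * C" for c x
  proof -
    have "l = (- k * s / 4) * (4 / s * (C - 1 / k * l)) + k * C" if "s \<noteq> 0" for s l :: real
      using k that by (simp add: field_simps)
    moreover have "real CARD('n) + 2 \<noteq> 0" using n_ge_3 by linarith
    ultimately show ?thesis unfolding \<mu>_def by blast
  qed
  \<comment> \<open>The factor between \<Delta>\<Delta>b and \<Delta>\<mu> is nonzero since k
    \<noteq> 0 and n + 2 > 0.\<close>
  have m: "laplacian g \<mu> c x = 0" if "c \<in> A" "x \<in> chart_range c" for c x
  proof -
    have "laplacian g (laplacian g b) c x = (- k * (real CARD('n) + 2) / 4) * laplacian g \<mu> c x"
      by (rule laplacian_affine[where m=\<mu> and a="laplacian g b", OF open_chart_range[OF that(1)] that(2)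
        smooth_conformal_factor_chart[OF conf[folded \<mu>_def] that(1)] L])
    then show ?thesis using b that k n_ge_3 by (simp add: vanishes_def)
  qed
  have eq': "field_eq A UNIV V \<xi> (\<lambda>c x u. ((2 - real CARD('n)) / 4 * \<mu> c x + C) * u + b c x)"
  proof (rule field_eq_cong[THEN iffD1, OF _ eq])
    fix c x and u :: real
    have "(2 - real CARD('n)) / 4 * \<mu> c x = (real CARD('n) - 2) / (real CARD('n) + 2) * (1 / k * laplacian g b c x - C)"
      unfolding \<mu>_def by (rule weight_in_source_terms)
    then show "((real CARD('n) - 2) / (real CARD('n) + 2) * (1 / k * laplacian g b c x - C) + C) * u + b c x = ((2 - real CARD('n)) / 4 * \<mu> c x + C) * u + b c x"
      by (simp only:)
  qed
  show "lie_point_symmetry A g UNIV (\<lambda>u. k) V"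
    by (rule lie_point_symmetryI[OF open_interval_UNIV DERIV_const V conf[folded \<mu>_def] eq'])
      (simp add: m L field_simps)
qed

text \<open>With f' = 1 the term a u occurs on both sides and cancels. This leaves \<open>C\<close>
  free and couples \<Delta>\<mu> only to \<mu>, and \<Delta>b only to b.\<close>

lemma symmetries_linear:
  assumes V: "smooth_point_field A UNIV V"
  shows "lie_point_symmetry A g UNIV (\<lambda>u. u) V \<longleftrightarrow>
         (\<exists>\<xi> \<mu> b C. conformal_killing_field A g \<xi> \<mu> \<and> smooth_function A b \<and>
            vanishes A (\<lambda>c x. laplacian g b c x + b c x) \<and>
            vanishes A (\<lambda>c x. (2 - real CARD('n)) / 4 * laplacian g \<mu> c x + \<mu> c x) \<and>
            field_eq A UNIV V \<xi> (\<lambda>c x u. ((2 - real CARD('n)) / 4 * \<mu> c x + C) * u + b c x))"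
    (is "_ = ?R")
proof
  assume "lie_point_symmetry A g UNIV (\<lambda>u. u) V"
  from lie_point_symmetryD[OF open_interval_UNIV _ this, of "\<lambda>_. 1"]
  obtain \<xi> \<mu> b C where *: "conformal_killing_field A g \<xi> \<mu>" "smooth_function A b"
    "field_eq A UNIV V \<xi> (\<lambda>c x u. ((2 - real CARD('n)) / 4 * \<mu> c x + C) * u + b c x)"
    and det: "\<And>c x u. c \<in> A \<Longrightarrow> x \<in> chart_range c \<Longrightarrow> (2 - real CARD('n)) / 4 * laplacian g \<mu> c x * u + laplacian g b c x
       + (((2 - real CARD('n)) / 4 * \<mu> c x + C) * u + b c x) = ((2 - real CARD('n)) / 4 * \<mu> c x + C - \<mu> c x) * u"
    by auto
  have b: "laplacian g b c x + b c x = 0" if "c \<in> A" "x \<in> chart_range c" for c x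
    using det[OF that, of 0] by simp
  moreover have "(2 - real CARD('n)) / 4 * laplacian g \<mu> c x + \<mu> c x = 0" if "c \<in> A" "x \<in> chart_range c" for c x
    using det[OF that, of 1] b[OF that] by simp
  ultimately show ?R using * unfolding vanishes_def by blast
next
  assume ?R
  then obtain \<xi> \<mu> b C where *: "conformal_killing_field A g \<xi> \<mu>"
     "field_eq A UNIV V \<xi> (\<lambda>c x u. ((2 - real CARD('n)) / 4 * \<mu> c x + C) * u + b c x)"
     and b: "vanishes A (\<lambda>c x. laplacian g b c x + b c x)"
     and m: "vanishes A (\<lambda>c x. (2 - real CARD('n)) / 4 * laplacian g \<mu> c x + \<mu> c x)" by blast
  show "lie_point_symmetry A g UNIV (\<lambda>u. u) V"
  proof (rule lie_point_symmetryI[OF open_interval_UNIV DERIV_ident V *])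
    fix c x and u :: real assume "c \<in> A" "x \<in> chart_range c"
    then have "laplacian g b c x = - b c x" "(2 - real CARD('n)) / 4 * laplacian g \<mu> c x = - \<mu> c x"
      using b m unfolding vanishes_def by (force simp: add_eq_0_iff)+
    then show "(2 - real CARD('n)) / 4 * laplacian g \<mu> c x * u + laplacian g b c x
       + (((2 - real CARD('n)) / 4 * \<mu> c x + C) * u + b c x) * 1 = ((2 - real CARD('n)) / 4 * \<mu> c x + C - \<mu> c x) * u"
      by (simp only:) (simp add: algebra_simps)
  qed
qed

text \<open>The coefficient of u exp u forces a = 0, hence \<mu> is constant because (2 - n) \<mu> /
  4 + C = 0; the coefficient of exp u then gives b = - \<mu>.\<close>

lemma symmetries_exp:
  assumes V: "smooth_point_field A UNIV V"
  shows "lie_point_symmetry A g UNIV exp V \<longleftrightarrow>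
         (\<exists>\<xi> m. homothety A g \<xi> m \<and> field_eq A UNIV V \<xi> (\<lambda>c x u. - m))"
    (is "_ = ?R")
proof
  assume "lie_point_symmetry A g UNIV exp V"
  from lie_point_symmetryD[OF open_interval_UNIV DERIV_exp this]
  obtain \<xi> \<mu> b C where *: "conformal_killing_field A g \<xi> \<mu>"
    "field_eq A UNIV V \<xi> (\<lambda>c x u. ((2 - real CARD('n)) / 4 * \<mu> c x + C) * u + b c x)"
    and det: "\<And>c x u. c \<in> A \<Longrightarrow> x \<in> chart_range c \<Longrightarrow> (2 - real CARD('n)) / 4 * laplacian g \<mu> c x * u + laplacian g b c x
       + (((2 - real CARD('n)) / 4 * \<mu> c x + C) * u + b c x) * exp u = ((2 - real CARD('n)) / 4 * \<mu> c x + C - \<mu> c x) * exp u"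
    by auto
  have ab: "(2 - real CARD('n)) / 4 * \<mu> c x + C = 0" "b c x = - \<mu> c x" if "c \<in> A" "x \<in> chart_range c" for c x
  proof -
    have z: "(2 - real CARD('n)) / 4 * laplacian g \<mu> c x * u + laplacian g b c x
        + (((2 - real CARD('n)) / 4 * \<mu> c x + C) * u + (b c x - ((2 - real CARD('n)) / 4 * \<mu> c x + C - \<mu> c x))) * exp u = 0" for u
      using det[OF that, of u] by (simp add: algebra_simps)
    show "(2 - real CARD('n)) / 4 * \<mu> c x + C = 0" "b c x = - \<mu> c x"
      using exp_linear_independent(3,4)[OF z] by auto
  qed
  define m where "m = 4 * C / (real CARD('n) - 2)"
  have \<mu>: "\<mu> c x = m" if "c \<in> A" "x \<in> chart_range c" for c x
    using ab(1)[OF that] n_ge_3 by (simp add: m_def field_simps)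
  have "homothety A g \<xi> m"
    unfolding homothety_def by (rule conformal_killing_field_cong[OF \<mu> *(1)])
  moreover have "field_eq A UNIV V \<xi> (\<lambda>c x u. - m)"
    by (rule field_eq_cong[THEN iffD1, OF _ *(2)]) (simp only: ab, simp add: \<mu>)
  ultimately show ?R by blast
next
  assume ?R
  then obtain \<xi> m where *: "homothety A g \<xi> m" "field_eq A UNIV V \<xi> (\<lambda>c x u. - m)" by blast
  \<comment> \<open>The constant (n - 2) m / 4 is the one that cancels the coefficient of u in the
    normal form.\<close>
  have z: "(2 - real CARD('n)) / 4 * m + (real CARD('n) - 2) / 4 * m = 0" by (simp add: field_simps)
  show "lie_point_symmetry A g UNIV exp V"
  proof (rule lie_point_symmetryI[OF open_interval_UNIV DERIV_exp V *(1)[unfolded homothety_def],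
        where C="(real CARD('n) - 2) / 4 * m" and b="\<lambda>_ _. - m"])
    show "field_eq A UNIV V \<xi> (\<lambda>c x u. ((2 - real CARD('n)) / 4 * m + (real CARD('n) - 2) / 4 * m) * u + - m)"
      unfolding z using *(2) by simp
  qed (simp only: z, simp add: laplacian_const)
qed

text \<open>The test function exp u + 1 suffices: the exponential forces a = 0 and b = - \<mu> with
  \<mu> constant, which still admits homotheties, and the summand 1 adds \<Delta>b = - \<mu>, which
  excludes the non-isometric ones.\<close>

lemma symmetries_all:
  assumes V: "smooth_point_field A UNIV V"
  shows "(\<forall>f. smooth_on UNIV f \<longrightarrow> lie_point_symmetry A g UNIV f V) \<longleftrightarrow>
         (\<exists>\<xi>. killing_field A g \<xi> \<and> field_eq A UNIV V \<xi> (\<lambda>c x u. 0))"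
    (is "?L = ?R")
proof
  assume ?L
  moreover have "smooth_on UNIV (\<lambda>u::real. exp u + 1)"
    by (intro smooth_on_add smooth_on_exp smooth_on_const) simp
  ultimately have sym: "lie_point_symmetry A g UNIV (\<lambda>u. exp u + 1) V" by blast
  have "((\<lambda>u. exp u + 1) has_real_derivative exp u) (at u)" for u :: real
    by (auto intro!: derivative_eq_intros)
  from lie_point_symmetryD[OF open_interval_UNIV this sym]
  obtain \<xi> \<mu> b C where *: "conformal_killing_field A g \<xi> \<mu>"
    "field_eq A UNIV V \<xi> (\<lambda>c x u. ((2 - real CARD('n)) / 4 * \<mu> c x + C) * u + b c x)"
    and det: "\<And>c x u. c \<in> A \<Longrightarrow> x \<in> chart_range c \<Longrightarrow> (2 - real CARD('n)) / 4 * laplacian g \<mu> c x * u + laplacian g b c x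
       + (((2 - real CARD('n)) / 4 * \<mu> c x + C) * u + b c x) * exp u = ((2 - real CARD('n)) / 4 * \<mu> c x + C - \<mu> c x) * (exp u + 1)"
    by auto
  have ab: "(2 - real CARD('n)) / 4 * \<mu> c x + C = 0" "b c x = - \<mu> c x" "laplacian g b c x = - \<mu> c x"
    if "c \<in> A" "x \<in> chart_range c" for c x
  proof -
    define a where "a = (2 - real CARD('n)) / 4 * \<mu> c x + C"
    have z: "(2 - real CARD('n)) / 4 * laplacian g \<mu> c x * u + (laplacian g b c x - (a - \<mu> c x))
        + (a * u + (b c x - (a - \<mu> c x))) * exp u = 0" for u
      using det[OF that, of u] unfolding a_def[symmetric] by (simp add: algebra_simps)
    show "(2 - real CARD('n)) / 4 * \<mu> c x + C = 0" "b c x = - \<mu> c x" "laplacian g b c x = - \<mu> c x"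
      using exp_linear_independent(2-4)[OF z] unfolding a_def[symmetric] by auto
  qed
  have b: "b c y = - (4 * C / (real CARD('n) - 2))" if "c \<in> A" "y \<in> chart_range c" for c y
    using ab(1,2)[OF that] n_ge_3 by (simp add: field_simps)
  \<comment> \<open>Here b is constant, so \<Delta>b = 0, while the test function demands \<Delta>b
    = - \<mu>.\<close>
  have \<mu>: "\<mu> c x = 0" if "c \<in> A" "x \<in> chart_range c" for c x
    using laplacian_const[OF that, of b, OF b[OF that(1)]] ab(3)[OF that] by simp
  have "killing_field A g \<xi>"
    unfolding killing_field_def homothety_def by (rule conformal_killing_field_cong[OF \<mu> *(1)])
  moreover have "field_eq A UNIV V \<xi> (\<lambda>c x u. 0)"
    by (rule field_eq_cong[THEN iffD1, OF _ *(2)]) (simp only: ab, simp add: \<mu>)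
  ultimately show ?R by blast
next
  assume ?R
  then obtain \<xi> where *: "conformal_killing_field A g \<xi> (\<lambda>_ _. 0)" "field_eq A UNIV V \<xi> (\<lambda>c x u. 0)"
    unfolding killing_field_def homothety_def by blast
  show ?L
  proof (intro allI impI)
    fix f :: "real \<Rightarrow> real" assume f: "smooth_on UNIV f"
    have "(f has_real_derivative deriv f u) (at u)" for u
      using smooth_on_differentiable[OF f, of u] DERIV_deriv_iff_real_differentiable by blast
    then show "lie_point_symmetry A g UNIV f V"
      by (rule lie_point_symmetryI[OF open_interval_UNIV _ V *(1), where C=0 and b="\<lambda>_ _. 0"])
        (use *(2) in \<open>simp_all add: laplacian_const\<close>)
  qed
qed

text \<open>By homogeneity the coefficient of f is a (p - 1) + \<mu>. Substituting a = (2 - n) \<mu>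
  / 4 + C determines \<mu> as a constant away from the critical exponent. For p = 2 the functions f'
  and u merge and only (2 - n) \<Delta>\<mu> / 4 + 2 b = 0 is obtained; constancy of \<mu> then
  gives b = 0.\<close>

lemma symmetries_power:
  assumes p: "p \<noteq> 0" "p \<noteq> 1" "p \<noteq> (real CARD('n) + 2) / (real CARD('n) - 2)"
    and J: "open_interval J" and f: "power_function_on p J f" and V: "smooth_point_field A J V"
  shows "lie_point_symmetry A g J f V \<longleftrightarrow>
         (\<exists>\<xi> m. homothety A g \<xi> m \<and> field_eq A J V \<xi> (\<lambda>c x u. m / (1 - p) * u))"
    (is "_ = ?R")
proof -
  have oJ: "open J" using J by (simp add: open_interval_def)
  obtain f' where f': "\<And>u. u \<in> J \<Longrightarrow> (f has_real_derivative f' u) (at u)" "\<And>u. u \<in> J \<Longrightarrow> u * f' u = p * f u"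
    using power_function_on_derivative(1)[OF oJ p(1) f] by blast
  note f0 = power_function_on_derivative(2)[OF oJ p(1) f]
  \<comment> \<open>The coefficient of \<mu> in a (p - 1) + \<mu>; it vanishes only at the critical
    exponent, which is excluded.\<close>
  have r: "(2 - real CARD('n)) / 4 * (p - 1) + 1 \<noteq> 0"
  proof
    assume "(2 - real CARD('n)) / 4 * (p - 1) + 1 = 0"
    then have "p = (real CARD('n) + 2) / (real CARD('n) - 2)" using n_ge_3 by (simp add: field_simps)
    then show False using p(3) by blast
  qed
  show ?thesis
  proof
    assume "lie_point_symmetry A g J f V"
    from lie_point_symmetryD[OF J f'(1) this]
    obtain \<xi> \<mu> b C where *: "conformal_killing_field A g \<xi> \<mu>"
      "field_eq A J V \<xi> (\<lambda>c x u. ((2 - real CARD('n)) / 4 * \<mu> c x + C) * u + b c x)"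
      and det: "\<And>c x u. c \<in> A \<Longrightarrow> x \<in> chart_range c \<Longrightarrow> u \<in> J \<Longrightarrow> (2 - real CARD('n)) / 4 * laplacian g \<mu> c x * u + laplacian g b c x
         + (((2 - real CARD('n)) / 4 * \<mu> c x + C) * u + b c x) * f' u = ((2 - real CARD('n)) / 4 * \<mu> c x + C - \<mu> c x) * f u"
      by auto
    have det': "(2 - real CARD('n)) / 4 * laplacian g \<mu> c x * u + laplacian g b c x + b c x * f' u
        + (((2 - real CARD('n)) / 4 * \<mu> c x + C) * (p - 1) + \<mu> c x) * f u = 0"
      if "c \<in> A" "x \<in> chart_range c" "u \<in> J" for c x u
      using det[OF that] f'(2)[OF that(3)] by (simp only: distrib_right mult.assoc) (simp add: algebra_simps)
    have a: "((2 - real CARD('n)) / 4 * \<mu> c x + C) * (p - 1) + \<mu> c x = 0" (is ?a)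
      and b2: "if p = 2 then (2 - real CARD('n)) / 4 * laplacian g \<mu> c x + 2 * b c x = 0 else b c x = 0" (is ?b)
      if "c \<in> A" "x \<in> chart_range c" for c x
    proof -
      note det'' = det'[OF that]
      have "?a \<and> ?b"
      proof (cases "p = 2")
        case True
        have fu: "f u = u ^ 2" if "u \<in> J" for u using power_function_on_2[of J f u] f True that by simp
        have "((\<lambda>u. u ^ 2) has_real_derivative 2 * u) (at u)" for u :: real
          by (auto intro!: derivative_eq_intros)
        then have "(f has_real_derivative 2 * u) (at u)" if "u \<in> J" for u
          using has_field_derivative_transform_within_open[OF _ oJ that, of "\<lambda>u. u ^ 2"] fu by simp
        then have fu': "f' u = 2 * u" if "u \<in> J" for u using f'(1)[OF that] DERIV_unique that by blast
        have "((2 - real CARD('n)) / 4 * laplacian g \<mu> c x + 2 * b c x) * u + laplacian g b c x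
           + (((2 - real CARD('n)) / 4 * \<mu> c x + C) * (p - 1) + \<mu> c x) * u ^ 2 = 0" if "u \<in> J" for u
          using det''[OF that] unfolding fu[OF that] fu'[OF that] by (simp add: algebra_simps)
        from quadratic_zero(1,3)[OF J this] show ?thesis using True by simp
      next
        case False
        from power_linear_independent(3,4)[OF J p(1,2) this f' f0 det''] show ?thesis using False by simp
      qed
      then show ?a ?b by blast+
    qed
    define m where "m = - C * (p - 1) / ((2 - real CARD('n)) / 4 * (p - 1) + 1)"
    have \<mu>: "\<mu> c x = m" if "c \<in> A" "x \<in> chart_range c" for c x
    proof -
      have "\<mu> c x * ((2 - real CARD('n)) / 4 * (p - 1) + 1) = - C * (p - 1)" using a[OF that] by (simp add: algebra_simps)
      then show ?thesis unfolding m_def using r by (metis nonzero_mult_div_cancel_right)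
    qed
    have b: "b c x = 0" if "c \<in> A" "x \<in> chart_range c" for c x
      using b2[OF that] laplacian_const[OF that, of \<mu>, OF \<mu>[OF that(1)]] by (auto split: if_splits)
    have "homothety A g \<xi> m"
      unfolding homothety_def by (rule conformal_killing_field_cong[OF \<mu> *(1)])
    moreover have "field_eq A J V \<xi> (\<lambda>c x u. m / (1 - p) * u)"
    proof (rule field_eq_cong[THEN iffD1, OF _ *(2)])
      fix c x u assume cx: "c \<in> A" "x \<in> chart_range c"
      have "((2 - real CARD('n)) / 4 * \<mu> c x + C) * (1 - p) = m"
      proof -
        have "y * (1 - p) = - (y * (p - 1))" for y by (simp add: algebra_simps)
        then show ?thesis using a[OF cx] \<mu>[OF cx] by (metis add.commute add_eq_0_iff2)
      qed
      then have "(2 - real CARD('n)) / 4 * \<mu> c x + C = m / (1 - p)" using p(2) by (simp add: eq_divide_eq)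
      then show "((2 - real CARD('n)) / 4 * \<mu> c x + C) * u + b c x = m / (1 - p) * u" by (simp only: b[OF cx])
    qed
    ultimately show ?R by blast
  next
    assume ?R
    then obtain \<xi> m where *: "homothety A g \<xi> m" "field_eq A J V \<xi> (\<lambda>c x u. m / (1 - p) * u)" by blast
    \<comment> \<open>Chosen so that (2 - n) m / 4 + C is the prescribed coefficient m / (1 -
      p).\<close>
    define C where "C = m / (1 - p) - (2 - real CARD('n)) / 4 * m"
    have z: "(2 - real CARD('n)) / 4 * m + C = m / (1 - p)" by (simp add: C_def)
    show "lie_point_symmetry A g J f V"
    proof (rule lie_point_symmetryI[OF J f'(1) V *(1)[unfolded homothety_def], where C=C and b="\<lambda>_ _. 0"])
      show "field_eq A J V \<xi> (\<lambda>c x u. ((2 - real CARD('n)) / 4 * m + C) * u + 0)"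
        unfolding z using *(2) by simp
      fix c x u assume cx: "c \<in> A" "x \<in> chart_range c" and u: "u \<in> J"
      have "m / (1 - p) * (u * f' u) = (m / (1 - p) - m) * f u"
        unfolding f'(2)[OF u] using p(2) by (simp add: field_simps)
      then show "(2 - real CARD('n)) / 4 * laplacian g (\<lambda>c x. m) c x * u + laplacian g (\<lambda>_ _. 0) c x
          + (((2 - real CARD('n)) / 4 * m + C) * u + 0) * f' u = ((2 - real CARD('n)) / 4 * m + C - m) * f u"
        unfolding z using laplacian_const[OF cx, of "\<lambda>_ _. m"] laplacian_const[OF cx, of "\<lambda>_ _. 0"]
        by (simp add: mult.assoc)
    qed
  qed
qed

text \<open>At this exponent (2 - n) (p - 1) / 4 = -1, so \<mu> cancels from the coefficient of f
  and only C = 0 follows: non-constant factors survive, subject to \<Delta>\<mu> = 0 from the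
  coefficient of u. The dimension 6 is excluded because there p = 2 and independence fails.\<close>

lemma symmetries_critical_power:
  assumes p: "p = (real CARD('n) + 2) / (real CARD('n) - 2)" and n6: "CARD('n) \<noteq> 6"
    and J: "open_interval J" and f: "power_function_on p J f" and V: "smooth_point_field A J V"
  shows "lie_point_symmetry A g J f V \<longleftrightarrow>
         (\<exists>\<xi> \<mu>. conformal_killing_field A g \<xi> \<mu> \<and> vanishes A (laplacian g \<mu>) \<and>
            field_eq A J V \<xi> (\<lambda>c x u. (2 - real CARD('n)) / 4 * \<mu> c x * u))"
    (is "_ = ?R")
proof -
  have oJ: "open J" using J by (simp add: open_interval_def)
  have p0: "p \<noteq> 0" "p \<noteq> 1" "p \<noteq> 2" using n_ge_3 n6 by (auto simp: p field_simps)
  have expand: "k * y * (p * z) = (k * (p - 1) * y + k * y) * z" for k y z :: real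
    by (simp add: algebra_simps)
  have r: "(2 - real CARD('n)) / 4 * (p - 1) = - 1" using n_ge_3 by (simp add: p field_simps)
  obtain f' where f': "\<And>u. u \<in> J \<Longrightarrow> (f has_real_derivative f' u) (at u)" "\<And>u. u \<in> J \<Longrightarrow> u * f' u = p * f u"
    using power_function_on_derivative(1)[OF oJ p0(1) f] by blast
  note f0 = power_function_on_derivative(2)[OF oJ p0(1) f]
  show ?thesis
  proof
    assume "lie_point_symmetry A g J f V"
    from lie_point_symmetryD[OF J f'(1) this]
    obtain \<xi> \<mu> b C where *: "conformal_killing_field A g \<xi> \<mu>"
      "field_eq A J V \<xi> (\<lambda>c x u. ((2 - real CARD('n)) / 4 * \<mu> c x + C) * u + b c x)"
      and det: "\<And>c x u. c \<in> A \<Longrightarrow> x \<in> chart_range c \<Longrightarrow> u \<in> J \<Longrightarrow> (2 - real CARD('n)) / 4 * laplacian g \<mu> c x * u + laplacian g b c x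
         + (((2 - real CARD('n)) / 4 * \<mu> c x + C) * u + b c x) * f' u = ((2 - real CARD('n)) / 4 * \<mu> c x + C - \<mu> c x) * f u"
      by auto
    have det': "(2 - real CARD('n)) / 4 * laplacian g \<mu> c x * u + laplacian g b c x + b c x * f' u
        + (((2 - real CARD('n)) / 4 * \<mu> c x + C) * (p - 1) + \<mu> c x) * f u = 0"
      if "c \<in> A" "x \<in> chart_range c" "u \<in> J" for c x u
      using det[OF that] f'(2)[OF that(3)] by (simp only: distrib_right mult.assoc) (simp add: algebra_simps)
    have m: "laplacian g \<mu> c x = 0" and b: "b c x = 0" and C: "C = 0"
      if "c \<in> A" "x \<in> chart_range c" for c x
    proof -
      note z = power_linear_independent[OF J p0 f' f0 det'[OF that]]
      show "laplacian g \<mu> c x = 0" using z(1) n_ge_3 by simp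
      show "b c x = 0" by (rule z(3))
      have "((2 - real CARD('n)) / 4 * \<mu> c x + C) * (p - 1) + \<mu> c x = ((2 - real CARD('n)) / 4 * (p - 1)) * \<mu> c x + C * (p - 1) + \<mu> c x"
        by (simp add: algebra_simps)
      then show "C = 0" using z(4) p0 unfolding r by simp
    qed
    have "field_eq A J V \<xi> (\<lambda>c x u. (2 - real CARD('n)) / 4 * \<mu> c x * u)"
      by (rule field_eq_cong[THEN iffD1, OF _ *(2)]) (simp add: b C)
    then show ?R using *(1) m unfolding vanishes_def by blast
  next
    assume ?R
    then obtain \<xi> \<mu> where *: "conformal_killing_field A g \<xi> \<mu>" "vanishes A (laplacian g \<mu>)"
      "field_eq A J V \<xi> (\<lambda>c x u. (2 - real CARD('n)) / 4 * \<mu> c x * u)" by blast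
    show "lie_point_symmetry A g J f V"
    proof (rule lie_point_symmetryI[OF J f'(1) V *(1), where C=0 and b="\<lambda>_ _. 0"])
      show "field_eq A J V \<xi> (\<lambda>c x u. ((2 - real CARD('n)) / 4 * \<mu> c x + 0) * u + 0)" using *(3) by simp
      fix c x u assume cx: "c \<in> A" "x \<in> chart_range c" and u: "u \<in> J"
      have "(2 - real CARD('n)) / 4 * \<mu> c x * (u * f' u) = ((2 - real CARD('n)) / 4 * (p - 1) * \<mu> c x + (2 - real CARD('n)) / 4 * \<mu> c x) * f u"
        unfolding f'(2)[OF u] by (rule expand)
      then have "(2 - real CARD('n)) / 4 * \<mu> c x * (u * f' u) = ((2 - real CARD('n)) / 4 * \<mu> c x - \<mu> c x) * f u"
        unfolding r by simp
      then show "(2 - real CARD('n)) / 4 * laplacian g \<mu> c x * u + laplacian g (\<lambda>_ _. 0) c x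
          + (((2 - real CARD('n)) / 4 * \<mu> c x + 0) * u + 0) * f' u = ((2 - real CARD('n)) / 4 * \<mu> c x + 0 - \<mu> c x) * f u"
        using *(2) cx laplacian_const[OF cx, of "\<lambda>_ _. 0"] by (simp add: vanishes_def mult.assoc)
    qed
  qed
qed

text \<open>The coefficient of u is 2 b - \<Delta>\<mu>, since f' = 2 u; hence b = \<Delta>\<mu> / 2
  instead of b = 0, and \<Delta>b = 0 becomes the biharmonic condition. In the coefficient of u^2
  the terms in \<mu> cancel and C = 0 remains.\<close>

lemma symmetries_square_dim_6:
  assumes n6: "CARD('n) = 6" and J: "open_interval J" and V: "smooth_point_field A J V"
  shows "lie_point_symmetry A g J (\<lambda>u. u ^ 2) V \<longleftrightarrow>
         (\<exists>\<xi> \<mu>. conformal_killing_field A g \<xi> \<mu> \<and>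
            vanishes A (laplacian g (laplacian g \<mu>)) \<and>
            field_eq A J V \<xi> (\<lambda>c x u. - \<mu> c x * u + 1 / 2 * laplacian g \<mu> c x))"
    (is "_ = ?R")
proof -
  have f': "((\<lambda>u. u ^ 2) has_real_derivative 2 * u) (at u)" for u :: real
    by (auto intro!: derivative_eq_intros)
  have n: "(2 - real CARD('n)) / 4 = - 1" using n6 by simp
  show ?thesis
  proof
    assume "lie_point_symmetry A g J (\<lambda>u. u ^ 2) V"
    from lie_point_symmetryD[OF J f' this]
    obtain \<xi> \<mu> b C where *: "conformal_killing_field A g \<xi> \<mu>" "smooth_function A b"
      "field_eq A J V \<xi> (\<lambda>c x u. (- 1 * \<mu> c x + C) * u + b c x)"
      and det: "\<And>c x u. c \<in> A \<Longrightarrow> x \<in> chart_range c \<Longrightarrow> u \<in> J \<Longrightarrow> - 1 * laplacian g \<mu> c x * u + laplacian g b c x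
         + ((- 1 * \<mu> c x + C) * u + b c x) * (2 * u) = (- 1 * \<mu> c x + C - \<mu> c x) * u ^ 2"
      unfolding n by blast
    have L: "laplacian g \<mu> c x = 2 * b c x + 0" and Lb: "laplacian g b c x = 0" and C: "C = 0"
      if "c \<in> A" "x \<in> chart_range c" for c x
    proof -
      have "(2 * b c x - laplacian g \<mu> c x) * u + laplacian g b c x + C * u ^ 2 = 0" if "u \<in> J" for u
        using det[OF \<open>c \<in> A\<close> \<open>x \<in> chart_range c\<close> that] by (simp add: algebra_simps power2_eq_square)
      from quadratic_zero[OF J this]
      show "laplacian g \<mu> c x = 2 * b c x + 0" "laplacian g b c x = 0" "C = 0" by auto
    qed
    have "laplacian g (laplacian g \<mu>) c x = 0" if "c \<in> A" "x \<in> chart_range c" for c x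
    proof -
      have "smooth_on (chart_range c) (b c)" using *(2) that by (simp add: smooth_function_def)
      from laplacian_affine[where m=b and a="laplacian g \<mu>", OF open_chart_range[OF that(1)] that(2) this L[OF that(1)]]
      show ?thesis using Lb[OF that] by simp
    qed
    moreover have "field_eq A J V \<xi> (\<lambda>c x u. - \<mu> c x * u + 1 / 2 * laplacian g \<mu> c x)"
      by (rule field_eq_cong[THEN iffD1, OF _ *(3)]) (simp add: L C)
    ultimately show ?R using *(1) unfolding vanishes_def by blast
  next
    assume ?R
    then obtain \<xi> \<mu> where *: "conformal_killing_field A g \<xi> \<mu>" "vanishes A (laplacian g (laplacian g \<mu>))"
      "field_eq A J V \<xi> (\<lambda>c x u. - \<mu> c x * u + 1 / 2 * laplacian g \<mu> c x)" by blast
    define b :: "('a,'n) scalar_comps" where "b = (\<lambda>c x. 1 / 2 * laplacian g \<mu> c x)"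
    have Lb: "laplacian g b c x = 0" if "c \<in> A" "x \<in> chart_range c" for c x
    proof -
      \<comment> \<open>Smoothness of \<Delta>\<mu> / 2 is read off from the smooth field itself,
        whose constant term in u it is, rather than from the coefficients of the Laplacian.\<close>
      have "smooth_on (chart_range c \<times> J) (snd (V c))" using V that by (simp add: smooth_point_field_def)
      moreover have "\<forall>y\<in>chart_range c. \<forall>w\<in>J. snd (V c) (y, w) = - \<mu> c y * w + b c y"
        using *(3) that by (simp add: field_eq_def b_def)
      ultimately have "smooth_on (chart_range c) (b c)"
        by (rule jet_domain.smooth_on_affine_coefficients(2)[OF jet_domain[OF that(1) J]])
      then have "laplacian g (laplacian g \<mu>) c x = 2 * laplacian g b c x"
        by (rule laplacian_affine[where C=0, OF open_chart_range[OF that(1)] that(2)]) (simp add: b_def)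
      then show ?thesis using *(2) that by (simp add: vanishes_def)
    qed
    show "lie_point_symmetry A g J (\<lambda>u. u ^ 2) V"
    proof (rule lie_point_symmetryI[OF J f' V *(1), where C=0 and b=b])
      show "field_eq A J V \<xi> (\<lambda>c x u. ((2 - real CARD('n)) / 4 * \<mu> c x + 0) * u + b c x)"
        unfolding n using *(3) by (simp add: b_def)
      fix c x u assume cx: "c \<in> A" "x \<in> chart_range c"
      show "(2 - real CARD('n)) / 4 * laplacian g \<mu> c x * u + laplacian g b c x
          + (((2 - real CARD('n)) / 4 * \<mu> c x + 0) * u + b c x) * (2 * u) = ((2 - real CARD('n)) / 4 * \<mu> c x + 0 - \<mu> c x) * u ^ 2"
        unfolding n Lb[OF cx] by (simp add: b_def algebra_simps power2_eq_square)
    qed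
  qed
qed

end

theorem theorem1:
  fixes X :: "'a topology" and A :: "('a,'n::finite) chart set"
    and g :: "('a,'n) metric_comps" and n :: nat
  assumes "smooth_manifold X A" and "connected_space X"
    and "pseudo_riemannian_metric A g"
    and "n = CARD('n)" and "n \<ge> 3"
  shows
    "(\<forall>V. smooth_point_field A UNIV V \<longrightarrow>
        ((\<forall>f. smooth_on UNIV f \<longrightarrow> lie_point_symmetry A g UNIV f V) \<longleftrightarrow>
         (\<exists>\<xi>. killing_field A g \<xi> \<and> field_eq A UNIV V \<xi> (\<lambda>c x u. 0))))
   \<and>
     (\<forall>V. smooth_point_field A UNIV V \<longrightarrow>
        (lie_point_symmetry A g UNIV (\<lambda>u. 0) V \<longleftrightarrow>
         (\<exists>\<xi> \<mu> b C. conformal_killing_field A g \<xi> \<mu> \<and> smooth_function A b \<and>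
            vanishes A (laplacian g b) \<and> vanishes A (laplacian g \<mu>) \<and>
            field_eq A UNIV V \<xi> (\<lambda>c x u. ((2 - real n) / 4 * \<mu> c x + C) * u + b c x))))
   \<and>
     (\<forall>k V. k \<noteq> 0 \<longrightarrow> smooth_point_field A UNIV V \<longrightarrow>
        (lie_point_symmetry A g UNIV (\<lambda>u. k) V \<longleftrightarrow>
         (\<exists>\<xi> b C.
            conformal_killing_field A g \<xi>
              (\<lambda>c x. 4 / (real n + 2) * (C - 1 / k * laplacian g b c x)) \<and>
            smooth_function A b \<and> vanishes A (laplacian g (laplacian g b)) \<and>
            field_eq A UNIV V \<xi> (\<lambda>c x u.
              ((real n - 2) / (real n + 2) * (1 / k * laplacian g b c x - C) + C) * u + b c x))))
   \<and>
     (\<forall>V. smooth_point_field A UNIV V \<longrightarrow>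
        (lie_point_symmetry A g UNIV (\<lambda>u. u) V \<longleftrightarrow>
         (\<exists>\<xi> \<mu> b C. conformal_killing_field A g \<xi> \<mu> \<and> smooth_function A b \<and>
            vanishes A (\<lambda>c x. laplacian g b c x + b c x) \<and>
            vanishes A (\<lambda>c x. (2 - real n) / 4 * laplacian g \<mu> c x + \<mu> c x) \<and>
            field_eq A UNIV V \<xi> (\<lambda>c x u. ((2 - real n) / 4 * \<mu> c x + C) * u + b c x))))
   \<and>
     (\<forall>V. smooth_point_field A UNIV V \<longrightarrow>
        (lie_point_symmetry A g UNIV exp V \<longleftrightarrow>
         (\<exists>\<xi> m. homothety A g \<xi> m \<and> field_eq A UNIV V \<xi> (\<lambda>c x u. - m))))
   \<and>
     (\<forall>p J f V. p \<noteq> 0 \<longrightarrow> p \<noteq> 1 \<longrightarrow> p \<noteq> (real n + 2) / (real n - 2) \<longrightarrow>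
        open_interval J \<longrightarrow> power_function_on p J f \<longrightarrow> smooth_point_field A J V \<longrightarrow>
        (lie_point_symmetry A g J f V \<longleftrightarrow>
         (\<exists>\<xi> m. homothety A g \<xi> m \<and> field_eq A J V \<xi> (\<lambda>c x u. m / (1 - p) * u))))
   \<and>
     (\<forall>p J f V. p = (real n + 2) / (real n - 2) \<longrightarrow> n \<noteq> 6 \<longrightarrow>
        open_interval J \<longrightarrow> power_function_on p J f \<longrightarrow> smooth_point_field A J V \<longrightarrow>
        (lie_point_symmetry A g J f V \<longleftrightarrow>
         (\<exists>\<xi> \<mu>. conformal_killing_field A g \<xi> \<mu> \<and> vanishes A (laplacian g \<mu>) \<and>
            field_eq A J V \<xi> (\<lambda>c x u. (2 - real n) / 4 * \<mu> c x * u))))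
   \<and>
     (\<forall>J V. n = 6 \<longrightarrow> open_interval J \<longrightarrow> smooth_point_field A J V \<longrightarrow>
        (lie_point_symmetry A g J (\<lambda>u. u ^ 2) V \<longleftrightarrow>
         (\<exists>\<xi> \<mu>. conformal_killing_field A g \<xi> \<mu> \<and>
            vanishes A (laplacian g (laplacian g \<mu>)) \<and>
            field_eq A J V \<xi> (\<lambda>c x u. - \<mu> c x * u + 1 / 2 * laplacian g \<mu> c x))))"
proof -
  interpret connected_pseudo_riemannian_manifold X A g
    using assms by unfold_locales simp_all
  note n = assms(4)
  show ?thesis
    unfolding n
    by (intro conjI allI impI symmetries_all symmetries_zero symmetries_constant symmetries_linear
        symmetries_exp symmetries_power symmetries_critical_power symmetries_square_dim_6)
qed

end
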